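(* Let $\mathbb{K}=\mathbb{R}$ or $\mathbb{C}$ and $G=\mathrm{SL}(3,\mathbb{K})$, with $G/P=\mathcal{FL}(3,\mathbb{K})$ the space of complete flags. A section $$s:(\mathfrak{a}^* )^{w_0}\cong\mathbb{R}\longrightarrow NH^2_m(G\curvearrowright\mathcal{FL}(3,\mathbb{K}))$$ of the map $q:NH^2_m(G\curvearrowright \mathcal{FL}(3,\mathbb{K}))\to(\mathfrak{a}^* )^{w_0}$ (that is, a map with $q\circ s=\mathrm{id}$) is given by sending a $w_0$-invariant linear form $\alpha_{\mathfrak{a}}\in(\mathfrak{a}^* )^{w_0}$ to the class of the measurable, almost everywhere defined, alternating $G$-invariant cocycle $$s(\alpha_{\mathfrak a}):(\mathcal{FL}(3,\mathbb{K}))^3\to\mathbb{R},\qquad (F_0,F_1,F_2)\mapsto\alpha_{\mathfrak{a}}(\log|\tau(F_0,F_1,F_2)|),$$ where $\tau$ is the triple ratio.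
   Context: Group notation. $P<G$ is the group of upper triangular matrices, $A<P$ the diagonal matrices with positive real entries, $\mathfrak{a}$ its Lie algebra (real traceless diagonal matrices), $N$ the upper triangular unipotent matrices, $K=\mathrm{SO}(3)$ if $\mathbb{K}=\mathbb{R}$ and $K=\mathrm{SU}(3)$ if $\mathbb{K}=\mathbb{C}$, $M=Z_K(\mathfrak{a})$; the longest Weyl element is represented by the matrix $w_0$ with rows $(0,0,-1),(0,1,0),(1,0,0)$. The map $\pi_A:G\to A$ is $g=ank\mapsto a$ for the Iwasawa decomposition $G=ANK$. Let $e_2^*\in\mathfrak{a}^*$ be the functional giving the second diagonal entry. Then $(\mathfrak{a}^* )^{w_0}=\mathbb{R}e_2^*$, identified with $\mathbb{R}$ by $\lambda e_2^*\leftrightarrow\lambda$; for $\alpha_{\mathfrak a}=\lambda e_2^*$ and $t\in\mathbb{R}$ the notation $\alpha_{\mathfrak{a}}(t)$ means $\lambda t$. Flags and triple ratio. A complete flag is a pair $F=(p,\ell)$ with $p\in P^2(\mathbb{K})$ a point on the line $\ell\subset P^2(\mathbb{K})$. Flags $F_i=(p_i,\ell_i)$ are in general position if no three of the points (with distinct indices) are aligned, no three of the lines (with distinct indices) meet in a common point, and $p_i\notin\ell_j$ for $i\neq j$; this is a full measure condition. For a triple in general position $$\tau(F_0,F_1,F_2)=-[\ell_0\cap\ell_1,\ \ell_1\cap\ell_2,\ p_1,\ \ell_1\cap p_0p_2]_{\ell_1}\in\mathbb{K}^*\setminus\{-1\},$$ where $p_0p_2$ is the line through $p_0,p_2$ and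 $[x_0,x_1,x_2,x_3]=\frac{(x_2-x_0)(x_3-x_1)}{(x_2-x_1)(x_3-x_0)}$ is the cross ratio on the projective line $\ell_1$. Cohomology. For a homogeneous $G$-space $X$, $H^*_m(G\curvearrowright X)$ is the cohomology of the complex $L^0(X^{*+1},\mathbb{R})^G$ ($G$-invariant measurable functions modulo a.e. equality) with its homogeneous differential, and $H^*_m(G)$ is the cohomology of $L^0(G^{*+1},\mathbb{R})^G$. Evaluation on a generic base point induces $ev:H^*_m(G\curvearrowright G/P)\to H^*_m(G)$, and $NH^*_m(G\curvearrowright G/P)=\ker(ev)$. The map $q$ (Monod). Let $C^{p,q}=L^0(G^{p+1},L^0((G/P)^q))^G$, with $d^\uparrow:C^{p,q}\to C^{p+1,q}$ the homogeneous differential in the $G$ variables and $d^\rightarrow:C^{p,q}\to C^{p,q+1}$ equal to $(-1)^{p+1}$ times the homogeneous differential in the $G/P$ variables. Consider the spectral sequence with $E_1^{p,q}=H^p(C^{*,q},d^\uparrow)$ and $d_1=d^\rightarrow$; $d_r[\gamma_0]$ is represented by $d^\rightarrow\gamma_{r-1}$ where $\gamma_j\in C^{p-j,q+j}$ satisfy $d^\rightarrow\gamma_{j-1}=d^\uparrow\gamma_j$. One has $E_2^{1,1}\cong H^1_m(A)^{w_0}$ and $E_2^{0,3}\cong H^2_m(G\curvearrowright G/P)$. $H^1_m(A)^{w_0}$ is identified with $(\mathfrak{a}^* )^{w_0}$ by sending $\alpha_{\mathfrak a}$ to the class of the homogeneous cocycle $\alpha(a_0,a_1)=\alpha_{\mathfrak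 a}(\log(a_0^{-1}a_1))$, represented in $C^{1,1}$ by $(g_0,g_1)(hP)\mapsto\alpha(\pi_A(h^{-1}g_0),\pi_A(h^{-1}g_1))$. In degree 2 the differential $d_2:E_2^{1,1}\to E_2^{0,3}$ is an isomorphism $(\mathfrak{a}^* )^{w_0}\to NH^2_m(G\curvearrowright G/P)$; the map $q$ is its inverse. *)

theory Defs
  imports "HOL-Analysis.Analysis"
begin

section \<open>The ground field\<close>

text \<open>By Frobenius and Gelfand--Mazur, the only fields in this class are, up to isometric
  isomorphism, the real and the complex numbers; the class only serves to develop both cases at
  once.\<close>

class rc_field = real_normed_field + euclidean_space

instance real :: rc_field ..
instance complex :: rc_field ..

definition re_part :: "'k::rc_field \<Rightarrow> real" where
  "re_part z = inner z 1"

definition conj_rc :: "'k::rc_field \<Rightarrow> 'k" where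
  "conj_rc z = of_real (2 * re_part z) - z"

lemma re_part_real: "re_part (x::real) = x"
  by (simp add: re_part_def)

lemma re_part_complex: "re_part (z::complex) = Re z"
  by (simp add: re_part_def inner_complex_def)

lemma conj_rc_real: "conj_rc (x::real) = x"
  by (simp add: conj_rc_def re_part_real)

lemma conj_rc_complex: "conj_rc (z::complex) = cnj z"
  by (simp add: conj_rc_def re_part_complex complex_eq_iff)


section \<open>The group and its subgroups\<close>

definition SL3 :: "('k::rc_field^3^3) set" where
  "SL3 = {g. det g = 1}"

definition diagonal :: "'k::rc_field^3^3 \<Rightarrow> bool" where
  "diagonal X \<longleftrightarrow> (\<forall>i j. i \<noteq> j \<longrightarrow> X $ i $ j = 0)"

definition upper_triangular3 :: "'k::rc_field^3^3 \<Rightarrow> bool" where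
  "upper_triangular3 g \<longleftrightarrow> g $ 2 $ 1 = 0 \<and> g $ 3 $ 1 = 0 \<and> g $ 3 $ 2 = 0"

definition borel_P :: "('k::rc_field^3^3) set" where
  "borel_P = {g \<in> SL3. upper_triangular3 g}"

definition torus_A :: "('k::rc_field^3^3) set" where
  "torus_A = {a \<in> SL3. diagonal a \<and> (\<forall>i. \<exists>t>0. a $ i $ i = of_real t)}"

definition unipotent_N :: "('k::rc_field^3^3) set" where
  "unipotent_N = {n. upper_triangular3 n \<and> (\<forall>i. n $ i $ i = 1)}"

definition compact_K :: "('k::rc_field^3^3) set" where
  "compact_K = {k \<in> SL3. k ** (\<chi> i j. conj_rc (k $ j $ i)) = mat 1}"

definition pi_A :: "'k::rc_field^3^3 \<Rightarrow> 'k^3^3" where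
  "pi_A g = (THE a. a \<in> torus_A \<and> (\<exists>n\<in>unipotent_N. \<exists>k\<in>compact_K. g = a ** n ** k))"

definition log_A :: "'k::rc_field^3^3 \<Rightarrow> 'k^3^3" where
  "log_A a = (\<chi> i j. if i = j then of_real (ln (re_part (a $ i $ i))) else 0)"

definition lie_a :: "('k::rc_field^3^3) set" where
  "lie_a = {X. diagonal X \<and> (\<forall>i. X $ i $ i \<in> \<real>) \<and> trace X = 0}"

definition w0 :: "'k::rc_field^3^3" where
  "w0 = vector [vector [0, 0, -1], vector [0, 1, 0], vector [1, 0, 0]]"

text \<open>Linear forms on \<open>lie_a\<close> are taken extensional, so that equality of such functions is equality
  of forms.\<close>

definition lie_a_dual :: "('k::rc_field^3^3 \<Rightarrow> real) set" where
  "lie_a_dual = {\<phi> \<in> extensional lie_a.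
     (\<forall>X\<in>lie_a. \<forall>Y\<in>lie_a. \<phi> (X + Y) = \<phi> X + \<phi> Y) \<and>
     (\<forall>c. \<forall>X\<in>lie_a. \<phi> (c *\<^sub>R X) = c * \<phi> X)}"

definition lie_a_dual_w0 :: "('k::rc_field^3^3 \<Rightarrow> real) set" where
  "lie_a_dual_w0 = {\<phi> \<in> lie_a_dual. \<forall>X\<in>lie_a. \<phi> (w0 ** X ** matrix_inv w0) = \<phi> X}"

definition e2_form :: "'k::rc_field^3^3 \<Rightarrow> real" where
  "e2_form = (\<lambda>X\<in>lie_a. re_part (X $ 2 $ 2))"

definition form_coeff :: "('k::rc_field^3^3 \<Rightarrow> real) \<Rightarrow> real" where
  "form_coeff \<phi> = (THE c. \<phi> = (\<lambda>X\<in>lie_a. c * e2_form X))"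

definition form_at :: "('k::rc_field^3^3 \<Rightarrow> real) \<Rightarrow> real \<Rightarrow> real" where
  "form_at \<phi> t = form_coeff \<phi> * t"


section \<open>Flags and the triple ratio\<close>

definition proj_points :: "('k::rc_field^3) set set" where
  "proj_points = {p. vec.subspace p \<and> vec.dim p = 1}"

definition proj_lines :: "('k::rc_field^3) set set" where
  "proj_lines = {l. vec.subspace l \<and> vec.dim l = 2}"

type_synonym 'k flag = "('k^3) set \<times> ('k^3) set"

definition flags :: "('k::rc_field flag) set" where
  "flags = {(p, l). p \<in> proj_points \<and> l \<in> proj_lines \<and> p \<subseteq> l}"

definition flag_act :: "'k::rc_field^3^3 \<Rightarrow> 'k flag \<Rightarrow> 'k flag" where
  "flag_act g F = ((\<lambda>v. g *v v) ` fst F, (\<lambda>v. g *v v) ` snd F)"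

text \<open>The coset \<open>g P\<close> is identified with
  the flag \<open>flag_act g std_flag\<close>.\<close>

definition std_flag :: "'k::rc_field flag" where
  "std_flag = (vec.span {axis 1 1}, vec.span {axis 1 1, axis 2 1})"

lemma span_axis_1: "vec.span {axis 1 1 :: 'k::rc_field^3} = {v. v $ 2 = 0 \<and> v $ 3 = 0}"
proof -
  have "v \<in> range (\<lambda>k. k *s axis 1 1)" if "v $ 2 = 0" "v $ 3 = 0" for v :: "'k^3"
    using that by (intro image_eqI[where x = "v $ 1"]) (auto simp: vec_eq_iff forall_3 axis_def)
  then show ?thesis
    by (auto simp: vec.span_singleton axis_def)
qed

lemma span_axis_12: "vec.span {axis 1 1, axis 2 1 :: 'k::rc_field^3} = {v. v $ 3 = 0}"
proof -
  have "v = (v $ 1) *s axis 1 1 + (v $ 2) *s axis 2 1" if "v $ 3 = 0" for v :: "'k^3"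
    using that by (simp add: vec_eq_iff forall_3 axis_def)
  then have "v \<in> vec.span {axis 1 1, axis 2 1}" if "v $ 3 = 0" for v :: "'k^3"
    using that by (metis insertCI vec.span_add vec.span_base vec.span_scale)
  moreover have "vec.span {axis 1 1, axis 2 1 :: 'k^3} \<subseteq> {v. v $ 3 = 0}"
    by (rule vec.span_minimal) (auto simp: axis_def vec.subspace_def)
  ultimately show ?thesis by auto
qed

lemma borel_P_eq_stabilizer:
  "(borel_P :: ('k::rc_field^3^3) set) = {g \<in> SL3. flag_act g std_flag = std_flag}"
proof (intro set_eqI iffI)
  fix g :: "'k^3^3"
  assume "g \<in> {g \<in> SL3. flag_act g std_flag = std_flag}"
  then have g: "g \<in> SL3" "(*v) g ` {v. v $ 2 = 0 \<and> v $ 3 = 0} = {v. v $ 2 = 0 \<and> v $ 3 = 0}"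
    "(*v) g ` {v. v $ 3 = 0} = {v. v $ 3 = 0}"
    by (auto simp: flag_act_def std_flag_def span_axis_1 span_axis_12)
  have "g *v axis 1 1 \<in> {v. v $ 2 = 0 \<and> v $ 3 = 0}" "g *v axis 2 1 \<in> {v. v $ 3 = 0}"
    using g(2,3) by (auto simp: axis_def)
  then show "g \<in> borel_P"
    using g(1) by (simp add: borel_P_def upper_triangular3_def matrix_vector_mult_def sum_3 axis_def)
next
  fix g :: "'k^3^3"
  assume "g \<in> borel_P"
  then have d: "det g = 1" and u: "g $ 2 $ 1 = 0" "g $ 3 $ 1 = 0" "g $ 3 $ 2 = 0"
    by (auto simp: borel_P_def SL3_def upper_triangular3_def)
  have nz: "g $ 2 $ 2 \<noteq> 0" "g $ 3 $ 3 \<noteq> 0"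
    using d u by (auto simp: det_3)
  obtain h where h: "g ** h = mat 1"
    using d invertible_det_nz[of g] by (auto simp: invertible_def)
  have gh: "g *v (h *v v) = v" for v
    by (simp add: h matrix_vector_mul_assoc)
  have comp: "(g *v w) $ 2 = g $ 2 $ 2 * w $ 2 + g $ 2 $ 3 * w $ 3"
    "(g *v w) $ 3 = g $ 3 $ 3 * w $ 3" for w
    by (simp_all add: matrix_vector_mult_def sum_3 u)
  have w3: "w $ 3 = 0" if "(g *v w) $ 3 = 0" for w
    using that nz by (simp add: comp)
  have w2: "w $ 2 = 0" if "(g *v w) $ 3 = 0" "(g *v w) $ 2 = 0" for w
    using that w3[of w] nz by (simp add: comp)
  have "(*v) g ` {v. v $ 3 = 0} = {v. v $ 3 = 0}"
  proof (intro equalityI subsetI)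
    fix v :: "'k^3" assume "v \<in> {v. v $ 3 = 0}"
    then show "v \<in> (*v) g ` {v. v $ 3 = 0}"
      using gh[of v] w3[of "h *v v"] by (intro image_eqI[where x = "h *v v"]) auto
  qed (auto simp: comp)
  moreover have "(*v) g ` {v. v $ 2 = 0 \<and> v $ 3 = 0} = {v. v $ 2 = 0 \<and> v $ 3 = 0}"
  proof (intro equalityI subsetI)
    fix v :: "'k^3" assume "v \<in> {v. v $ 2 = 0 \<and> v $ 3 = 0}"
    then show "v \<in> (*v) g ` {v. v $ 2 = 0 \<and> v $ 3 = 0}"
      using gh[of v] w3[of "h *v v"] w2[of "h *v v"]
      by (intro image_eqI[where x = "h *v v"]) auto
  qed (auto simp: comp)
  ultimately show "g \<in> {g \<in> SL3. flag_act g std_flag = std_flag}"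
    using d by (simp add: SL3_def flag_act_def std_flag_def span_axis_1 span_axis_12)
qed

definition general_position :: "nat \<Rightarrow> (nat \<Rightarrow> 'k::rc_field flag) \<Rightarrow> bool" where
  "general_position n F \<longleftrightarrow>
     (\<forall>i<n. \<forall>j<n. \<forall>k<n. i \<noteq> j \<and> j \<noteq> k \<and> i \<noteq> k \<longrightarrow>
        \<not> (\<exists>l\<in>proj_lines. fst (F i) \<subseteq> l \<and> fst (F j) \<subseteq> l \<and> fst (F k) \<subseteq> l) \<and>
        \<not> (\<exists>p\<in>proj_points. p \<subseteq> snd (F i) \<and> p \<subseteq> snd (F j) \<and> p \<subseteq> snd (F k))) \<and>
     (\<forall>i<n. \<forall>j<n. i \<noteq> j \<longrightarrow> \<not> fst (F i) \<subseteq> snd (F j))"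

text \<open>The cross ratio of four points of the projective line \<open>l\<close>, computed in an affine
  coordinate \<open>x \<mapsto> [x u + v]\<close> in which none of the four points is at infinity. It does
  not depend on the coordinate.\<close>

definition cross_ratio ::
  "('k::rc_field^3) set \<Rightarrow> ('k^3) set \<Rightarrow> ('k^3) set \<Rightarrow> ('k^3) set \<Rightarrow> ('k^3) set \<Rightarrow> 'k" where
  "cross_ratio l X0 X1 X2 X3 =
     (THE c. \<exists>u v x0 x1 x2 x3. l \<in> proj_lines \<and> vec.span {u, v} = l \<and>
        X0 = vec.span {x0 *s u + v} \<and> X1 = vec.span {x1 *s u + v} \<and>
        X2 = vec.span {x2 *s u + v} \<and> X3 = vec.span {x3 *s u + v} \<and>
        c = ((x2 - x0) * (x3 - x1)) / ((x2 - x1) * (x3 - x0)))"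

definition triple_ratio :: "'k::rc_field flag \<Rightarrow> 'k flag \<Rightarrow> 'k flag \<Rightarrow> 'k" where
  "triple_ratio F0 F1 F2 =
     - cross_ratio (snd F1) (snd F0 \<inter> snd F1) (snd F1 \<inter> snd F2) (fst F1)
         (snd F1 \<inter> vec.span (fst F0 \<union> fst F2))"


section \<open>Measure classes on the group and on the flag space\<close>

text \<open>A Haar measure on \<open>SL3\<close>: the image of Lebesgue measure on
  \<open>{m. 0 < |det m| \<le> 1}\<close> under \<open>m \<mapsto> m diag(1/det m, 1, 1)\<close>. Left multiplication
  by an element of \<open>SL3\<close> preserves Lebesgue measure and the determinant and commutes with
  this map, so the image is left invariant; it is finite on compact sets because a compact set
  pulls back to a bounded one.\<close>

definition haar :: "('k::rc_field^3^3) measure" where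
  "haar = distr (restrict_space lborel {m. 0 < norm (det m) \<and> norm (det m) \<le> 1})
     (restrict_space borel SL3)
     (\<lambda>m. \<chi> i j. if j = 1 then m $ i $ j / det m else m $ i $ j)"

text \<open>The flag space carries the quotient Borel structure of \<open>G/P\<close> and a finite measure in
  the unique invariant measure class, namely the image of a finite measure equivalent to
  \<open>haar\<close>. Only the measure class is used.\<close>

definition flag_measure :: "('k::rc_field flag) measure" where
  "flag_measure = distr (density haar (\<lambda>g. ennreal (exp (- (norm g)\<^sup>2))))
     (sigma flags {E. E \<subseteq> flags \<and> {g \<in> SL3. flag_act g std_flag \<in> E} \<in> sets haar})
     (\<lambda>g. flag_act g std_flag)"

abbreviation pow_measure :: "'a measure \<Rightarrow> nat \<Rightarrow> (nat \<Rightarrow> 'a) measure" where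
  "pow_measure M n \<equiv> Pi\<^sub>M {..<n} (\<lambda>_. M)"


section \<open>Measurable cohomology\<close>

text \<open>Functions represent elements of \<open>L\<^sup>0\<close>; equality in \<open>L\<^sup>0\<close> is equality
  almost everywhere. An \<open>n\<close>-cochain is a function of \<open>n + 1\<close> variables.\<close>

definition skip :: "nat \<Rightarrow> nat \<Rightarrow> (nat \<Rightarrow> 'a) \<Rightarrow> nat \<Rightarrow> 'a" where
  "skip n i x = (\<lambda>j\<in>{..<n}. if j < i then x j else x (Suc j))"

definition hdiff :: "nat \<Rightarrow> ((nat \<Rightarrow> 'a) \<Rightarrow> real) \<Rightarrow> (nat \<Rightarrow> 'a) \<Rightarrow> real" where
  "hdiff n f x = (\<Sum>i\<le>n. (-1) ^ i * f (skip n i x))"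

definition translate :: "('g \<Rightarrow> 'a \<Rightarrow> 'a) \<Rightarrow> nat \<Rightarrow> 'g \<Rightarrow> (nat \<Rightarrow> 'a) \<Rightarrow> nat \<Rightarrow> 'a" where
  "translate act n g x = (\<lambda>i\<in>{..<n}. act g (x i))"

definition L0_inv ::
  "('k::rc_field^3^3 \<Rightarrow> 'a \<Rightarrow> 'a) \<Rightarrow> 'a measure \<Rightarrow> nat \<Rightarrow> ((nat \<Rightarrow> 'a) \<Rightarrow> real) set" where
  "L0_inv act M n = {f \<in> borel_measurable (pow_measure M n).
     \<forall>g\<in>SL3. AE x in pow_measure M n. f (translate act n g x) = f x}"

definition cocycles ::
  "('k::rc_field^3^3 \<Rightarrow> 'a \<Rightarrow> 'a) \<Rightarrow> 'a measure \<Rightarrow> nat \<Rightarrow> ((nat \<Rightarrow> 'a) \<Rightarrow> real) set" where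
  "cocycles act M n = {f \<in> L0_inv act M (Suc n).
     AE x in pow_measure M (Suc (Suc n)). hdiff (Suc n) f x = 0}"

definition coboundaries ::
  "('k::rc_field^3^3 \<Rightarrow> 'a \<Rightarrow> 'a) \<Rightarrow> 'a measure \<Rightarrow> nat \<Rightarrow> ((nat \<Rightarrow> 'a) \<Rightarrow> real) set" where
  "coboundaries act M n = {f \<in> L0_inv act M (Suc n).
     if n = 0 then AE x in pow_measure M (Suc n). f x = 0
     else \<exists>h\<in>L0_inv act M n. AE x in pow_measure M (Suc n). f x = hdiff n h x}"

definition cohom_class ::
  "('k::rc_field^3^3 \<Rightarrow> 'a \<Rightarrow> 'a) \<Rightarrow> 'a measure \<Rightarrow> nat \<Rightarrow> ((nat \<Rightarrow> 'a) \<Rightarrow> real) \<Rightarrow>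
     ((nat \<Rightarrow> 'a) \<Rightarrow> real) set" where
  "cohom_class act M n f = {f' \<in> cocycles act M n. (\<lambda>x. f' x - f x) \<in> coboundaries act M n}"

definition Hm ::
  "('k::rc_field^3^3 \<Rightarrow> 'a \<Rightarrow> 'a) \<Rightarrow> 'a measure \<Rightarrow> nat \<Rightarrow> ((nat \<Rightarrow> 'a) \<Rightarrow> real) set set" where
  "Hm act M n = cohom_class act M n ` cocycles act M n"

text \<open>Evaluation on a base point. As the flag space is homogeneous and the orbit map of any base
  point pulls null sets back to null sets, every base point is generic. The union over all
  representatives of a class is the common image class.\<close>

definition ev_cochain ::
  "'k::rc_field flag \<Rightarrow> nat \<Rightarrow> ((nat \<Rightarrow> 'k flag) \<Rightarrow> real) \<Rightarrow> (nat \<Rightarrow> 'k^3^3) \<Rightarrow> real" where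
  "ev_cochain F n f = (\<lambda>g. f (\<lambda>i\<in>{..<Suc n}. flag_act (g i) F))"

definition ev ::
  "nat \<Rightarrow> ((nat \<Rightarrow> 'k::rc_field flag) \<Rightarrow> real) set \<Rightarrow> ((nat \<Rightarrow> 'k^3^3) \<Rightarrow> real) set" where
  "ev n c = (\<Union>f\<in>c. cohom_class (**) haar n (ev_cochain std_flag n f))"

definition NHm :: "nat \<Rightarrow> ((nat \<Rightarrow> 'k::rc_field flag) \<Rightarrow> real) set set" where
  "NHm n = {c \<in> Hm flag_act flag_measure n. ev n c = cohom_class (**) haar n (\<lambda>_. 0)}"


section \<open>The spectral sequence\<close>

text \<open>\<open>C\<^sup>p\<^sup>,\<^sup>q = L\<^sup>0(G\<^sup>p\<^sup>+\<^sup>1, L\<^sup>0((G/P)\<^sup>q))\<^sup>G\<close>. A measurable map into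
  \<open>L\<^sup>0((G/P)\<^sup>q)\<close> (with the topology of convergence in measure) is represented by a curried,
  jointly measurable function; two such functions represent the same element iff they agree for
  almost every \<open>x\<close> at almost every \<open>y\<close>.\<close>

type_synonym 'k bicochain = "(nat \<Rightarrow> 'k^3^3) \<Rightarrow> (nat \<Rightarrow> 'k flag) \<Rightarrow> real"

definition bi_eq :: "nat \<Rightarrow> nat \<Rightarrow> 'k::rc_field bicochain \<Rightarrow> 'k bicochain \<Rightarrow> bool" where
  "bi_eq p q F F' \<longleftrightarrow>
     (AE x in pow_measure haar (Suc p). AE y in pow_measure flag_measure q. F x y = F' x y)"

definition bicochains :: "nat \<Rightarrow> nat \<Rightarrow> 'k::rc_field bicochain set" where
  "bicochains p q = {F.
     case_prod F \<in> borel_measurable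
       (pow_measure haar (Suc p) \<Otimes>\<^sub>M pow_measure flag_measure q) \<and>
     (\<forall>g\<in>SL3. bi_eq p q
       (\<lambda>x y. F (translate (**) (Suc p) g x) (translate flag_act q g y)) F)}"

definition d_up :: "nat \<Rightarrow> 'k::rc_field bicochain \<Rightarrow> 'k bicochain" where
  "d_up p F = (\<lambda>x y. hdiff (Suc p) (\<lambda>x'. F x' y) x)"

definition d_right :: "nat \<Rightarrow> nat \<Rightarrow> 'k::rc_field bicochain \<Rightarrow> 'k bicochain" where
  "d_right p q F = (\<lambda>x y. (-1) ^ (p + 1) * hdiff q (F x) y)"

definition E1_cocycles :: "nat \<Rightarrow> nat \<Rightarrow> 'k::rc_field bicochain set" where
  "E1_cocycles p q = {F \<in> bicochains p q. bi_eq (Suc p) q (d_up p F) (\<lambda>_ _. 0)}"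

definition E1_coboundaries :: "nat \<Rightarrow> nat \<Rightarrow> 'k::rc_field bicochain set" where
  "E1_coboundaries p q = {F \<in> bicochains p q.
     case p of 0 \<Rightarrow> bi_eq p q F (\<lambda>_ _. 0)
     | Suc p' \<Rightarrow> \<exists>\<beta>\<in>bicochains p' q. bi_eq p q F (d_up p' \<beta>)}"

text \<open>\<open>E\<^sub>2\<close>, the cohomology of \<open>(E\<^sub>1, d_right)\<close>, is written as a single quotient: its
  cocycles are the \<open>d_up\<close>-cocycles whose class is killed by \<open>d\<^sub>1\<close>, its coboundaries the
  \<open>d_up\<close>-cocycles whose class lies in the image of \<open>d\<^sub>1\<close>.\<close>

definition E2_cocycles :: "nat \<Rightarrow> nat \<Rightarrow> 'k::rc_field bicochain set" where
  "E2_cocycles p q = {F \<in> E1_cocycles p q. d_right p q F \<in> E1_coboundaries p (Suc q)}"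

definition E2_coboundaries :: "nat \<Rightarrow> nat \<Rightarrow> 'k::rc_field bicochain set" where
  "E2_coboundaries p q = {F \<in> E1_cocycles p q.
     case q of 0 \<Rightarrow> F \<in> E1_coboundaries p q
     | Suc q' \<Rightarrow> \<exists>\<zeta>\<in>E1_cocycles p q'.
         (\<lambda>x y. F x y - d_right p q' \<zeta> x y) \<in> E1_coboundaries p q}"

definition E2_class :: "nat \<Rightarrow> nat \<Rightarrow> 'k::rc_field bicochain \<Rightarrow> 'k bicochain set" where
  "E2_class p q F = {F' \<in> E2_cocycles p q. (\<lambda>x y. F' x y - F x y) \<in> E2_coboundaries p q}"

text \<open>The differential \<open>d\<^sub>2\<close> from \<open>E\<^sub>2\<^sup>p\<^sup>+\<^sup>1\<^sup>,\<^sup>q\<close> to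
  \<open>E\<^sub>2\<^sup>p\<^sup>,\<^sup>q\<^sup>+\<^sup>2\<close>. All choices of \<open>\<gamma>\<^sub>0\<close> and \<open>\<gamma>\<^sub>1\<close> give the same
  class, so the union is that class.\<close>

definition d2 :: "nat \<Rightarrow> nat \<Rightarrow> 'k::rc_field bicochain set \<Rightarrow> 'k bicochain set" where
  "d2 p q c = \<Union> {E2_class p (q + 2) (d_right p (q + 1) \<gamma>\<^sub>1) | \<gamma>\<^sub>0 \<gamma>\<^sub>1.
     \<gamma>\<^sub>0 \<in> c \<and> \<gamma>\<^sub>1 \<in> bicochains p (q + 1) \<and>
     bi_eq (p + 1) (q + 1) (d_right (p + 1) q \<gamma>\<^sub>0) (d_up p \<gamma>\<^sub>1)}"


section \<open>The map \<open>q\<close>\<close>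

definition form_cocycle ::
  "('k::rc_field^3^3 \<Rightarrow> real) \<Rightarrow> 'k^3^3 \<Rightarrow> 'k^3^3 \<Rightarrow> real" where
  "form_cocycle \<phi> a0 a1 = \<phi> (log_A (matrix_inv a0 ** a1))"

text \<open>The value does not depend on the representative \<open>h\<close> of the coset: replacing \<open>h\<close> by
  \<open>h b\<close> with \<open>b \<in> P\<close> multiplies both values of \<open>pi_A\<close> by the same element of \<open>A\<close>.\<close>

definition form_bicochain :: "('k::rc_field^3^3 \<Rightarrow> real) \<Rightarrow> 'k bicochain" where
  "form_bicochain \<phi> = (\<lambda>g F.
     let h = (SOME h. h \<in> SL3 \<and> flag_act h std_flag = F 0)
     in form_cocycle \<phi> (pi_A (matrix_inv h ** g 0)) (pi_A (matrix_inv h ** g 1)))"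

text \<open>The identifications of the space of invariant forms with \<open>E\<^sub>2\<^sup>1\<^sup>,\<^sup>1\<close>, and of the
  second cohomology of the action on flags with \<open>E\<^sub>2\<^sup>0\<^sup>,\<^sup>3\<close> (cochains constant in the group
  variable).\<close>

definition form_to_E2 :: "('k::rc_field^3^3 \<Rightarrow> real) \<Rightarrow> 'k bicochain set" where
  "form_to_E2 \<phi> = E2_class 1 1 (form_bicochain \<phi>)"

definition H2_to_E2 :: "((nat \<Rightarrow> 'k::rc_field flag) \<Rightarrow> real) set \<Rightarrow> 'k bicochain set" where
  "H2_to_E2 c = (\<Union>f\<in>c. E2_class 0 3 (\<lambda>_. f))"

definition q_map :: "((nat \<Rightarrow> 'k::rc_field flag) \<Rightarrow> real) set \<Rightarrow> ('k^3^3 \<Rightarrow> real)" where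
  "q_map c = (THE \<phi>. \<phi> \<in> lie_a_dual_w0 \<and> d2 0 1 (form_to_E2 \<phi>) = H2_to_E2 c)"


section \<open>The triple ratio cocycle\<close>

text \<open>The cochain is defined on triples in general position; the value \<open>0\<close> elsewhere is
  irrelevant.\<close>

definition s_cochain ::
  "('k::rc_field^3^3 \<Rightarrow> real) \<Rightarrow> (nat \<Rightarrow> 'k flag) \<Rightarrow> real" where
  "s_cochain \<phi> F = (if general_position 3 F
     then form_at \<phi> (ln (norm (triple_ratio (F 0) (F 1) (F 2)))) else 0)"

definition alternating ::
  "nat \<Rightarrow> 'a set \<Rightarrow> ((nat \<Rightarrow> 'a) \<Rightarrow> real) \<Rightarrow> bool" where
  "alternating n X f \<longleftrightarrow> (\<forall>\<sigma> F. \<sigma> permutes {..<n} \<and> F \<in> {..<n} \<rightarrow>\<^sub>E X \<longrightarrow>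
     f (\<lambda>i\<in>{..<n}. F (\<sigma> i)) = of_int (sign \<sigma>) * f F)"

end

theory Submission
  imports Defs
begin

text \<open>
  Lift a flag to a vector \<open>v\<close> spanning its point and a covector \<open>f\<close> vanishing on its line. Writing the
  cross ratio through the functionals \<open>f\<^sub>0\<close> and \<open>f\<^sub>2\<close> on the line of \<open>F\<^sub>1\<close> gives
  \<open>\<tau> = f\<^sub>0(v\<^sub>1) f\<^sub>1(v\<^sub>2) f\<^sub>2(v\<^sub>0) / (f\<^sub>0(v\<^sub>2) f\<^sub>1(v\<^sub>0) f\<^sub>2(v\<^sub>1))\<close>,
  so \<open>log |\<tau>|\<close> is the differential of \<open>B(F\<^sub>0, F\<^sub>1) = log |f\<^sub>0(v\<^sub>1)| - log |f\<^sub>1(v\<^sub>0)|\<close>. On flags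
  \<open>B\<close> depends on the lifts, hence is not invariant; on the group, where \<open>g P\<close> has the canonical lift given
  by \<open>g\<close>, it is, and so the class evaluates to zero there. On flags the dependence is compensated by
  \<open>H(g, F) = log |g\<inverse> v| - log |f \<circ> g|\<close>, which by the Iwasawa decomposition is \<open>log a\<^sub>2\<close> of
  \<open>h\<inverse> g\<close> for \<open>F = h P\<close>, up to a constant. Thus \<open>- (B(F\<^sub>0, F\<^sub>1) + H(g, F\<^sub>0) - H(g, F\<^sub>1))\<close> is the
  invariant cochain that carries \<open>e\<^sub>2\<^sup>*\<close> to \<open>log |\<tau>|\<close> in the spectral sequence.

  The form is determined by its class, since an invariant function of pairs of flags is constant almost
  everywhere (\<open>G\<close> has a conull orbit on pairs) while \<open>|\<tau>|\<close> is not.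
\<close>

subsection \<open>Vectors, covectors and determinants\<close>

text \<open>A form invariant under \<open>w0\<close> sees only the second diagonal entry, and for
  that entry the Iwasawa decomposition is explicit: it is the norm of the first column of the
  inverse divided by the norm of the last row. So heights are built from one vector and one
  covector, and the compact group enters only by preserving norms.

  Identities between cochains hold only off null sets, and this shapes the measure theory. An
  invariant function is invariant outside a null set that varies with the group element; instead of
  choosing a pointwise invariant representative, the proof exchanges almost-everywhere quantifiers
  by Fubini. For this the null sets of \<open>haar\<close> have to be stable under inversion and
  under translation from both sides.

  \<open>q_map\<close> is a definite description, so the zigzag alone does not evaluate it: a second
  form might have the same image. A coboundary in degree (0,3) is \<open>d_right\<close> of a
  \<open>d_up\<close>-closed element of degree (0,2), and such an element is constant almost
  everywhere. This is why the non-constancy of |\<tau>| decides uniqueness.\<close>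

definition pairing :: "'k::field^3 \<Rightarrow> 'k^3 \<Rightarrow> 'k" where
  "pairing f x = (\<Sum>i\<in>UNIV. f $ i * x $ i)"

definition crossk :: "'k::field^3 \<Rightarrow> 'k^3 \<Rightarrow> 'k^3" where
  "crossk a b = vector [a $ 2 * b $ 3 - a $ 3 * b $ 2, a $ 3 * b $ 1 - a $ 1 * b $ 3,
     a $ 1 * b $ 2 - a $ 2 * b $ 1]"

definition colmat :: "'k::field^3 \<Rightarrow> 'k^3 \<Rightarrow> 'k^3 \<Rightarrow> 'k^3^3" where
  "colmat a b c = (\<chi> i j. if j = 1 then a $ i else if j = 2 then b $ i else c $ i)"

text \<open>The covector of the line spanned by the first two columns, hence of the line of the flag
  \<open>g P\<close>. For determinant 1 it is the third row of the inverse of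
  \<open>g\<close>.\<close>

definition covec :: "'k::field^3^3 \<Rightarrow> 'k^3" where
  "covec g = crossk (column 1 g) (column 2 g)"

lemma pairing_3: "pairing f x = f $ 1 * x $ 1 + f $ 2 * x $ 2 + f $ 3 * x $ 3"
  by (simp add: pairing_def sum_3)

lemma crossk_nth [simp]:
  "crossk a b $ 1 = a $ 2 * b $ 3 - a $ 3 * b $ 2"
  "crossk a b $ 2 = a $ 3 * b $ 1 - a $ 1 * b $ 3"
  "crossk a b $ 3 = a $ 1 * b $ 2 - a $ 2 * b $ 1"
  by (simp_all add: crossk_def)

lemma pairing_add_right: "pairing f (x + y) = pairing f x + pairing f y"
  and pairing_diff_right: "pairing f (x - y) = pairing f x - pairing f y"
  and pairing_scale_right [simp]: "pairing f (c *s x) = c * pairing f x"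
  and pairing_scale_left [simp]: "pairing (c *s f) x = c * pairing f x"
  and pairing_zero_right [simp]: "pairing f 0 = 0"
  and pairing_zero_left [simp]: "pairing 0 f = 0"
  by (simp_all add: pairing_3 algebra_simps)

lemma pairing_commute: "pairing f x = pairing x f"
  by (simp add: pairing_3 mult.commute)

lemma pairing_crossk_self [simp]: "pairing (crossk a b) a = 0" "pairing (crossk a b) b = 0"
  by (simp_all add: pairing_3 algebra_simps)

lemma pairing_minus_left [simp]: "pairing (- f) x = - pairing f x"
  by (simp add: pairing_3)

lemma pairing_crossk_rotate: "pairing (crossk a b) c = pairing (crossk b c) a"
  by (simp add: pairing_3 algebra_simps)

lemma det_colmat: "det (colmat a b c) = pairing (crossk a b) c"
  by (simp add: det_3 colmat_def pairing_3 algebra_simps)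

lemma column_colmat [simp]:
  "column 1 (colmat a b c) = a" "column 2 (colmat a b c) = b" "column 3 (colmat a b c) = c"
  by (simp_all add: column_def colmat_def vec_eq_iff)

lemma colmat_columns: "colmat (column 1 g) (column 2 g) (column 3 g) = g"
  by (simp add: column_def colmat_def vec_eq_iff forall_3)

lemma covec_colmat [simp]: "covec (colmat a b c) = crossk a b"
  by (simp add: covec_def)

lemma column_mult: "column j (k ** g) = k *v column j g"
  by (simp add: column_def matrix_matrix_mult_def matrix_vector_mult_def vec_eq_iff)

lemma colmat_mult: "k ** colmat a b c = colmat (k *v a) (k *v b) (k *v c)"
  by (metis colmat_columns column_colmat column_mult)

text \<open>Multiplicativity of the determinant, read on columns. Expressing the transformation law
  of covectors through pairings with moved vectors avoids inverse transposes.\<close>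

lemma pairing_crossk_mult: "pairing (crossk (k *v a) (k *v b)) (k *v x) = det k * pairing (crossk a b) x"
  by (metis colmat_mult det_colmat det_mul)

lemma covec_mult: "pairing (covec (k ** g)) (k *v x) = det k * pairing (covec g) x"
  by (simp add: covec_def column_mult pairing_crossk_mult)

lemma pairing_covec_column: "pairing (covec g) (column 1 g) = 0" "pairing (covec g) (column 2 g) = 0"
  "pairing (covec g) (column 3 g) = det g"
  by (simp_all add: covec_def flip: det_colmat) (simp add: colmat_columns)

lemma mult_vec_columns:
  fixes g :: "'k::field^3^3"
  shows "g *v x = x $ 1 *s column 1 g + x $ 2 *s column 2 g + x $ 3 *s column 3 g"
  by (simp add: vec_eq_iff matrix_vector_mult_def column_def sum_3 mult.commute)

lemma pairing_covec: "pairing (covec g) (g *v x) = det g * x $ 3"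
  by (simp add: mult_vec_columns[of g x] pairing_add_right pairing_covec_column)

lemma SL3_mult: "g \<in> SL3 \<Longrightarrow> h \<in> SL3 \<Longrightarrow> g ** h \<in> SL3"
  by (simp add: SL3_def det_mul)

lemma SL3_det_nz: "g \<in> SL3 \<Longrightarrow> det g \<noteq> 0"
  by (simp add: SL3_def)

lemma one_SL3: "mat 1 \<in> SL3"
  by (simp add: SL3_def det_I)

lemma SL3_inv:
  assumes "g \<in> SL3"
  shows "matrix_inv g ** g = mat 1" "g ** matrix_inv g = mat 1" "matrix_inv g \<in> SL3"
proof -
  have "invertible g"
    using assms by (simp add: invertible_det_nz SL3_def)
  then show *: "matrix_inv g ** g = mat 1" "g ** matrix_inv g = mat 1"
    unfolding invertible_def matrix_inv_def by (metis (mono_tags, lifting) someI_ex)+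
  have "det (matrix_inv g ** g) = 1"
    using * by (simp add: det_I)
  then show "matrix_inv g \<in> SL3"
    using assms by (simp add: SL3_def det_mul)
qed

lemma SL3_inv_vec:
  assumes "g \<in> SL3"
  shows "matrix_inv g *v (g *v x) = x" "g *v (matrix_inv g *v x) = x"
  by (simp_all add: matrix_vector_mul_assoc SL3_inv[OF assms])

lemma SL3_inv_mat:
  assumes "g \<in> SL3"
  shows "matrix_inv g ** (g ** x) = x" "g ** (matrix_inv g ** x) = x"
  by (simp_all add: matrix_mul_assoc SL3_inv[OF assms])

lemma SL3_inv_unique: "g \<in> SL3 \<Longrightarrow> g ** h = mat 1 \<Longrightarrow> matrix_inv g = h"
  by (metis SL3_inv_mat(1) matrix_mul_rid)

lemma SL3_inv_inv: "g \<in> SL3 \<Longrightarrow> matrix_inv (matrix_inv g) = g"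
  by (simp add: SL3_inv SL3_inv_unique)

lemma SL3_inv_mult: "g \<in> SL3 \<Longrightarrow> h \<in> SL3 \<Longrightarrow> matrix_inv (g ** h) = matrix_inv h ** matrix_inv g"
  by (rule SL3_inv_unique)
     (simp_all add: SL3_mult SL3_inv SL3_inv_mat flip: matrix_mul_assoc)

lemma covec_nz: "det (g :: 'k::field^3^3) \<noteq> 0 \<Longrightarrow> covec g \<noteq> 0"
  using pairing_covec_column(3)[of g] by auto

lemma column_nz: "det (g :: 'k::field^3^3) \<noteq> 0 \<Longrightarrow> column 1 g \<noteq> 0"
  using pairing_crossk_rotate[of "column 1 g" "column 2 g" "column 3 g"] pairing_covec_column(3)[of g]
  by (auto simp: covec_def)

lemma pairing_axis [simp]: "pairing f (axis i 1) = f $ i"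
  by (auto simp: pairing_def axis_def sum.delta' if_distrib cong: if_cong)

lemma pairing_ex: "f \<noteq> 0 \<Longrightarrow> \<exists>x. pairing f x \<noteq> 0"
  by (metis pairing_axis vec_eq_iff zero_index)

lemma crossk_eq_0:
  assumes "crossk a b = 0" "a \<noteq> 0"
  shows "\<exists>c. b = c *s a"
proof -
  have e: "a $ 2 * b $ 3 = a $ 3 * b $ 2" "a $ 3 * b $ 1 = a $ 1 * b $ 3" "a $ 1 * b $ 2 = a $ 2 * b $ 1"
    using assms(1) by (auto simp: vec_eq_iff forall_3)
  obtain i where "a $ i \<noteq> 0"
    using assms(2) by (auto simp: vec_eq_iff)
  then have "b = (b $ i / a $ i) *s a"
    using e exhaust_3[of i] by (auto simp: vec_eq_iff forall_3 field_simps)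
  then show ?thesis ..
qed

text \<open>Subtracting from \<open>x\<close> the multiple of \<open>x0\<close> with the same value
  under \<open>f\<close> moves it into the kernel of \<open>f\<close>, where \<open>f'\<close>
  vanishes too. So \<open>f'\<close> is determined by its value at \<open>x0\<close>.\<close>

lemma covector_eq:
  assumes "\<And>x. pairing f x = 0 \<Longrightarrow> pairing f' x = 0" "f \<noteq> 0"
  shows "\<exists>c. f' = c *s f"
proof -
  obtain x0 where x0: "pairing f x0 \<noteq> 0"
    using pairing_ex[OF assms(2)] by auto
  have *: "pairing f' x = (pairing f' x0 / pairing f x0) * pairing f x" for x
    using assms(1)[of "x - (pairing f x / pairing f x0) *s x0"] x0
    by (simp add: pairing_diff_right field_simps)
  have "f' $ i = pairing f' x0 / pairing f x0 * f $ i" for i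
    using *[of "axis i 1"] by simp
  then have "f' = (pairing f' x0 / pairing f x0) *s f"
    by (simp add: vec_eq_iff)
  then show ?thesis ..
qed

subsection \<open>Flags\<close>

lemma flag_act_mult: "flag_act (g ** h) F = flag_act g (flag_act h F)"
  by (simp add: flag_act_def image_image matrix_vector_mul_assoc)

lemma flag_act_one [simp]: "flag_act (mat 1) F = F"
  by (simp add: flag_act_def)

lemma mult_axis: "(g :: 'k::field^3^3) *v axis j 1 = column j g"
  by (simp add: vec_eq_iff column_def matrix_vector_mult_def axis_def if_distrib cong: if_cong)

lemma flag_act_std: "flag_act g std_flag = (vec.span {column 1 g}, vec.span {column 1 g, column 2 g})"
  by (simp add: flag_act_def std_flag_def mult_axis flip: vec.linear_span_image[OF matrix_vector_mul_linear_gen])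

lemma snd_flag_act_std:
  assumes "det g \<noteq> 0"
  shows "snd (flag_act g std_flag) = {x. pairing (covec g) x = 0}"
proof -
  obtain h where h: "g ** h = mat 1"
    using assms by (auto simp: invertible_det_nz[symmetric] invertible_def)
  have "x \<in> (*v) g ` {v. v $ 3 = 0} \<longleftrightarrow> pairing (covec g) x = 0" for x
  proof
    assume "pairing (covec g) x = 0"
    moreover have x: "x = g *v (h *v x)"
      by (simp add: matrix_vector_mul_assoc h)
    ultimately have "(h *v x) $ 3 = 0"
      using assms by (metis pairing_covec mult_eq_0_iff)
    then show "x \<in> (*v) g ` {v. v $ 3 = 0}"
      using x by blast
  qed (auto simp: pairing_covec)
  then show ?thesis
    by (auto simp: flag_act_def std_flag_def span_axis_12)
qed

lemma fst_flag_act_std: "fst (flag_act g std_flag) = range (\<lambda>c. c *s column 1 g)"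
  by (simp add: flag_act_std vec.span_singleton)

lemma flag_act_std_in:
  assumes "det g \<noteq> 0"
  shows "flag_act g std_flag \<in> flags"
proof -
  have n: "column 1 g \<noteq> 0" by (rule column_nz[OF assms])
  have "column 2 g \<noteq> c *s column 1 g" for c
  proof
    assume "column 2 g = c *s column 1 g"
    then have "covec g = 0" by (simp add: covec_def vec_eq_iff forall_3)
    with covec_nz[OF assms] show False ..
  qed
  then have "column 2 g \<notin> vec.span {column 1 g}"
    by (auto simp: vec.span_singleton)
  moreover from this have "column 2 g \<noteq> column 1 g"
    by (metis singletonI vec.span_base)
  ultimately have "vec.independent {column 2 g, column 1 g}" "card {column 2 g, column 1 g} = 2"
    using n by (auto simp: vec.independent_insert)
  moreover have "vec.independent {column 1 g}" using n by simp
  ultimately have "vec.dim (vec.span {column 2 g, column 1 g}) = 2" "vec.dim (vec.span {column 1 g}) = 1"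
    using vec.dim_span_eq_card_independent[of "{column 2 g, column 1 g}"]
      vec.dim_span_eq_card_independent[of "{column 1 g}"] by (metis, metis is_singletonI is_singleton_altdef)
  moreover have "vec.span {column 1 g} \<subseteq> vec.span {column 2 g, column 1 g}"
    by (rule vec.span_mono) simp
  ultimately show ?thesis
    by (simp add: flags_def flag_act_std proj_points_def proj_lines_def insert_commute[of "column 2 g"]
      del: vec.dim_span)
qed

lemma flags_ex:
  assumes "F \<in> flags"
  shows "\<exists>g\<in>SL3. flag_act g std_flag = F"
proof -
  obtain p l where F: "F = (p, l)" "vec.subspace p" "vec.dim p = 1" "vec.subspace l" "vec.dim l = 2" "p \<subseteq> l"
    using assms by (auto simp: flags_def proj_points_def proj_lines_def)
  obtain B where B: "B \<subseteq> p" "vec.independent B" "p \<subseteq> vec.span B" "card B = vec.dim p"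
    using vec.basis_exists[of p] by blast
  then obtain a where a: "B = {a}" using F by (auto simp: card_1_singleton_iff)
  have p: "p = vec.span {a}"
    using B F a by (simp add: vec.span_minimal subset_antisym)
  obtain C where C: "B \<subseteq> C" "C \<subseteq> l" "vec.independent C" "l \<subseteq> vec.span C"
    using vec.maximal_independent_subset_extend[of B l] B F by blast
  then have "card C = 2" using F vec.basis_card_eq_dim by metis
  then obtain b where b: "C = {a, b}" "a \<noteq> b"
    using C(1) a by (auto simp: card_2_iff)
  have l: "l = vec.span {a, b}"
    using C F b by (simp add: vec.span_minimal subset_antisym)
  have "a \<noteq> 0" using B(2) a by auto
  have "vec.independent (insert b {a})" using C(3) b by (simp add: insert_commute)
  then have nb: "b \<notin> vec.span {a}"
    using b(2) by (subst (asm) vec.independent_insert) auto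
  have "crossk a b \<noteq> 0"
    using crossk_eq_0[of a b] nb \<open>a \<noteq> 0\<close> by (auto simp: vec.span_singleton)
  then obtain x where x: "pairing (crossk a b) x \<noteq> 0" using pairing_ex by blast
  \<comment> \<open>The first two columns alone determine the flag, so the third can be scaled until
    the determinant is 1.\<close>
  define g where "g = colmat a b (inverse (pairing (crossk a b) x) *s x)"
  have "g \<in> SL3" using x by (simp add: g_def SL3_def det_colmat)
  moreover have "flag_act g std_flag = F"
    by (simp add: g_def flag_act_std F(1) p l)
  ultimately show ?thesis by blast
qed

lemma flag_act_in:
  assumes "F \<in> flags" "g \<in> SL3"
  shows "flag_act g F \<in> flags"
proof -
  obtain h where "h \<in> SL3" "flag_act h std_flag = F" using flags_ex[OF assms(1)] by blast
  then show ?thesis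
    using assms flag_act_std_in[of "g ** h"] by (auto simp: flag_act_mult SL3_def det_mul)
qed

text \<open>A choice of homogeneous coordinates that depends measurably on the point.\<close>

definition normalize3 :: "'k::field^3 \<Rightarrow> 'k^3" where
  "normalize3 v = (if v $ 1 \<noteq> 0 then inverse (v $ 1) *s v
     else if v $ 2 \<noteq> 0 then inverse (v $ 2) *s v else inverse (v $ 3) *s v)"

lemma normalize3_scale: "c \<noteq> 0 \<Longrightarrow> normalize3 (c *s v) = normalize3 v"
  by (auto simp: normalize3_def vec_eq_iff field_simps)

lemma normalize3_ex: "v \<noteq> 0 \<Longrightarrow> \<exists>c. c \<noteq> 0 \<and> normalize3 v = c *s v"
  by (auto simp: normalize3_def vec_eq_iff[of v] forall_3 intro: nonzero_imp_inverse_nonzero)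

text \<open>An arbitrary representative of the coset, with no claim of measurability. It is
  literally the choice made inside \<open>form_bicochain\<close>.\<close>

definition lift :: "'k::rc_field flag \<Rightarrow> 'k^3^3" where
  "lift F = (SOME h. h \<in> SL3 \<and> flag_act h std_flag = F)"

definition fpoint :: "'k::rc_field flag \<Rightarrow> 'k^3" where
  "fpoint F = normalize3 (column 1 (lift F))"

definition fcov :: "'k::rc_field flag \<Rightarrow> 'k^3" where
  "fcov F = normalize3 (covec (lift F))"

lemma lift:
  assumes "F \<in> flags"
  shows "lift F \<in> SL3" "flag_act (lift F) std_flag = F"
  using someI_ex[of "\<lambda>h. h \<in> SL3 \<and> flag_act h std_flag = F"] flags_ex[OF assms]
  by (auto simp: lift_def)

text \<open>The first column spans the point and the covector has the line as its kernel, so the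
  flag determines each of them up to a scalar.\<close>

lemma flag_act_std_eq:
  assumes "det g \<noteq> 0" "det h \<noteq> 0" "flag_act g std_flag = flag_act h std_flag"
  shows "\<exists>c. c \<noteq> 0 \<and> column 1 g = c *s column 1 h" "\<exists>c. c \<noteq> 0 \<and> covec g = c *s covec h"
proof -
  have "column 1 g \<in> range (\<lambda>c. c *s column 1 h)"
    using assms(3) fst_flag_act_std[of g] fst_flag_act_std[of h] rangeI[of "\<lambda>c. c *s column 1 g" 1] by simp
  then obtain c where c: "column 1 g = c *s column 1 h" by blast
  then have "c \<noteq> 0" using column_nz[OF assms(1)] by (cases "c = 0") auto
  with c show "\<exists>c. c \<noteq> 0 \<and> column 1 g = c *s column 1 h" by blast
  have "{x. pairing (covec g) x = 0} = {x. pairing (covec h) x = 0}"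
    using assms by (metis snd_flag_act_std)
  then have "\<exists>c. covec g = c *s covec h"
    by (intro covector_eq covec_nz assms) blast
  then obtain c where c: "covec g = c *s covec h" by blast
  then have "c \<noteq> 0" using covec_nz[OF assms(1)] by (cases "c = 0") auto
  with c show "\<exists>c. c \<noteq> 0 \<and> covec g = c *s covec h" by blast
qed

text \<open>Normalisation removes the scalar by which \<open>lift\<close> and \<open>g\<close> may
  differ, so the coordinate becomes an explicit function on the group. Measurability on the flag
  space rests on this.\<close>

lemma fpoint_std: "g \<in> SL3 \<Longrightarrow> fpoint (flag_act g std_flag) = normalize3 (column 1 g)"
  using flag_act_std_eq(1)[OF SL3_det_nz[OF lift(1)] SL3_det_nz lift(2)] flag_act_std_in[OF SL3_det_nz]
    normalize3_scale unfolding fpoint_def by metis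

lemma fcov_std: "g \<in> SL3 \<Longrightarrow> fcov (flag_act g std_flag) = normalize3 (covec g)"
  using flag_act_std_eq(2)[OF SL3_det_nz[OF lift(1)] SL3_det_nz lift(2)] flag_act_std_in[OF SL3_det_nz]
    normalize3_scale unfolding fcov_def by metis



lemma fpoint_ex: "g \<in> SL3 \<Longrightarrow> \<exists>c. c \<noteq> 0 \<and> fpoint (flag_act g std_flag) = c *s column 1 g"
  by (simp add: fpoint_std normalize3_ex column_nz SL3_det_nz)

lemma fcov_ex: "g \<in> SL3 \<Longrightarrow> \<exists>c. c \<noteq> 0 \<and> fcov (flag_act g std_flag) = c *s covec g"
  by (simp add: fcov_std normalize3_ex covec_nz SL3_det_nz)

lemma flag_eqs:
  assumes "F \<in> flags"
  shows "fpoint F \<noteq> 0" "fcov F \<noteq> 0" "fst F = range (\<lambda>c. c *s fpoint F)"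
    "snd F = {x. pairing (fcov F) x = 0}" "pairing (fcov F) (fpoint F) = 0"
proof -
  obtain g where g: "g \<in> SL3" "F = flag_act g std_flag" using flags_ex[OF assms] by blast
  obtain c where c: "c \<noteq> 0" "fpoint F = c *s column 1 g" using fpoint_ex g by blast
  obtain d where d: "d \<noteq> 0" "fcov F = d *s covec g" using fcov_ex g by blast
  show "fpoint F \<noteq> 0" "fcov F \<noteq> 0"
    using c d column_nz[of g] covec_nz[of g] g by (auto simp: SL3_det_nz)
  show "pairing (fcov F) (fpoint F) = 0"
    by (simp add: c d pairing_covec_column)
  show "snd F = {x. pairing (fcov F) x = 0}"
    using g d by (simp add: snd_flag_act_std SL3_det_nz)
  have "e *s column 1 g = (e / c) *s (c *s column 1 g)" for e
    using c(1) by simp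
  then have "range (\<lambda>e. e *s column 1 g) \<subseteq> range (\<lambda>e. e *s (c *s column 1 g))"
    by blast
  moreover have "range (\<lambda>e. e *s (c *s column 1 g)) \<subseteq> range (\<lambda>e. e *s column 1 g)"
    by auto
  ultimately have "range (\<lambda>e. e *s column 1 g) = range (\<lambda>e. e *s (c *s column 1 g))"
    by blast
  then show "fst F = range (\<lambda>c. c *s fpoint F)"
    using c(2) g(2) fst_flag_act_std[of g] by metis
qed

lemma fpoint_act:
  assumes "F \<in> flags" "k \<in> SL3"
  shows "\<exists>c. c \<noteq> 0 \<and> fpoint (flag_act k F) = c *s (k *v fpoint F)"
proof -
  obtain g where g: "g \<in> SL3" "F = flag_act g std_flag" using flags_ex[OF assms(1)] by blast
  obtain c where c: "c \<noteq> 0" "fpoint F = c *s column 1 g" using fpoint_ex g by blast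
  obtain d where d: "d \<noteq> 0" "fpoint (flag_act k F) = d *s column 1 (k ** g)"
    using fpoint_ex[of "k ** g"] g assms by (auto simp: SL3_mult flag_act_mult)
  show ?thesis
    using c d by (intro exI[of _ "d / c"]) (simp add: column_mult vec.scale matrix_vector_mult_def vec_eq_iff sum_3 algebra_simps)
qed

lemma fcov_act:
  assumes "F \<in> flags" "k \<in> SL3"
  shows "\<exists>c. c \<noteq> 0 \<and> (\<forall>x. pairing (fcov (flag_act k F)) (k *v x) = c * pairing (fcov F) x)"
proof -
  obtain g where g: "g \<in> SL3" "F = flag_act g std_flag" using flags_ex[OF assms(1)] by blast
  obtain c where c: "c \<noteq> 0" "fcov F = c *s covec g" using fcov_ex g by blast
  obtain d where d: "d \<noteq> 0" "fcov (flag_act k F) = d *s covec (k ** g)"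
    using fcov_ex[of "k ** g"] g assms by (auto simp: SL3_mult flag_act_mult)
  show ?thesis
    using c d assms by (intro exI[of _ "d / c"]) (simp add: covec_mult SL3_def)
qed

declare transpose_matrix_vector [simp del]

subsection \<open>Conjugation\<close>

text \<open>Since the norm is multiplicative, (1+u)^2 and (1-u)^2 both have norm 1+|u|^2. Adding the
  squares of these norms forces <1,u^2> = -|u|^2; as u^2 has norm |u|^2, this is equality in
  Cauchy-Schwarz. The real and the complex conjugation are thereby treated at once.\<close>

lemma rc_field_square_orthogonal_one:
  fixes u :: "'k::rc_field"
  assumes "inner u 1 = 0"
  shows "u * u = - of_real ((norm u)\<^sup>2)"
proof -
  define n where "n = (norm u)\<^sup>2"
  define w where "w = u * u"
  have nw: "inner w w = n\<^sup>2"
    by (simp add: w_def n_def norm_mult power2_eq_square flip: power2_norm_eq_inner)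
  have nu: "inner u u = n" by (simp add: n_def power2_norm_eq_inner)
  have one: "inner 1 (1::'k) = 1" by (simp flip: power2_norm_eq_inner)
  have u1: "inner 1 u = 0" using assms by (simp add: inner_commute)
  have p: "inner (1 + u) (1 + u) = 1 + n" "inner (1 - u) (1 - u) = 1 + n"
    using assms u1 one nu by (simp_all add: inner_simps)
  have nm: "norm ((1 + u) * (1 + u)) = inner (1 + u) (1 + u)" "norm ((1 - u) * (1 - u)) = inner (1 - u) (1 - u)"
    by (simp_all only: norm_mult power2_eq_square flip: power2_norm_eq_inner)
  have ex: "(1 + u) * (1 + u) = 1 + w + 2 * u" "(1 - u) * (1 - u) = 1 + w - 2 * u"
    by (simp_all add: w_def algebra_simps)
  have "norm (1 + w + 2 * u) = 1 + n" "norm (1 + w - 2 * u) = 1 + n"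
    using nm unfolding ex p by simp_all
  then have "inner (1 + w + 2 * u) (1 + w + 2 * u) = (1 + n)\<^sup>2" "inner (1 + w - 2 * u) (1 + w - 2 * u) = (1 + n)\<^sup>2"
    by (simp_all flip: power2_norm_eq_inner)
  moreover have "inner (1 + w + 2 * u) (1 + w + 2 * u) + inner (1 + w - 2 * u) (1 + w - 2 * u)
      = 2 * (1 + 2 * inner 1 w + n\<^sup>2) + 8 * n"
  proof -
    have "2 * u = 2 *\<^sub>R u" by (simp add: scaleR_conv_of_real)
    then show ?thesis
      using one nw nu by (simp add: inner_simps inner_commute algebra_simps)
  qed
  ultimately have w1: "inner 1 w = - n"
    by (simp add: power2_eq_square algebra_simps)
  have "inner (w + n *\<^sub>R 1) (w + n *\<^sub>R 1) = 0"
    using one nw w1 by (simp add: inner_simps inner_commute power2_eq_square algebra_simps)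
  then have "w + n *\<^sub>R 1 = 0" by simp
  then show ?thesis
    by (simp add: w_def n_def scaleR_conv_of_real eq_neg_iff_add_eq_0)
qed

lemma re_part_of_real [simp]: "re_part (of_real r :: 'k::rc_field) = r"
  by (simp add: re_part_def of_real_def flip: power2_norm_eq_inner)

lemma mult_conj_rc: "z * conj_rc z = of_real ((norm z)\<^sup>2)"
proof -
  define u where "u = z - of_real (re_part z)"
  have one: "inner 1 (1::'a) = 1" by (simp flip: power2_norm_eq_inner)
  have u: "inner u 1 = 0"
    by (simp add: u_def inner_diff_left re_part_def of_real_def one)
  have z: "z = of_real (re_part z) + u" by (simp add: u_def)
  have "inner z z = (re_part z)\<^sup>2 + inner u u"
    apply (subst (1 2) z) using u one
    by (simp add: inner_add_left inner_add_right of_real_def inner_commute power2_eq_square)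
  moreover have "z * conj_rc z = of_real ((re_part z)\<^sup>2) - u * u"
    by (simp add: conj_rc_def u_def power2_eq_square algebra_simps)
  ultimately show ?thesis
    by (simp add: rc_field_square_orthogonal_one[OF u] flip: power2_norm_eq_inner)
qed

lemma conj_rc_0 [simp]: "conj_rc 0 = 0"
  by (simp add: conj_rc_def re_part_def)

lemma conj_rc_of_real [simp]: "conj_rc (of_real r) = of_real r"
  by (simp add: conj_rc_def)

lemma re_part_1 [simp]: "re_part 1 = 1"
  using re_part_of_real[of 1] by simp

lemma conj_rc_add: "conj_rc (x + y) = conj_rc x + conj_rc y"
  by (simp add: conj_rc_def re_part_def inner_add_left algebra_simps)

lemma conj_rc_diff: "conj_rc (x - y) = conj_rc x - conj_rc y"
  by (simp add: conj_rc_def re_part_def inner_diff_left algebra_simps)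

lemma conj_rc_conj [simp]: "conj_rc (conj_rc x) = x"
proof -
  have "re_part (conj_rc x) = re_part x"
    by (simp add: conj_rc_def re_part_def inner_diff_left of_real_def flip: power2_norm_eq_inner)
  then show ?thesis by (simp add: conj_rc_def)
qed

text \<open>Multiplied by \<open>x * y\<close>, both sides become the square of the norm of
  \<open>x * y\<close> by \<open>mult_conj_rc\<close>; then cancel.\<close>

lemma conj_rc_mult: "conj_rc (x * y) = conj_rc x * conj_rc y"
proof (cases "x * y = 0")
  case False
  have "(x * y) * conj_rc (x * y) = (x * conj_rc x) * (y * conj_rc y)"
    by (simp add: mult_conj_rc norm_mult power_mult_distrib)
  then have "(x * y) * conj_rc (x * y) = (x * y) * (conj_rc x * conj_rc y)"
    by (simp add: algebra_simps)
  then show ?thesis using False mult_left_cancel by blast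
qed auto

subsection \<open>The Iwasawa decomposition\<close>

definition conj_vec :: "'k::rc_field^3 \<Rightarrow> 'k^3" where
  "conj_vec x = (\<chi> i. conj_rc (x $ i))"

definition star :: "'k::rc_field^3^3 \<Rightarrow> 'k^3^3" where
  "star k = (\<chi> i j. conj_rc (k $ j $ i))"

lemma compact_K_star: "compact_K = {k \<in> SL3. k ** star k = mat 1}"
  by (simp add: compact_K_def star_def)

lemma norm_vec_3: "(norm x)\<^sup>2 = (norm (x $ 1))\<^sup>2 + (norm (x $ 2))\<^sup>2 + (norm (x $ (3::3)))\<^sup>2"
  by (simp add: norm_vec_def L2_set_def sum_3)

lemma pairing_conj_vec: "pairing x (conj_vec x) = of_real ((norm x)\<^sup>2)"
  by (simp add: pairing_3 conj_vec_def mult_conj_rc norm_vec_3)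

lemma pairing_transpose: "pairing (transpose g *v f) x = pairing f (g *v x)"
  by (simp add: pairing_3 matrix_vector_mult_def transpose_def sum_3 algebra_simps)

lemma conj_vec_mult: "conj_vec (k *v x) = transpose (star k) *v conj_vec x"
  by (simp add: vec_eq_iff conj_vec_def star_def transpose_def matrix_vector_mult_def sum_3
      conj_rc_add conj_rc_mult)

lemma star_transpose: "star (transpose k) = transpose (star k)"
  by (simp add: star_def transpose_def vec_eq_iff)

lemma norm_unitary:
  assumes "star k ** k = mat 1"
  shows "norm (k *v x) = norm x"
proof -
  have "pairing (k *v x) (conj_vec (k *v x)) = pairing x (transpose (star k ** k) *v conj_vec x)"
    using pairing_transpose[of "transpose k" x]
    by (simp add: conj_vec_mult matrix_transpose_mul flip: matrix_vector_mul_assoc)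
  then have "(of_real ((norm (k *v x))\<^sup>2) :: 'a) = of_real ((norm x)\<^sup>2)"
    by (simp add: assms pairing_conj_vec)
  then show ?thesis
    by (metis norm_ge_zero of_real_eq_iff power2_eq_imp_eq)
qed

text \<open>The transpose of a unitary matrix is again unitary. Both versions occur because Iwasawa
  components are read off a column of the inverse and a row of the matrix.\<close>

lemma norm_compact_K:
  assumes "k \<in> compact_K"
  shows "norm (k *v x) = norm x" "norm (transpose k *v x) = norm x"
proof -
  have k: "k ** star k = mat 1" using assms by (simp add: compact_K_star)
  then have "star k ** k = mat 1" by (simp add: matrix_left_right_inverse)
  then show "norm (k *v x) = norm x" by (rule norm_unitary)
  have "star (transpose k) ** transpose k = mat 1"
    by (simp add: star_transpose k flip: matrix_transpose_mul)
  then show "norm (transpose k *v x) = norm x" by (rule norm_unitary)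
qed

lemma norm_scale: "norm (c *s (x :: 'k::rc_field^3)) = norm c * norm x"
proof -
  have "(norm (c *s x))\<^sup>2 = (norm c * norm x)\<^sup>2"
    by (simp add: norm_vec_3 power_mult_distrib norm_mult distrib_left)
  then show ?thesis
    using power2_eq_imp_eq[of "norm (c *s x)" "norm c * norm x"] by simp
qed

lemma norm_axis_1: "norm (axis i (1::'k::rc_field) :: 'k^3) = 1"
proof -
  have "(norm (axis i (1::'k) :: 'k^3))\<^sup>2 = 1\<^sup>2"
    using exhaust_3[of i] by (auto simp: norm_vec_3 axis_def)
  then show ?thesis by (rule power2_eq_imp_eq) simp_all
qed

text \<open>Right multiplication by \<open>k\<close> preserves the norm of the last row, which for
  \<open>a ** n\<close> is the third entry of \<open>a\<close>. Likewise the first column of the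
  inverse has the norm of the first column of the inverse of \<open>a ** n\<close>, the reciprocal
  of the first entry of \<open>a\<close>. The middle entry follows from the determinant.\<close>

lemma iwasawa_values:
  assumes a: "a \<in> torus_A" and n: "n \<in> unipotent_N" and k: "k \<in> compact_K" and g: "g = a ** n ** k"
  shows "a = (\<chi> i j. if i = j then of_real (if i = 1 then inverse (norm (matrix_inv g *v axis 1 1))
     else if i = 2 then norm (matrix_inv g *v axis 1 1) / norm (transpose g *v axis 3 1)
     else norm (transpose g *v axis 3 1)) else 0)"
    and "norm (matrix_inv g *v axis 1 1) > 0" "norm (transpose g *v axis 3 1) > 0"
proof -
  have d: "diagonal a" using a by (simp add: torus_A_def)
  have u: "upper_triangular3 n" "\<And>i. n $ i $ i = 1" using n by (auto simp: unipotent_N_def)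
  have "det n = 1" using u by (simp add: det_3 upper_triangular3_def)
  then have gS: "g \<in> SL3"
    using a k g by (simp add: torus_A_def compact_K_def SL3_def det_mul)
  obtain t where t: "\<And>i. t i > 0" "\<And>i. a $ i $ i = of_real (t i)"
    using a unfolding torus_A_def by (simp add: choice_iff) metis
  have off: "\<And>i j. i \<noteq> j \<Longrightarrow> a $ i $ j = 0" using d by (simp add: diagonal_def)
  have "transpose (a ** n) *v axis 3 1 = of_real (t 3) *s axis 3 1"
    using u t(2)[of 3] off[of 3 1] off[of 3 2] u(2)[of 3]
    by (simp add: vec_eq_iff forall_3 upper_triangular3_def transpose_def matrix_vector_mult_def
        matrix_matrix_mult_def sum_3 axis_def)
  then have "transpose g *v axis 3 1 = transpose k *v (of_real (t 3) *s axis 3 1)"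
    unfolding g by (simp add: matrix_transpose_mul flip: matrix_vector_mul_assoc)
  then have t3: "norm (transpose g *v axis 3 1) = t 3"
    using t(1)[of 3] by (simp add: norm_compact_K[OF k] norm_scale norm_axis_1)
  \<comment> \<open>\<open>z\<close> is the first column of the inverse of \<open>a ** n\<close>; it
    is found by back substitution in the triangular system below.\<close>
  define z where "z = k *v (matrix_inv g *v axis 1 1)"
  have "(a ** n) *v z = axis 1 1"
    using SL3_inv_vec(2)[OF gS, of "axis 1 1"] by (simp add: z_def g matrix_vector_mul_assoc matrix_mul_assoc)
  then have e: "of_real (t 1) * z $ 1 + of_real (t 1) * n $ 1 $ 2 * z $ 2 + of_real (t 1) * n $ 1 $ 3 * z $ 3 = 1"
      "of_real (t 2) * z $ 2 + of_real (t 2) * n $ 2 $ 3 * z $ 3 = 0" "z $ 3 = 0"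
    using u t(2)[of 1] t(2)[of 2] t(2)[of 3] t(1)[of 1] t(1)[of 2] t(1)[of 3]
      off[of 3 1] off[of 3 2] off[of 2 1] off[of 2 3] off[of 1 2] off[of 1 3] u(2)[of 1] u(2)[of 2] u(2)[of 3]
    by (simp_all add: vec_eq_iff forall_3 upper_triangular3_def matrix_vector_mult_def
        matrix_matrix_mult_def sum_3 axis_def, auto)
  have "z $ 2 = 0" using e(2,3) t(1)[of 2] by simp
  then have "z $ 3 = 0 \<and> z $ 2 = 0 \<and> of_real (t 1) * z $ 1 = 1"
    using e by simp
  then have "z = of_real (inverse (t 1)) *s axis 1 1"
    using t(1)[of 1] by (auto simp: vec_eq_iff forall_3 axis_def field_simps)
  then have "norm z = inverse (t 1)"
    using t(1)[of 1] by (simp add: norm_scale norm_axis_1 norm_inverse del: of_real_inverse)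
  then have t1: "norm (matrix_inv g *v axis 1 1) = inverse (t 1)"
    by (simp add: z_def norm_compact_K[OF k])
  have "det a = 1" using a by (simp add: torus_A_def SL3_def)
  then have "(of_real (t 1 * t 2 * t 3) :: 'a) = of_real 1"
    using off by (simp add: det_3 t(2))
  then have "t 1 * t 2 * t 3 = 1" by (simp only: of_real_eq_iff)
  then have t2: "t 2 = inverse (t 1) / t 3"
    using t(1)[of 1] t(1)[of 3] by (simp add: field_simps)
  show "a = (\<chi> i j. if i = j then of_real (if i = 1 then inverse (norm (matrix_inv g *v axis 1 1))
     else if i = 2 then norm (matrix_inv g *v axis 1 1) / norm (transpose g *v axis 3 1)
     else norm (transpose g *v axis 3 1)) else 0)"
    unfolding t1 t3 using t(2)[of 1] t(2)[of 2] t(2)[of 3] t2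
      off[of 3 1] off[of 3 2] off[of 2 1] off[of 2 3] off[of 1 2] off[of 1 3]
    by (simp add: vec_eq_iff forall_3)
  show "norm (matrix_inv g *v axis 1 1) > 0" "norm (transpose g *v axis 3 1) > 0"
    unfolding t1 t3 using t(1) by auto
qed

lemma rowmat_ex: "\<exists>k :: 'k::field^3^3. k $ 1 = a \<and> k $ 2 = b \<and> k $ 3 = c"
  by (intro exI[of _ "vector [a, b, c]"]) simp

lemma pairing_conj_vec_commute: "pairing x (conj_vec y) = conj_rc (pairing y (conj_vec x))"
  by (simp add: pairing_3 conj_vec_def conj_rc_add conj_rc_mult mult.commute)

lemma conj_vec_conj [simp]: "conj_vec (conj_vec x) = x"
  by (simp add: conj_vec_def vec_eq_iff)

lemma crossk_lagrange:
  "pairing (crossk a b) (crossk c d) = pairing a c * pairing b d - pairing a d * pairing b c"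
  by (simp add: pairing_3 algebra_simps)

lemma conj_vec_crossk: "conj_vec (crossk a b) = crossk (conj_vec a) (conj_vec b)"
  by (simp add: vec_eq_iff forall_3 conj_vec_def conj_rc_diff conj_rc_mult)

lemma pairing_det_rows: "det k = pairing (k $ 1) (crossk (k $ 2) (k $ 3))"
  by (simp add: det_3 pairing_3 algebra_simps)

text \<open>Gram-Schmidt on the rows of \<open>g\<close>, from the bottom upwards since
  \<open>n\<close> is upper triangular. The orthonormal rows form \<open>k\<close>, and the
  coefficients form the triangular factor \<open>u\<close>.\<close>

lemma iwasawa_ex:
  fixes g :: "'k::rc_field^3^3"
  assumes g: "g \<in> SL3"
  shows "\<exists>a\<in>torus_A. \<exists>n\<in>unipotent_N. \<exists>k\<in>compact_K. g = a ** n ** k"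
proof -
  have dg: "pairing (g $ 1) (crossk (g $ 2) (g $ 3)) = 1"
    using g by (simp add: SL3_def pairing_det_rows)
  define t3 where "t3 = norm (g $ 3)"
  define k3 where "k3 = of_real (inverse t3) *s g $ 3"
  have "g $ 3 \<noteq> 0" using dg by (auto simp: vec_eq_iff forall_3 pairing_3)
  then have t3: "t3 > 0" by (simp add: t3_def)
  have r3: "g $ 3 = of_real t3 *s k3" using t3 by (simp add: k3_def)
  have k33: "pairing k3 (conj_vec k3) = 1"
    using t3 by (simp add: pairing_conj_vec k3_def norm_scale norm_inverse flip: t3_def)
  define c where "c = pairing (g $ 2) (conj_vec k3)"
  define v where "v = g $ 2 - c *s k3"
  define t2 where "t2 = norm v"
  define k2 where "k2 = of_real (inverse t2) *s v"
  have "v \<noteq> 0"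
  proof
    assume "v = 0"
    then have "g $ 2 = c *s k3" by (simp add: v_def)
    then have "crossk (g $ 2) (g $ 3) = 0" using r3 by (simp add: vec_eq_iff forall_3)
    then show False using dg by simp
  qed
  then have t2: "t2 > 0" by (simp add: t2_def)
  have v: "v = of_real t2 *s k2" using t2 by (simp add: k2_def)
  then have r2: "g $ 2 = of_real t2 *s k2 + c *s k3" by (simp add: v_def diff_eq_eq)
  have k22: "pairing k2 (conj_vec k2) = 1"
    using t2 by (simp add: pairing_conj_vec k2_def norm_scale norm_inverse flip: t2_def)
  have "pairing v (conj_vec k3) = 0"
    by (simp add: v_def pairing_commute[of _ "conj_vec k3"] pairing_diff_right)
       (simp add: pairing_commute[of "conj_vec k3"] k33 c_def)
  then have k23: "pairing k2 (conj_vec k3) = 0" by (simp add: k2_def)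
  then have k32: "pairing k3 (conj_vec k2) = 0"
    by (subst pairing_conj_vec_commute) simp
  \<comment> \<open>The conjugated cross product is orthogonal to \<open>k2\<close> and
    \<open>k3\<close>, has norm 1 by Lagrange's identity, and gives \<open>k\<close> determinant
    exactly 1, so no phase remains to be corrected.\<close>
  define k1 where "k1 = conj_vec (crossk k2 k3)"
  have k21: "pairing k2 (conj_vec k1) = 0" "pairing k3 (conj_vec k1) = 0"
    by (simp_all add: k1_def pairing_commute[of _ "crossk _ _"])
  have k12: "pairing k1 (conj_vec k2) = 0" "pairing k1 (conj_vec k3) = 0"
    by (subst pairing_conj_vec_commute, simp add: k21)+
  have k11: "pairing k1 (conj_vec k1) = 1"
    using k22 k33 k23 k32 pairing_commute[of "conj_vec k2"] pairing_commute[of "conj_vec k3"]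
    by (simp add: k1_def conj_vec_crossk crossk_lagrange)
  obtain k :: "'k^3^3" where k: "k $ 1 = k1" "k $ 2 = k2" "k $ 3 = k3" using rowmat_ex by blast
  have "(k ** star k) $ i $ j = pairing (k $ i) (conj_vec (k $ j))" for i j
    by (simp add: matrix_matrix_mult_def star_def conj_vec_def pairing_def)
  then have ks: "k ** star k = mat 1"
    by (simp add: vec_eq_iff forall_3 k mat_def k11 k12 k21 k22 k23 k32 k33)
  have "det k = pairing k1 (conj_vec k1)"
    by (simp add: pairing_det_rows k k1_def)
  then have dk: "det k = 1" using k11 by simp
  have kK: "k \<in> compact_K" using dk ks by (simp add: compact_K_star SL3_def)
  define u where "u = g ** star k"
  have uk: "g = u ** k"
    using ks unfolding matrix_left_right_inverse[of k] by (simp add: u_def flip: matrix_mul_assoc)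
  then have du: "det u = 1" using g dk by (simp add: SL3_def det_mul)
  have u: "u $ i $ j = pairing (g $ i) (conj_vec (k $ j))" for i j
    by (simp add: u_def matrix_matrix_mult_def star_def conj_vec_def pairing_def)
  have u3: "u $ 3 $ 1 = 0" "u $ 3 $ 2 = 0" "u $ 3 $ 3 = of_real t3"
    by (simp_all add: u k r3 k21 k32 k33)
  have u2: "u $ 2 $ 1 = 0" "u $ 2 $ 2 = of_real t2"
    by (simp_all add: u k r2 pairing_commute[of _ "conj_vec _"] pairing_add_right)
       (simp_all add: pairing_commute[of "conj_vec _"] k21 k32 k22)
  \<comment> \<open>The value forced by the determinant of \<open>u\<close>; the first diagonal
    entry of \<open>u\<close> is therefore automatically real and positive.\<close>
  define t1 where "t1 = inverse (t2 * t3)"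
  have t1: "t1 > 0" using t2 t3 by (simp add: t1_def)
  have "u $ 1 $ 1 * of_real t2 * of_real t3 = 1"
    using du u3 u2 by (simp add: det_3)
  then have u1: "u $ 1 $ 1 = of_real t1"
    using t2 t3 by (simp add: t1_def field_simps)
  define a :: "'k^3^3" where
    "a = (\<chi> i j. if i = j then of_real (if i = 1 then t1 else if i = 2 then t2 else t3) else 0)"
  define n :: "'k^3^3" where
    "n = (\<chi> i j. u $ i $ j / of_real (if i = 1 then t1 else if i = 2 then t2 else t3))"
  have an: "a ** n = u"
    using t1 t2 t3 by (simp add: a_def n_def vec_eq_iff forall_3 matrix_matrix_mult_def sum_3)
  have n: "n \<in> unipotent_N"
    using t1 t2 t3 u1 u2 u3 by (simp add: n_def unipotent_N_def upper_triangular3_def forall_3)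
  have "(of_real (t1 * t2 * t3) :: 'k) = 1" using t2 t3 by (simp add: t1_def field_simps del: of_real_mult)
  then have "det a = 1"
    by (simp add: a_def det_3)
  then have "a \<in> torus_A"
    using t1 t2 t3 by (auto simp: torus_A_def a_def SL3_def diagonal_def)
  with n kK an uk show ?thesis by metis
qed

text \<open>The formula of \<open>iwasawa_values\<close> involves \<open>g\<close> alone, so the
  existence of one decomposition already makes its \<open>A\<close>-part unique.\<close>

lemma pi_A_eq:
  assumes "g \<in> SL3"
  shows "pi_A g = (\<chi> i j. if i = j then of_real (if i = 1 then inverse (norm (matrix_inv g *v axis 1 1))
     else if i = 2 then norm (matrix_inv g *v axis 1 1) / norm (transpose g *v axis 3 1)
     else norm (transpose g *v axis 3 1)) else 0)"
    "norm (matrix_inv g *v axis 1 1) > 0" "norm (transpose g *v axis 3 1) > 0"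
    "pi_A g \<in> torus_A"
proof -
  obtain a n k where ank: "a \<in> torus_A" "n \<in> unipotent_N" "k \<in> compact_K" "g = a ** n ** k"
    using iwasawa_ex[OF assms] by blast
  have "pi_A g = a"
    unfolding pi_A_def
  proof (rule the_equality)
    show "a \<in> torus_A \<and> (\<exists>n\<in>unipotent_N. \<exists>k\<in>compact_K. g = a ** n ** k)" using ank by blast
  next
    fix a' assume "a' \<in> torus_A \<and> (\<exists>n\<in>unipotent_N. \<exists>k\<in>compact_K. g = a' ** n ** k)"
    then obtain n' k' where "a' \<in> torus_A" "n' \<in> unipotent_N" "k' \<in> compact_K" "g = a' ** n' ** k'" by blast
    from iwasawa_values(1)[OF this] iwasawa_values(1)[OF ank] show "a' = a" by metis
  qed
  then show "pi_A g = (\<chi> i j. if i = j then of_real (if i = 1 then inverse (norm (matrix_inv g *v axis 1 1))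
     else if i = 2 then norm (matrix_inv g *v axis 1 1) / norm (transpose g *v axis 3 1)
     else norm (transpose g *v axis 3 1)) else 0)" "pi_A g \<in> torus_A"
    "norm (matrix_inv g *v axis 1 1) > 0" "norm (transpose g *v axis 3 1) > 0"
    using iwasawa_values[OF ank] ank(1) by auto
qed

subsection \<open>Invariant linear forms\<close>

definition diag3 :: "real \<Rightarrow> real \<Rightarrow> real \<Rightarrow> 'k::rc_field^3^3" where
  "diag3 x y z = (\<chi> i j. if i = j then of_real (if i = 1 then x else if i = 2 then y else z) else 0)"

lemma diag3_nth [simp]:
  "diag3 x y z $ 1 $ 1 = of_real x" "diag3 x y z $ 2 $ 2 = of_real y" "diag3 x y z $ 3 $ 3 = of_real z"
  by (simp_all add: diag3_def)

lemma diag3_lie_a: "diag3 x y z \<in> lie_a \<longleftrightarrow> x + y + z = 0"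
proof -
  have "trace (diag3 x y z :: 'a^3^3) = of_real (x + y + z)"
    by (simp add: trace_def sum_3)
  then show ?thesis
    by (auto simp: lie_a_def diag3_def diagonal_def simp del: of_real_add)
qed

lemma lie_a_diag3:
  assumes "X \<in> lie_a"
  obtains x y z where "X = diag3 x y z" "x + y + z = 0"
proof -
  obtain f where f: "\<And>i. X $ i $ i = of_real (f i)"
    using assms unfolding lie_a_def Reals_def by (simp add: image_iff choice_iff) metis
  have "X = diag3 (f 1) (f 2) (f 3)"
    using assms f[of 1] f[of 2] f[of 3] by (simp add: lie_a_def diag3_def diagonal_def vec_eq_iff forall_3)
  with that assms diag3_lie_a show ?thesis by metis
qed

lemma w0_SL3: "w0 \<in> SL3"
  by (simp add: SL3_def w0_def det_3)

lemma w0_conj_diag3: "w0 ** diag3 x y z ** matrix_inv w0 = (diag3 z y x :: 'k::rc_field^3^3)"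
proof -
  have "w0 ** diag3 x y z = (diag3 z y x :: 'k^3^3) ** w0"
    by (simp add: w0_def diag3_def vec_eq_iff forall_3 matrix_matrix_mult_def sum_3)
  then have "w0 ** diag3 x y z ** matrix_inv w0 = (diag3 z y x :: 'k^3^3) ** (w0 ** matrix_inv w0)"
    by (simp add: matrix_mul_assoc)
  then show ?thesis
    by (simp add: SL3_inv[OF w0_SL3])
qed

lemma diag3_add: "diag3 x y z + diag3 x' y' z' = diag3 (x + x') (y + y') (z + z')"
  by (simp add: diag3_def vec_eq_iff)

lemma diag3_scale: "c *\<^sub>R diag3 x y z = diag3 (c * x) (c * y) (c * z)"
  by (simp add: diag3_def vec_eq_iff of_real_def)

text \<open>Conjugation by \<open>w0\<close> exchanges the outer diagonal entries. The sum of a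
  traceless diag(x,y,z) and its conjugate is therefore y diag(-1,2,-1), and an invariant form takes
  twice its value on this sum; hence the division by 2 in \<open>c\<close>.\<close>

lemma lie_a_dual_w0_form:
  fixes \<phi> :: "'k::rc_field^3^3 \<Rightarrow> real"
  assumes "\<phi> \<in> lie_a_dual_w0"
  shows "\<phi> = (\<lambda>X\<in>lie_a. form_coeff \<phi> * e2_form X)"
proof -
  have ext: "\<phi> \<in> extensional lie_a" and add: "\<And>X Y. X \<in> lie_a \<Longrightarrow> Y \<in> lie_a \<Longrightarrow> \<phi> (X + Y) = \<phi> X + \<phi> Y"
    and scale: "\<And>c X. X \<in> lie_a \<Longrightarrow> \<phi> (c *\<^sub>R X) = c * \<phi> X"
    and w: "\<And>X. X \<in> lie_a \<Longrightarrow> \<phi> (w0 ** X ** matrix_inv w0) = \<phi> X"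
    using assms by (auto simp: lie_a_dual_w0_def lie_a_dual_def)
  define c where "c = \<phi> (diag3 (-1) 2 (-1)) / 2"
  have "\<phi> X = c * e2_form X" if X: "X \<in> lie_a" for X
  proof -
    obtain x y z where xyz: "X = diag3 x y z" "x + y + z = 0" using lie_a_diag3[OF X] .
    have "2 * \<phi> X = \<phi> (diag3 x y z) + \<phi> (diag3 z y x)"
      using w[OF X] by (simp add: xyz w0_conj_diag3)
    also have "\<dots> = \<phi> (diag3 (x + z) (y + y) (z + x))"
      using xyz(2) by (subst add[symmetric]) (simp_all add: diag3_lie_a diag3_add)
    also have "\<dots> = \<phi> (y *\<^sub>R diag3 (-1) 2 (-1))"
    proof -
      have "x + z = - y" "z + x = - y" using xyz(2) by auto
      then show ?thesis by (simp only: diag3_scale) (simp add: mult.commute[of y])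
    qed
    also have "\<dots> = y * \<phi> (diag3 (-1) 2 (-1))"
      by (rule scale) (simp add: diag3_lie_a)
    finally show ?thesis using X by (simp add: c_def e2_form_def xyz mult.commute)
  qed
  then have eq: "\<phi> = (\<lambda>X\<in>lie_a. c * e2_form X)"
    using ext by (intro extensionalityI[of _ lie_a]) auto
  moreover have "form_coeff \<phi> = c"
    unfolding form_coeff_def
  proof (rule the_equality)
    fix d assume "\<phi> = (\<lambda>X\<in>lie_a. d * e2_form X)"
    \<comment> \<open>A traceless matrix with middle entry 1, on which the form takes its
      coefficient as value.\<close>
    then have "\<phi> (diag3 (-1) 1 0) = d" by (simp add: diag3_lie_a e2_form_def)
    moreover have "\<phi> (diag3 (-1) 1 0) = c" by (subst eq) (simp add: diag3_lie_a e2_form_def)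
    ultimately show "d = c" by simp
  qed (rule eq)
  ultimately show ?thesis by simp
qed

text \<open>On \<open>SL3\<close> this is the logarithm of the second diagonal entry of
  \<open>pi_A g\<close>, the only coordinate that a \<open>w0\<close>-invariant form sees.\<close>

definition log_a2 :: "'k::rc_field^3^3 \<Rightarrow> real" where
  "log_a2 g = ln (norm (matrix_inv g *v axis 1 1)) - ln (norm (transpose g *v axis 3 1))"

lemma form_cocycle_pi_A:
  fixes \<phi> :: "'k::rc_field^3^3 \<Rightarrow> real"
  assumes \<phi>: "\<phi> \<in> lie_a_dual_w0" and g: "g0 \<in> SL3" "g1 \<in> SL3"
  shows "form_cocycle \<phi> (pi_A g0) (pi_A g1) = form_coeff \<phi> * (log_a2 g1 - log_a2 g0)"
proof -
  have *: "\<exists>x z. pi_A g = diag3 x (exp (log_a2 g)) z \<and> x > 0 \<and> z > 0 \<and> x * exp (log_a2 g) * z = 1"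
    if "g \<in> SL3" for g :: "'k^3^3"
  proof -
    have "exp (log_a2 g) = norm (matrix_inv g *v axis 1 1) / norm (transpose g *v axis 3 1)"
      using pi_A_eq(2,3)[OF that] by (simp add: log_a2_def exp_diff)
    then have "pi_A g = diag3 (inverse (norm (matrix_inv g *v axis 1 1))) (exp (log_a2 g)) (norm (transpose g *v axis 3 1))"
      by (simp add: pi_A_eq(1)[OF that] diag3_def)
    then show ?thesis using pi_A_eq(2,3)[OF that]
      by (intro exI[of _ "inverse (norm (matrix_inv g *v axis 1 1))"] exI[of _ "norm (transpose g *v axis 3 1)"])
         (simp add: \<open>exp (log_a2 g) = _\<close>)
  qed
  obtain x z where a: "pi_A g0 = diag3 x (exp (log_a2 g0)) z" "x > 0" "z > 0" "x * exp (log_a2 g0) * z = 1"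
    using *[OF g(1)] by blast
  obtain x' z' where a': "pi_A g1 = diag3 x' (exp (log_a2 g1)) z'" "x' > 0" "z' > 0" "x' * exp (log_a2 g1) * z' = 1"
    using *[OF g(2)] by blast
  have inv: "matrix_inv (pi_A g0) = diag3 (inverse x) (exp (- log_a2 g0)) (inverse z)"
    using pi_A_eq(4)[OF g(1)] a(2,3)
    by (intro SL3_inv_unique)
       (simp_all add: torus_A_def a(1) diag3_def vec_eq_iff forall_3 mat_def matrix_matrix_mult_def sum_3
         exp_minus flip: of_real_mult of_real_inverse)
  have "matrix_inv (pi_A g0) ** pi_A g1 = diag3 (inverse x * x') (exp (log_a2 g1 - log_a2 g0)) (inverse z * z')"
    unfolding inv a'(1)
    by (simp add: diag3_def vec_eq_iff forall_3 matrix_matrix_mult_def sum_3 exp_diff exp_minus field_simps)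
  then have "log_A (matrix_inv (pi_A g0) ** pi_A g1)
     = diag3 (ln (inverse x * x')) (log_a2 g1 - log_a2 g0) (ln (inverse z * z'))"
    by (simp add: log_A_def diag3_def vec_eq_iff forall_3 del: of_real_mult of_real_inverse)
  \<comment> \<open>Forms are extensional, so they can be evaluated only after the logarithm is
    known to be traceless, that is, to lie in \<open>lie_a\<close>.\<close>
  moreover have "ln (inverse x * x') + (log_a2 g1 - log_a2 g0) + ln (inverse z * z') = 0"
  proof -
    have "ln (x * exp (log_a2 g0) * z) = ln x + log_a2 g0 + ln z"
      "ln (x' * exp (log_a2 g1) * z') = ln x' + log_a2 g1 + ln z'"
      using a(2,3) a'(2,3) by (simp_all add: ln_mult)
    then show ?thesis using a(2-4) a'(2-4) by (simp add: ln_mult ln_inverse)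
  qed
  ultimately show ?thesis
    unfolding form_cocycle_def
    by (subst lie_a_dual_w0_form[OF \<phi>]) (simp add: diag3_lie_a e2_form_def del: of_real_diff)
qed

subsection \<open>Powers of a measure\<close>

text \<open>For fixed \<open>a\<close> a section of \<open>skip n i\<close>. It identifies
  \<open>M\<close> times the \<open>n\<close>-th power with the power of order \<open>n + 1\<close>,
  which brings Fubini to bear on any chosen coordinate.\<close>

definition insert_at :: "nat \<Rightarrow> nat \<Rightarrow> 'a \<Rightarrow> (nat \<Rightarrow> 'a) \<Rightarrow> nat \<Rightarrow> 'a" where
  "insert_at n i a x = (\<lambda>j\<in>{..<Suc n}. if j < i then x j else if j = i then a else x (j - 1))"

lemma skip_insert_at: "x \<in> extensional {..<n} \<Longrightarrow> i \<le> n \<Longrightarrow> skip n i (insert_at n i a x) = x"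
  by (rule extensionalityI[of _ "{..<n}"]) (auto simp: skip_def insert_at_def)

lemma prod_insert_at:
  fixes w :: "nat \<Rightarrow> 'b::comm_monoid_mult"
  assumes "i \<le> n"
  shows "(\<Prod>j<Suc n. w j) = w i * (\<Prod>j<n. w (if j < i then j else Suc j))"
proof -
  have "bij_betw (\<lambda>j. if j < i then j else Suc j) {..<n} ({..<Suc n} - {i})"
    using assms
    by (intro bij_betwI[where g = "\<lambda>j. if j < i then j else j - 1"]) (auto split: if_splits)
  then have "(\<Prod>j<n. w (if j < i then j else Suc j)) = (\<Prod>j\<in>{..<Suc n} - {i}. w j)"
    by (rule prod.reindex_bij_betw)
  then show ?thesis
    using assms by (subst prod.remove[of _ i]) auto
qed

context sigma_finite_measure
begin

lemma pow_sigma_finite: "sigma_finite_measure (pow_measure M n)"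
proof -
  interpret product_sigma_finite "\<lambda>_::nat. M" by unfold_locales
  show ?thesis by (rule sigma_finite) simp
qed

lemma pair_pow: "pair_sigma_finite M (pow_measure M n)"
  by (intro pair_sigma_finite.intro sigma_finite_measure_axioms pow_sigma_finite)

lemma measurable_insert_at [measurable]:
  "(\<lambda>(a, x). insert_at n i a x) \<in> M \<Otimes>\<^sub>M pow_measure M n \<rightarrow>\<^sub>M pow_measure M (Suc n)"
  if "i \<le> n"
proof -
  have "(\<lambda>p. (if j < i then snd p j else if j = i then fst p else snd p (j - 1))) \<in> M \<Otimes>\<^sub>M pow_measure M n \<rightarrow>\<^sub>M M"
    if "j < Suc n" for j
  proof -
    have "(\<lambda>p. snd p j) \<in> M \<Otimes>\<^sub>M pow_measure M n \<rightarrow>\<^sub>M M" if "j < i"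
      using that \<open>i \<le> n\<close> by (intro measurable_compose[OF measurable_snd measurable_component_singleton]) auto
    moreover have "(\<lambda>p. snd p (j - 1)) \<in> M \<Otimes>\<^sub>M pow_measure M n \<rightarrow>\<^sub>M M" if "j > i"
      using that \<open>j < Suc n\<close> by (intro measurable_compose[OF measurable_snd measurable_component_singleton]) auto
    ultimately show ?thesis
      by (cases "j < i"; cases "j = i") auto
  qed
  then show ?thesis
    unfolding insert_at_def case_prod_beta by (intro measurable_restrict) auto
qed

text \<open>The preimage of a box is a box with side \<open>i\<close> moved to the front, and for
  sigma-finite factors the values on boxes determine the product measure.\<close>

lemma distr_insert_at:
  assumes "i \<le> n"
  shows "distr (M \<Otimes>\<^sub>M pow_measure M n) (pow_measure M (Suc n)) (\<lambda>(a, x). insert_at n i a x) = pow_measure M (Suc n)"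
proof -
  interpret product_sigma_finite "\<lambda>_::nat. M" by unfold_locales
  interpret P: pair_sigma_finite M "pow_measure M n" by (rule pair_pow)
  show ?thesis
  proof (rule PiM_eqI)
    fix A :: "nat \<Rightarrow> 'a set" assume A: "\<And>j. j \<in> {..<Suc n} \<Longrightarrow> A j \<in> sets M"
    let ?k = "\<lambda>j. if j < i then j else Suc j"
    have Ai: "A i \<in> sets M" "\<And>j. j < n \<Longrightarrow> A (?k j) \<in> sets M" using A assms by auto
    have "(\<lambda>(a, x). insert_at n i a x) -` (\<Pi>\<^sub>E j\<in>{..<Suc n}. A j) \<inter> space (M \<Otimes>\<^sub>M pow_measure M n)
       = A i \<times> (\<Pi>\<^sub>E j\<in>{..<n}. A (?k j))"
    proof (intro equalityI subsetI)
      fix p assume p: "p \<in> (\<lambda>(a, x). insert_at n i a x) -` (\<Pi>\<^sub>E j\<in>{..<Suc n}. A j) \<inter> space (M \<Otimes>\<^sub>M pow_measure M n)"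
      obtain a x where ax: "p = (a, x)" by (cases p)
      have *: "insert_at n i a x j \<in> A j" if "j < Suc n" for j
        using p that by (auto simp: ax PiE_iff)
      have "a \<in> A i" using *[of i] assms by (simp add: insert_at_def)
      moreover have "x j \<in> A (?k j)" if "j < n" for j
        using *[of "?k j"] that assms by (auto simp: insert_at_def split: if_splits)
      moreover have "x \<in> extensional {..<n}" using p by (auto simp: ax space_pair_measure space_PiM PiE_def)
      ultimately show "p \<in> A i \<times> (\<Pi>\<^sub>E j\<in>{..<n}. A (?k j))" by (auto simp: ax PiE_iff)
    next
      fix p assume "p \<in> A i \<times> (\<Pi>\<^sub>E j\<in>{..<n}. A (?k j))"
      then obtain a x where ax: "p = (a, x)" "a \<in> A i" "x \<in> extensional {..<n}" "\<And>j. j < n \<Longrightarrow> x j \<in> A (?k j)"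
        by (auto simp: PiE_iff)
      have "insert_at n i a x j \<in> A j" if "j < Suc n" for j
      proof (cases "j \<le> i")
        case True
        then show ?thesis using ax(2) ax(4)[of j] assms by (auto simp: insert_at_def)
      next
        case False
        then have "\<not> j - 1 < i" "Suc (j - 1) = j" by auto
        then show ?thesis using ax(4)[of "j - 1"] that False by (simp add: insert_at_def)
      qed
      moreover have "insert_at n i a x \<in> extensional {..<Suc n}" by (simp add: insert_at_def)
      moreover have "p \<in> space (M \<Otimes>\<^sub>M pow_measure M n)"
        using ax Ai sets.sets_into_space by (fastforce simp: space_pair_measure space_PiM PiE_iff)
      ultimately show "p \<in> (\<lambda>(a, x). insert_at n i a x) -` (\<Pi>\<^sub>E j\<in>{..<Suc n}. A j) \<inter> space (M \<Otimes>\<^sub>M pow_measure M n)"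
        by (auto simp: ax PiE_iff)
    qed
    then have "emeasure (distr (M \<Otimes>\<^sub>M pow_measure M n) (pow_measure M (Suc n)) (\<lambda>(a, x). insert_at n i a x)) (\<Pi>\<^sub>E j\<in>{..<Suc n}. A j)
      = emeasure (M \<Otimes>\<^sub>M pow_measure M n) (A i \<times> (\<Pi>\<^sub>E j\<in>{..<n}. A (?k j)))"
      using A assms by (subst emeasure_distr) (auto intro!: sets_PiM_I_finite measurable_insert_at)
    also have "\<dots> = emeasure M (A i) * emeasure (pow_measure M n) (\<Pi>\<^sub>E j\<in>{..<n}. A (?k j))"
      using Ai by (intro P.M2.emeasure_pair_measure_Times sets_PiM_I_finite) auto
    also have "\<dots> = emeasure M (A i) * (\<Prod>j<n. emeasure M (A (?k j)))"
      using Ai by (intro arg_cong[where f = "(*) _"] emeasure_PiM) auto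
    also have "\<dots> = (\<Prod>j<Suc n. emeasure M (A j))"
      using prod_insert_at[OF assms, of "\<lambda>j. emeasure M (A j)"] by simp
    finally show "emeasure (distr (M \<Otimes>\<^sub>M pow_measure M n) (pow_measure M (Suc n)) (\<lambda>(a, x). insert_at n i a x)) (\<Pi>\<^sub>E j\<in>{..<Suc n}. A j)
       = (\<Prod>j<Suc n. emeasure M (A j))" .
  qed auto
qed

lemma AE_pow_insert_at:
  assumes "i \<le> n" "AE x in pow_measure M (Suc n). P x"
  shows "AE a in M. AE x in pow_measure M n. P (insert_at n i a x)"
proof -
  interpret P: pair_sigma_finite M "pow_measure M n" by (rule pair_pow)
  have "AE p in M \<Otimes>\<^sub>M pow_measure M n. P (insert_at n i (fst p) (snd p))"
    using AE_distrD[OF measurable_insert_at[OF assms(1)], of P] assms(2)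
    unfolding distr_insert_at[OF assms(1)] by (simp add: case_prod_beta)
  from P.AE_pair[OF this] show ?thesis by simp
qed

lemma AE_pow_insert_at_iff:
  assumes "i \<le> n" "Measurable.pred (pow_measure M (Suc n)) P"
  shows "(AE x in pow_measure M (Suc n). P x) \<longleftrightarrow> (AE a in M. AE x in pow_measure M n. P (insert_at n i a x))"
proof -
  interpret P: pair_sigma_finite M "pow_measure M n" by (rule pair_pow)
  note measurable_insert_at[OF assms(1), measurable] assms(2)[measurable]
  have "(AE x in pow_measure M (Suc n). P x) \<longleftrightarrow>
    (AE x in distr (M \<Otimes>\<^sub>M pow_measure M n) (pow_measure M (Suc n)) (\<lambda>(a, x). insert_at n i a x). P x)"
    unfolding distr_insert_at[OF assms(1)] ..
  also have "\<dots> \<longleftrightarrow> (AE p in M \<Otimes>\<^sub>M pow_measure M n. P (case p of (a, x) \<Rightarrow> insert_at n i a x))"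
    by (rule AE_distr_iff) measurable
  also have "\<dots> \<longleftrightarrow> (AE a in M. AE x in pow_measure M n. P (insert_at n i a x))"
  proof -
    have "{p \<in> space (M \<Otimes>\<^sub>M pow_measure M n). P (insert_at n i (fst p) (snd p))} \<in> sets (M \<Otimes>\<^sub>M pow_measure M n)"
    proof -
      have "Measurable.pred (M \<Otimes>\<^sub>M pow_measure M n) (\<lambda>p. P (case p of (a, x) \<Rightarrow> insert_at n i a x))"
        by measurable
      then show ?thesis by (simp add: pred_def case_prod_beta)
    qed
    from P.AE_pair_iff[OF this] show ?thesis by (simp add: case_prod_beta)
  qed
  finally show ?thesis .
qed

text \<open>The preimage of a null set under omission of coordinate \<open>i\<close> is, once that
  coordinate is moved to the front, the product of \<open>M\<close> with the null set. Thus every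
  face of a generic tuple is generic.\<close>

lemma AE_pow_skip:
  assumes "i \<le> n" "AE x in pow_measure M n. P x"
  shows "AE x in pow_measure M (Suc n). P (skip n i x)"
proof -
  interpret P: pair_sigma_finite M "pow_measure M n" by (rule pair_pow)
  obtain N where N: "N \<in> null_sets (pow_measure M n)" "{x \<in> space (pow_measure M n). \<not> P x} \<subseteq> N"
    using assms(2) by (auto elim: AE_E3 simp: eventually_ae_filter)
  have m: "(\<lambda>x. skip n i x) \<in> pow_measure M (Suc n) \<rightarrow>\<^sub>M pow_measure M n"
    unfolding skip_def using assms(1) by (intro measurable_restrict) auto
  have N': "N \<in> sets (pow_measure M n)" using N(1) by auto
  have "Measurable.pred (pow_measure M (Suc n)) (\<lambda>x. skip n i x \<notin> N)"
    using measurable_sets[OF m N'] by (intro pred_intros_logic) (simp add: pred_def vimage_def Int_def conj_commute)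
  moreover have "AE a in M. AE x in pow_measure M n. skip n i (insert_at n i a x) \<notin> N"
  proof -
    have "AE x in pow_measure M n. skip n i (insert_at n i a x) \<notin> N" for a
      using AE_not_in[OF N(1)] AE_space
      by eventually_elim (auto simp: skip_insert_at assms(1) space_PiM PiE_def)
    then show ?thesis by simp
  qed
  ultimately have "AE x in pow_measure M (Suc n). skip n i x \<notin> N"
    by (subst AE_pow_insert_at_iff[OF assms(1)])
  then show ?thesis
    using AE_space
  proof eventually_elim
    case (elim x)
    then show ?case using N(2) measurable_space[OF m] by blast
  qed
qed



lemma AE_pow_component:
  assumes "i < n" "AE a in M. P a"
  shows "AE x in pow_measure M n. P (x i)"
proof -
  obtain N where N: "N \<in> null_sets M" "{x \<in> space M. \<not> P x} \<subseteq> N"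
    using assms(2) by (auto elim: AE_E3 simp: eventually_ae_filter)
  obtain m where m: "n = Suc m" "i \<le> m" using assms(1) by (cases n) auto
  have N': "N \<in> sets M" using N(1) by auto
  have "Measurable.pred (pow_measure M (Suc m)) (\<lambda>x. x i \<notin> N)"
    using m(2) N' by (intro pred_intros_logic pred_sets2[OF N'] measurable_component_singleton) auto
  moreover have "AE a in M. AE x in pow_measure M m. insert_at m i a x i \<notin> N"
    using AE_not_in[OF N(1)] by (rule eventually_mono) (use m(2) in \<open>simp add: insert_at_def\<close>)
  ultimately have "AE x in pow_measure M (Suc m). x i \<notin> N"
    by (subst AE_pow_insert_at_iff[OF m(2)])
  then show ?thesis
    unfolding m(1) using AE_space
  proof eventually_elim
    case (elim x)
    then show ?case using N(2) m(2) by (auto simp: space_PiM PiE_iff)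
  qed
qed

end

definition map_pow :: "nat \<Rightarrow> ('a \<Rightarrow> 'b) \<Rightarrow> (nat \<Rightarrow> 'a) \<Rightarrow> nat \<Rightarrow> 'b" where
  "map_pow n f x = (\<lambda>i\<in>{..<n}. f (x i))"

lemma measurable_map_pow:
  "f \<in> M \<rightarrow>\<^sub>M M' \<Longrightarrow> map_pow n f \<in> pow_measure M n \<rightarrow>\<^sub>M pow_measure M' n"
  unfolding map_pow_def
  by (intro measurable_restrict measurable_compose[OF measurable_component_singleton]) auto

lemma map_pow_insert_at:
  "i \<le> n \<Longrightarrow> map_pow (Suc n) f (insert_at n i a x) = insert_at n i (f a) (map_pow n f x)"
  by (auto simp: map_pow_def insert_at_def fun_eq_iff restrict_def)

text \<open>The hypothesis says that \<open>f\<close> carries the measure class of \<open>M\<close>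
  to that of \<open>M'\<close>. The class of a power depends only on the class of the factor; Fubini
  replaces one coordinate at a time.\<close>

lemma AE_map_pow_iff:
  assumes M: "sigma_finite_measure M" and M': "sigma_finite_measure M'" and f: "f \<in> M \<rightarrow>\<^sub>M M'"
    and AE: "\<And>P. Measurable.pred M' P \<Longrightarrow> (AE x in M. P (f x)) \<longleftrightarrow> (AE y in M'. P y)"
    and P: "Measurable.pred (pow_measure M' n) P"
  shows "(AE x in pow_measure M n. P (map_pow n f x)) \<longleftrightarrow> (AE y in pow_measure M' n. P y)"
  using P
proof (induction n arbitrary: P)
  case 0
  have e: "pow_measure M 0 = count_space {\<lambda>_. undefined}" "pow_measure M' 0 = count_space {\<lambda>_. undefined}"
    by (simp_all add: PiM_empty)
  show ?case unfolding e AE_count_space by (simp add: map_pow_def restrict_def)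
next
  case (Suc n)
  interpret M: sigma_finite_measure M by fact
  interpret M': sigma_finite_measure M' by fact
  note M'.measurable_insert_at[of 0 n, simplified, measurable] measurable_map_pow[OF f, measurable] f[measurable]
    Suc.prems[measurable]
  have p1: "Measurable.pred (pow_measure M (Suc n)) (\<lambda>x. P (map_pow (Suc n) f x))" by measurable
  interpret pM': sigma_finite_measure "pow_measure M' n" by (rule M'.pow_sigma_finite)
  have p2': "Measurable.pred (M' \<Otimes>\<^sub>M pow_measure M' n) (\<lambda>p. P (case p of (a, x) \<Rightarrow> insert_at n 0 a x))"
    by measurable
  have p2: "Measurable.pred (pow_measure M' n) (\<lambda>y. P (insert_at n 0 a y))" if "a \<in> space M'" for a
    using measurable_Pair2[OF p2' that] by simp
  \<comment> \<open>The hypothesis on \<open>f\<close> applies only to measurable predicates. The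
    inner condition is one because it says that a section of a measurable set has measure
    zero.\<close>
  have p3: "Measurable.pred M' (\<lambda>a. AE y in pow_measure M' n. P (insert_at n 0 a y))"
  proof -
    let ?Q = "{p \<in> space (M' \<Otimes>\<^sub>M pow_measure M' n). \<not> P (case p of (a, x) \<Rightarrow> insert_at n 0 a x)}"
    have Q: "?Q \<in> sets (M' \<Otimes>\<^sub>M pow_measure M' n)" using p2' by measurable
    have "(AE y in pow_measure M' n. P (insert_at n 0 a y)) \<longleftrightarrow> emeasure (pow_measure M' n) (Pair a -` ?Q) = 0"
      if a: "a \<in> space M'" for a
    proof (rule AE_iff_measurable)
      show "Pair a -` ?Q \<in> sets (pow_measure M' n)" using Q by (rule sets_Pair1)
      show "{x \<in> space (pow_measure M' n). \<not> P (insert_at n 0 a x)} = Pair a -` ?Q"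
        using a by (auto simp: space_pair_measure)
    qed
    moreover have "Measurable.pred M' (\<lambda>a. emeasure (pow_measure M' n) (Pair a -` ?Q) = 0)"
      using pM'.measurable_emeasure_Pair[OF Q] by measurable
    ultimately show ?thesis by (subst measurable_cong) auto
  qed
  have "(AE x in pow_measure M (Suc n). P (map_pow (Suc n) f x)) \<longleftrightarrow>
      (AE a in M. AE x in pow_measure M n. P (insert_at n 0 (f a) (map_pow n f x)))"
    by (subst M.AE_pow_insert_at_iff[OF le0 p1]) (simp add: map_pow_insert_at)
  also have "\<dots> \<longleftrightarrow> (AE a in M. AE y in pow_measure M' n. P (insert_at n 0 (f a) y))"
    using Suc.IH[OF p2] measurable_space[OF f] by (intro AE_cong) simp
  also have "\<dots> \<longleftrightarrow> (AE b in M'. AE y in pow_measure M' n. P (insert_at n 0 b y))"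
    by (rule AE[OF p3])
  also have "\<dots> \<longleftrightarrow> (AE y in pow_measure M' (Suc n). P y)"
    by (subst M'.AE_pow_insert_at_iff[OF le0 Suc.prems]) simp
  finally show ?case .
qed

subsection \<open>Haar measure\<close>

text \<open>Comparison with exp(1 - |x|); the 1 comes from |x| \<le> 1 + x^2, a consequence of (|x|
  - 1)^2 \<ge> 0.\<close>

lemma ennreal_gauss_finite_real: "(\<integral>\<^sup>+x. ennreal (exp (- (x::real)\<^sup>2)) \<partial>lborel) < \<infinity>"
proof -
  define g where "g x = ennreal (exp (1 - x)) * indicator {0..} x" for x :: real
  have [measurable]: "g \<in> borel_measurable borel" by (simp add: g_def[abs_def])
  have "((\<lambda>x::real. - exp (1 - x)) \<longlongrightarrow> - 0) at_top"
  proof (rule tendsto_minus)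
    have "((\<lambda>x::real. exp 1 * exp (- x)) \<longlongrightarrow> 0) at_top"
      by (rule tendsto_mult_right_zero[OF filterlim_compose[OF exp_at_bot filterlim_uminus_at_bot_at_top]])
    then show "((\<lambda>x::real. exp (1 - x)) \<longlongrightarrow> 0) at_top"
      by (simp add: exp_diff exp_minus field_simps)
  qed
  then have I: "(\<integral>\<^sup>+x. g x \<partial>lborel) = ennreal (0 - (- exp (1 - 0)))"
    unfolding g_def
    by (intro nn_integral_FTC_atLeast[where F = "\<lambda>x. - exp (1 - x)"]) (auto intro!: derivative_eq_intros)
  have I': "(\<integral>\<^sup>+x. g (- x) \<partial>lborel) = (\<integral>\<^sup>+x. g x \<partial>lborel)"
    using nn_integral_real_affine[of g "-1" 0] by simp
  have "ennreal (exp (- x\<^sup>2)) \<le> g x + g (- x)" for x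
  proof -
    have "0 \<le> (\<bar>x\<bar> - 1)\<^sup>2" "\<bar>x\<bar>\<^sup>2 = x\<^sup>2" by auto
    then have "\<bar>x\<bar> \<le> 1 + x\<^sup>2" by (simp add: power2_diff)
    then have "exp (- x\<^sup>2) \<le> exp (1 - \<bar>x\<bar>)" by simp
    then have "ennreal (exp (- x\<^sup>2)) \<le> ennreal (exp (1 - \<bar>x\<bar>))" by (rule ennreal_leI)
    also have "\<dots> \<le> g x + g (- x)" by (cases "x \<ge> 0") (auto simp: g_def intro: add_increasing2)
    finally show ?thesis .
  qed
  then have "(\<integral>\<^sup>+x. ennreal (exp (- x\<^sup>2)) \<partial>lborel) \<le> (\<integral>\<^sup>+x. g x + g (- x) \<partial>lborel)"
    by (intro nn_integral_mono) auto
  also have "\<dots> = (\<integral>\<^sup>+x. g x \<partial>lborel) + (\<integral>\<^sup>+x. g (- x) \<partial>lborel)"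
    by (rule nn_integral_add) auto
  also have "\<dots> < \<infinity>" by (simp add: I I' ennreal_add_less_top)
  finally show ?thesis .
qed

lemma ennreal_gauss_finite:
  "(\<integral>\<^sup>+x. ennreal (exp (- (norm (x::'a::euclidean_space))\<^sup>2)) \<partial>lborel) < \<infinity>"
proof -
  have "ennreal (exp (- (norm x)\<^sup>2)) = (\<Prod>b\<in>Basis. ennreal (exp (- (x \<bullet> b)\<^sup>2)))" for x :: 'a
  proof -
    have "(norm x)\<^sup>2 = (\<Sum>b\<in>Basis. (x \<bullet> b)\<^sup>2)"
      by (subst power2_norm_eq_inner, subst euclidean_inner) (simp add: power2_eq_square)
    then show ?thesis by (simp add: prod_ennreal exp_sum flip: sum_negf)
  qed
  then have "(\<integral>\<^sup>+x. ennreal (exp (- (norm (x::'a))\<^sup>2)) \<partial>lborel)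
    = (\<Prod>b\<in>(Basis::'a set). \<integral>\<^sup>+x. ennreal (exp (- x\<^sup>2)) \<partial>lborel)"
    by (simp add: nn_integral_lborel_prod[of "\<lambda>b x. ennreal (exp (- x\<^sup>2))"])
  also have "\<dots> < \<infinity>"
    using ennreal_gauss_finite_real by (simp add: power_less_top_ennreal)
  finally show ?thesis .
qed

section \<open>Continuity of the matrix operations\<close>

lemma continuous_on_det3 [continuous_intros]:
  fixes f :: "'a::topological_space \<Rightarrow> 'k::real_normed_field^3^3"
  shows "continuous_on A f \<Longrightarrow> continuous_on A (\<lambda>x. det (f x))"
  by (simp add: det_3) (intro continuous_intros)

lemma continuous_on_matrix_mult [continuous_intros]:
  fixes f g :: "'a::topological_space \<Rightarrow> 'k::real_normed_field^3^3"
  shows "continuous_on A f \<Longrightarrow> continuous_on A g \<Longrightarrow> continuous_on A (\<lambda>x. f x ** g x)"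
  unfolding matrix_matrix_mult_def by (intro continuous_intros)

lemma continuous_on_matrix_vector [continuous_intros]:
  fixes f :: "'a::topological_space \<Rightarrow> 'k::real_normed_field^3^3"
  shows "continuous_on A f \<Longrightarrow> continuous_on A g \<Longrightarrow> continuous_on A (\<lambda>x. f x *v g x)"
  unfolding matrix_vector_mult_def by (intro continuous_intros)

lemma continuous_on_column [continuous_intros]:
  fixes f :: "'a::topological_space \<Rightarrow> 'k::real_normed_field^3^3"
  shows "continuous_on A f \<Longrightarrow> continuous_on A (\<lambda>x. column i (f x))"
  unfolding column_def by (intro continuous_intros)

lemma continuous_on_transpose [continuous_intros]:
  fixes f :: "'a::topological_space \<Rightarrow> 'k::real_normed_field^3^3"
  shows "continuous_on A f \<Longrightarrow> continuous_on A (\<lambda>x. transpose (f x))"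
  unfolding transpose_def by (intro continuous_intros)

lemma continuous_on_pairing [continuous_intros]:
  fixes f g :: "'a::topological_space \<Rightarrow> 'k::real_normed_field^3"
  shows "continuous_on A f \<Longrightarrow> continuous_on A g \<Longrightarrow> continuous_on A (\<lambda>x. pairing (f x) (g x))"
  unfolding pairing_def by (intro continuous_intros)

lemma crossk_lambda: "crossk a b = (\<chi> i. if i = 1 then a $ 2 * b $ 3 - a $ 3 * b $ 2
    else if i = 2 then a $ 3 * b $ 1 - a $ 1 * b $ 3 else a $ 1 * b $ 2 - a $ 2 * b $ 1)"
  by (simp add: vec_eq_iff forall_3)

lemma continuous_on_crossk [continuous_intros]:
  fixes f g :: "'a::topological_space \<Rightarrow> 'k::real_normed_field^3"
  assumes "continuous_on A f" "continuous_on A g"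
  shows "continuous_on A (\<lambda>x. crossk (f x) (g x))"
  unfolding crossk_lambda
proof (rule continuous_on_vec_lambda)
  fix i :: 3
  show "continuous_on A (\<lambda>x. if i = 1 then f x $ 2 * g x $ 3 - f x $ 3 * g x $ 2
     else if i = 2 then f x $ 3 * g x $ 1 - f x $ 1 * g x $ 3 else f x $ 1 * g x $ 2 - f x $ 2 * g x $ 1)"
    using assms by (cases "i = 1"; cases "i = 2"; simp; intro continuous_intros)
qed

lemma continuous_on_covec [continuous_intros]:
  fixes f :: "'a::topological_space \<Rightarrow> 'k::real_normed_field^3^3"
  shows "continuous_on A f \<Longrightarrow> continuous_on A (\<lambda>x. covec (f x))"
  unfolding covec_def by (intro continuous_intros)

lemma continuous_on_colmat [continuous_intros]:
  fixes f g h :: "'a::topological_space \<Rightarrow> 'k::real_normed_field^3"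
  assumes "continuous_on A f" "continuous_on A g" "continuous_on A h"
  shows "continuous_on A (\<lambda>x. colmat (f x) (g x) (h x))"
  unfolding colmat_def
proof (intro continuous_on_vec_lambda)
  fix i j :: 3
  show "continuous_on A (\<lambda>x. if j = 1 then f x $ i else if j = 2 then g x $ i else h x $ i)"
    using assms by (cases "j = 1"; cases "j = 2"; simp; intro continuous_intros)
qed

lemma continuous_on_scale3 [continuous_intros]:
  fixes f :: "'a::topological_space \<Rightarrow> 'k::real_normed_field^3"
  shows "continuous_on A c \<Longrightarrow> continuous_on A f \<Longrightarrow> continuous_on A (\<lambda>x. c x *s f x)"
  unfolding vector_scalar_mult_def by (intro continuous_intros)

section \<open>Haar measure as an image of Lebesgue measure\<close>

definition to_SL3 :: "'k::rc_field^3^3 \<Rightarrow> 'k^3^3" where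
  "to_SL3 m = colmat (inverse (det m) *s column 1 m) (column 2 m) (column 3 m)"

lemma to_SL3_eq: "(\<chi> i j. if j = 1 then m $ i $ j / det m else m $ i $ j) = to_SL3 m"
  by (simp add: to_SL3_def colmat_def column_def vec_eq_iff forall_3 field_simps)

lemma det_to_SL3: "det m \<noteq> 0 \<Longrightarrow> to_SL3 m \<in> SL3"
proof -
  assume m: "det m \<noteq> 0"
  have "det m = pairing (crossk (column 2 m) (column 3 m)) (column 1 m)"
    using colmat_columns[of m] det_colmat pairing_crossk_rotate by metis
  moreover have "det (to_SL3 m) = pairing (crossk (column 2 m) (column 3 m)) (inverse (det m) *s column 1 m)"
    unfolding to_SL3_def det_colmat by (rule pairing_crossk_rotate)
  ultimately show ?thesis using m by (simp add: SL3_def)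
qed

definition small_det :: "('k::rc_field^3^3) set" where
  "small_det = {m. 0 < norm (det m) \<and> norm (det m) \<le> 1}"

lemma small_det_sets [measurable]: "small_det \<in> sets borel"
proof -
  have [measurable]: "(det :: 'a^3^3 \<Rightarrow> 'a) \<in> borel_measurable borel"
    by (intro borel_measurable_continuous_onI continuous_intros)
  show ?thesis unfolding small_det_def by measurable
qed

lemma haar_eq: "haar = distr (restrict_space lborel small_det) (restrict_space borel SL3) to_SL3"
  unfolding haar_def small_det_def[symmetric] to_SL3_eq ..

lemma continuous_on_to_SL3: "continuous_on {m. det m \<noteq> 0} to_SL3"
  unfolding to_SL3_def by (intro continuous_intros) auto

lemma to_SL3_measurable: "to_SL3 \<in> restrict_space lborel small_det \<rightarrow>\<^sub>M restrict_space borel SL3"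
proof (rule measurable_restrict_space2)
  show "to_SL3 \<in> space (restrict_space lborel small_det) \<rightarrow> SL3"
    by (auto simp: space_restrict_space small_det_def det_to_SL3)
  have "continuous_on small_det to_SL3"
    by (rule continuous_on_subset[OF continuous_on_to_SL3]) (auto simp: small_det_def)
  then have "to_SL3 \<in> borel_measurable (restrict_space borel small_det)"
    by (rule borel_measurable_continuous_on_restrict)
  then show "to_SL3 \<in> borel_measurable (restrict_space lborel small_det)"
    by (simp cong: measurable_cong_sets sets_restrict_space_cong)
qed

lemma space_haar [simp]: "space haar = SL3"
  by (simp add: haar_eq space_restrict_space)

lemma sets_haar: "sets haar = sets (restrict_space borel SL3)"
  by (simp add: haar_eq)

lemma measurable_haar_borel: "f \<in> borel_measurable borel \<Longrightarrow> f \<in> borel_measurable haar"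
  using measurable_cong_sets[OF sets_haar refl] measurable_restrict_space1 by blast

lemma continuous_haar: "continuous_on UNIV f \<Longrightarrow> f \<in> borel_measurable haar"
  by (intro measurable_haar_borel borel_measurable_continuous_onI)

lemma haar_id [measurable]: "(\<lambda>x. x) \<in> borel_measurable haar"
  by (rule continuous_haar) (rule continuous_on_id)

lemma measurable_to_haar:
  "f \<in> borel_measurable M \<Longrightarrow> (\<And>x. x \<in> space M \<Longrightarrow> f x \<in> SL3) \<Longrightarrow> f \<in> M \<rightarrow>\<^sub>M haar"
  using measurable_cong_sets[OF refl sets_haar] measurable_restrict_space2[of f M SL3 borel] by blast

lemma continuous_measurable2:
  fixes F :: "'a::second_countable_topology \<Rightarrow> 'b::second_countable_topology \<Rightarrow> 'c::topological_space"
  assumes "continuous_on UNIV (\<lambda>p. F (fst p) (snd p))" "f \<in> borel_measurable M" "g \<in> borel_measurable M"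
  shows "(\<lambda>x. F (f x) (g x)) \<in> borel_measurable M"
proof -
  have "(\<lambda>x. (f x, g x)) \<in> M \<rightarrow>\<^sub>M borel"
    unfolding borel_prod[symmetric] using assms(2,3) by measurable
  from measurable_compose[OF this borel_measurable_continuous_onI[OF assms(1)]] show ?thesis by simp
qed

lemma AE_haar_iff:
  assumes "Measurable.pred haar P"
  shows "(AE g in haar. P g) \<longleftrightarrow> (AE m in lborel. m \<in> small_det \<longrightarrow> P (to_SL3 m))"
proof -
  have "{x \<in> space (restrict_space borel SL3). P x} \<in> sets (restrict_space borel SL3)"
    using assms by (simp add: pred_def sets_haar space_restrict_space)
  then have "(AE g in haar. P g) \<longleftrightarrow> (AE m in restrict_space lborel small_det. P (to_SL3 m))"
    unfolding haar_eq by (rule AE_distr_iff[OF to_SL3_measurable])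
  also have "\<dots> \<longleftrightarrow> (AE m in lborel. m \<in> small_det \<longrightarrow> P (to_SL3 m))"
    by (rule AE_restrict_space_iff) simp
  finally show ?thesis .
qed

lemma AE_lborel_negligible: "(AE x in lborel. P x) \<longleftrightarrow> negligible {x. \<not> P x}"
  using eventually_ae_filter_negligible[of P] AE_completion_iff[of P lborel] negligible_subset by blast

text \<open>On \<open>small_det\<close> the first column is divided by a number of norm at most 1,
  so entries only grow. A Gaussian on \<open>SL3\<close> is thus dominated by the Gaussian on all
  matrices.\<close>

lemma norm_to_SL3:
  assumes "m \<in> small_det"
  shows "norm m \<le> norm (to_SL3 m)"
proof -
  have d: "norm (det m) \<le> 1" "det m \<noteq> 0" using assms by (auto simp: small_det_def)
  have le: "norm (m $ i $ j) \<le> norm (to_SL3 m $ i $ j)" for i j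
  proof (cases "j = 1")
    case True
    have "1 \<le> inverse (norm (det m))" using d by (simp add: one_le_inverse_iff)
    then have "norm (m $ i $ j) \<le> inverse (norm (det m)) * norm (m $ i $ j)"
      using mult_right_mono[of 1 _ "norm (m $ i $ j)"] by simp
    then show ?thesis
      using True d(2) by (simp add: to_SL3_def colmat_def column_def norm_mult norm_inverse)
  qed (use exhaust_3[of j] in \<open>auto simp: to_SL3_def colmat_def column_def\<close>)
  have "norm (m $ i) \<le> norm (to_SL3 m $ i)" for i
    unfolding norm_vec_def by (rule L2_set_mono) (use le in auto)
  then show ?thesis
    unfolding norm_vec_def[of m] norm_vec_def[of "to_SL3 m"] by (intro L2_set_mono) auto
qed

lemma nn_integral_haar:
  assumes "f \<in> borel_measurable haar"
  shows "(\<integral>\<^sup>+g. f g \<partial>haar) = (\<integral>\<^sup>+m. f (to_SL3 m) * indicator small_det m \<partial>lborel)"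
proof -
  have "f \<in> borel_measurable (restrict_space borel SL3)"
    using assms by (simp cong: measurable_cong_sets add: sets_haar)
  then have "(\<integral>\<^sup>+g. f g \<partial>haar) = (\<integral>\<^sup>+m. f (to_SL3 m) \<partial>restrict_space lborel small_det)"
    unfolding haar_eq by (subst nn_integral_distr[OF to_SL3_measurable]) auto
  also have "\<dots> = (\<integral>\<^sup>+m. f (to_SL3 m) * indicator small_det m \<partial>lborel)"
    by (rule nn_integral_restrict_space) simp
  finally show ?thesis .
qed

lemma gauss_haar: "(\<integral>\<^sup>+g. ennreal (exp (- (norm g)\<^sup>2)) \<partial>(haar :: ('k::rc_field^3^3) measure)) < \<infinity>"
proof -
  have "(\<integral>\<^sup>+g. ennreal (exp (- (norm g)\<^sup>2)) \<partial>(haar :: ('k::rc_field^3^3) measure))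
      = (\<integral>\<^sup>+m. ennreal (exp (- (norm (to_SL3 m :: 'k^3^3))\<^sup>2)) * indicator small_det m \<partial>lborel)"
    by (rule nn_integral_haar) measurable
  also have "\<dots> \<le> (\<integral>\<^sup>+m. ennreal (exp (- (norm (m :: 'k^3^3))\<^sup>2)) \<partial>lborel)"
    by (intro nn_integral_mono) (auto simp: indicator_def norm_to_SL3 intro!: ennreal_leI power_mono)
  also have "\<dots> < \<infinity>" by (rule ennreal_gauss_finite)
  finally show ?thesis .
qed

text \<open>On the ball of radius \<open>n\<close> the Gaussian weight is at least exp(-n^2), so its
  finite integral bounds the measure of the ball.\<close>

lemma sigma_finite_haar: "sigma_finite_measure (haar :: ('k::rc_field^3^3) measure)"
proof
  let ?A = "\<lambda>n::nat. {g \<in> space haar. norm (g::'k^3^3) \<le> real n}"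
  have A: "?A n \<in> sets haar" for n by measurable
  have "emeasure haar (?A n) \<noteq> \<infinity>" for n
  proof -
    have "emeasure haar (?A n) = (\<integral>\<^sup>+g. indicator (?A n) g \<partial>haar)" using A by simp
    also have "\<dots> \<le> (\<integral>\<^sup>+g. ennreal (exp ((real n)\<^sup>2)) * ennreal (exp (- (norm (g::'k^3^3))\<^sup>2)) \<partial>haar)"
    proof (rule nn_integral_mono)
      fix g :: "'k^3^3"
      have "1 \<le> exp ((real n)\<^sup>2 + - (norm g)\<^sup>2)" if "norm g \<le> real n"
        using power_mono[OF that] by simp
      then have "ennreal 1 \<le> ennreal (exp ((real n)\<^sup>2) * exp (- (norm g)\<^sup>2))" if "norm g \<le> real n"
        using that by (intro ennreal_leI) (simp only: exp_add)
      then show "indicator (?A n) g \<le> ennreal (exp ((real n)\<^sup>2)) * ennreal (exp (- (norm g)\<^sup>2))"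
        by (auto simp: indicator_def ennreal_mult)
    qed
    also have "\<dots> = ennreal (exp ((real n)\<^sup>2)) * (\<integral>\<^sup>+g. ennreal (exp (- (norm (g::'k^3^3))\<^sup>2)) \<partial>haar)"
      by (rule nn_integral_cmult) measurable
    also have "\<dots> < \<infinity>" using gauss_haar[where 'k = 'k] by (simp add: ennreal_mult_less_top)
    finally show ?thesis by simp
  qed
  moreover have "(\<Union>n. ?A n) = space haar" using real_arch_simple by auto
  ultimately show "\<exists>A::('k^3^3) set set. countable A \<and> A \<subseteq> sets haar \<and> \<Union> A = space haar \<and> (\<forall>a\<in>A. emeasure haar a \<noteq> \<infinity>)"
    using A by (intro exI[of _ "range ?A"]) auto
qed

text \<open>Replaces an arbitrary almost sure property by the measurable property of avoiding a null
  set, to which Fubini and transport of measures apply.\<close>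

lemma AE_null_pred:
  assumes "AE x in M. P x"
  shows "\<exists>Q. Measurable.pred M Q \<and> (AE x in M. Q x) \<and> (\<forall>x\<in>space M. Q x \<longrightarrow> P x)"
proof -
  obtain N where "\<And>x. x \<in> space M - N \<Longrightarrow> P x" "N \<in> null_sets M"
    using assms by (rule AE_E3) blast
  then show ?thesis
    by (intro exI[of _ "\<lambda>x. x \<notin> N"]) (auto intro: AE_not_in)
qed

section \<open>Null sets under translation and inversion\<close>

lemma haar_mult [measurable]:
  "(\<lambda>p. fst p ** snd p) \<in> haar \<Otimes>\<^sub>M haar \<rightarrow>\<^sub>M (haar :: ('k::rc_field^3^3) measure)"
proof (rule measurable_to_haar)
  show "(\<lambda>p. fst p ** snd p) \<in> borel_measurable (haar \<Otimes>\<^sub>M (haar :: ('k^3^3) measure))"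
  proof (rule continuous_measurable2[of "(**)" fst _ snd])
    show "continuous_on UNIV (\<lambda>p :: ('k^3^3) \<times> ('k^3^3). fst p ** snd p)" by (intro continuous_intros)
    show "fst \<in> borel_measurable (haar \<Otimes>\<^sub>M haar)" "snd \<in> borel_measurable (haar \<Otimes>\<^sub>M haar)"
      using measurable_compose[OF measurable_fst haar_id] measurable_compose[OF measurable_snd haar_id] by auto
  qed
qed (auto simp: space_pair_measure SL3_mult)

lemma haar_left [measurable]: "g \<in> SL3 \<Longrightarrow> (\<lambda>x. g ** x) \<in> haar \<rightarrow>\<^sub>M haar"
  by (rule measurable_to_haar, intro continuous_haar continuous_intros, simp add: SL3_mult)

lemma linear_left_mult: "linear (\<lambda>m. (g :: 'k::rc_field^3^3) ** m)"
  by (rule linearI) (simp add: matrix_add_ldistrib,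
      simp add: matrix_matrix_mult_def vec_eq_iff scaleR_right.sum)

text \<open>The exceptional set is the image of a negligible set under a linear map, and linear maps
  of a Euclidean space to itself preserve negligibility.\<close>

lemma AE_lborel_left_mult:
  assumes "AE m in lborel. P m" "g \<in> SL3"
  shows "AE m in lborel. P (g ** (m :: 'k::rc_field^3^3))"
proof -
  have "negligible ((\<lambda>m. matrix_inv g ** m) ` {m. \<not> P m})"
    using assms(1) linear_left_mult
    by (intro negligible_differentiable_image_negligible linear_imp_differentiable_on)
       (auto simp: AE_lborel_negligible)
  moreover have "{m. \<not> P (g ** m)} \<subseteq> (\<lambda>m. matrix_inv g ** m) ` {m. \<not> P m}"
  proof
    fix m assume "m \<in> {m. \<not> P (g ** m)}"
    then show "m \<in> (\<lambda>m. matrix_inv g ** m) ` {m. \<not> P m}"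
      by (intro image_eqI[where x = "g ** m"]) (simp_all add: SL3_inv_mat[OF assms(2)])
  qed
  ultimately show ?thesis
    unfolding AE_lborel_negligible by (rule negligible_subset)
qed

lemma to_SL3_left: "g \<in> SL3 \<Longrightarrow> to_SL3 (g ** m) = g ** to_SL3 m"
  by (simp add: to_SL3_def colmat_mult column_mult SL3_def det_mul)
     (simp add: matrix_vector_mult_def vec_eq_iff colmat_def sum_3 algebra_simps)

lemma AE_haar_left:
  assumes "AE x in haar. P x" "g \<in> SL3"
  shows "AE x in haar. P (g ** x)"
proof -
  obtain Q where Q: "Measurable.pred haar Q" "AE x in haar. Q x" "\<forall>x\<in>SL3. Q x \<longrightarrow> P x"
    using AE_null_pred[OF assms(1)] unfolding space_haar by blast
  have "AE m in lborel. m \<in> small_det \<longrightarrow> Q (to_SL3 m)"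
    using Q(2) unfolding AE_haar_iff[OF Q(1)] .
  from AE_lborel_left_mult[OF this assms(2)]
  have "AE m in lborel. m \<in> small_det \<longrightarrow> Q (g ** to_SL3 m)"
    using assms(2) by (simp add: to_SL3_left small_det_def det_mul SL3_def)
  moreover have "Measurable.pred haar (\<lambda>x. Q (g ** x))"
    using Q(1) haar_left[OF assms(2)] by measurable
  ultimately have "AE x in haar. Q (g ** x)"
    by (simp add: AE_haar_iff)
  then show ?thesis
    using AE_space by eventually_elim (use assms(2) Q(3) SL3_mult in auto)
qed

text \<open>\<open>haar\<close> charges every nonempty open subset of \<open>SL3\<close>: where the
  continuous \<open>f\<close> does not vanish, its preimage under \<open>to_SL3\<close> contains a
  nonempty open set of matrices, which is not negligible.\<close>

lemma AE_haar_continuous: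
  fixes f :: "'k::rc_field^3^3 \<Rightarrow> real"
  assumes f: "continuous_on UNIV f" and AE: "AE x in haar. f x = 0" and h: "h \<in> SL3"
  shows "f h = 0"
proof (rule ccontr)
  assume "f h \<noteq> 0"
  have [measurable]: "f \<in> borel_measurable haar" by (rule continuous_haar[OF f])
  have "AE m in lborel. m \<in> small_det \<longrightarrow> f (to_SL3 m) = 0"
    using AE by (subst (asm) AE_haar_iff) measurable
  then have neg: "negligible {m. \<not> (m \<in> small_det \<longrightarrow> f (to_SL3 m) = 0)}"
    by (simp only: AE_lborel_negligible)
  define U where "U = {m. det m \<noteq> 0} \<inter> (f \<circ> to_SL3) -` (- {0})"
  have o: "open {m::'k^3^3. det m \<noteq> 0}" "open {m::'k^3^3. norm (det m) < 1}"
    by (intro open_Collect_neq open_Collect_less continuous_intros)+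
  have "continuous_on {m. det m \<noteq> 0} (f \<circ> to_SL3)"
    by (rule continuous_on_compose[OF continuous_on_to_SL3]) (rule continuous_on_subset[OF f], simp)
  then have "open U"
    unfolding U_def using o(1) by (rule continuous_open_preimage) auto
  then have "open (U \<inter> {m. norm (det m) < 1})"
    using o(2) by auto
  moreover have "U \<inter> {m. norm (det m) < 1} \<subseteq> {m. \<not> (m \<in> small_det \<longrightarrow> f (to_SL3 m) = 0)}"
    by (auto simp: U_def small_det_def)
  then have "negligible (U \<inter> {m. norm (det m) < 1})"
    by (rule negligible_subset[OF neg])
  moreover have "U \<inter> {m. norm (det m) < 1} \<noteq> {}"
  proof -
    \<comment> \<open>A preimage of \<open>h\<close> in the interior of \<open>small_det\<close>:
      halving the first column gives determinant 1/2, and \<open>to_SL3\<close> restores it.\<close>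
    define m where "m = colmat (of_real (1/2) *s column 1 h) (column 2 h) (column 3 h)"
    have "det m = of_real (1/2) * det h"
    proof -
      have "det m = pairing (crossk (column 2 h) (column 3 h)) (of_real (1/2) *s column 1 h)"
        unfolding m_def det_colmat by (rule pairing_crossk_rotate)
      moreover have "det h = pairing (crossk (column 2 h) (column 3 h)) (column 1 h)"
        using colmat_columns[of h] det_colmat pairing_crossk_rotate by metis
      ultimately show ?thesis by simp
    qed
    then have d: "det m = of_real (1/2)" using h by (simp add: SL3_def)
    have c: "column 1 m = of_real (1/2) *s column 1 h" "column 2 m = column 2 h" "column 3 m = column 3 h"
      by (simp_all add: m_def)
    have "inverse (det m) *s column 1 m = column 1 h"
      by (simp add: c(1) d)
    then have "to_SL3 m = h"
      using colmat_columns[of h] unfolding to_SL3_def c(2,3) by simp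
    then have "m \<in> U \<inter> {m. norm (det m) < 1}"
    proof -
      have "norm (det m) = 1 / 2" unfolding d norm_of_real by simp
      moreover from this have "det m \<noteq> 0" by auto
      ultimately show ?thesis using \<open>f h \<noteq> 0\<close> \<open>to_SL3 m = h\<close> by (simp add: U_def)
    qed
    then show ?thesis by blast
  qed
  ultimately show False using open_not_negligible by blast
qed

lemma AE_haar_ex:
  assumes "AE x in haar. P (x :: 'k::rc_field^3^3)"
  shows "\<exists>x\<in>SL3. P x"
proof (rule ccontr)
  assume no: "\<not> (\<exists>x\<in>SL3. P x)"
  have "AE x in (haar :: ('k^3^3) measure). (1::real) = 0"
    using assms AE_space
  proof eventually_elim
    case (elim x)
    then show ?case using no by auto
  qed
  from AE_haar_continuous[OF continuous_on_const this one_SL3] show False by simp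
qed

text \<open>Cramer's rule: the rows of the inverse are cross products of columns.\<close>

lemma matrix_inv_SL3:
  assumes "g \<in> SL3"
  shows "matrix_inv g = transpose (colmat (crossk (column 2 g) (column 3 g)) (crossk (column 3 g) (column 1 g)) (crossk (column 1 g) (column 2 g)))"
    (is "_ = ?h")
proof -
  have d: "pairing (crossk (column 1 g) (column 2 g)) (column 3 g) = 1"
    using assms by (simp add: SL3_def flip: det_colmat) (simp add: colmat_columns)
  have e: "(?h ** g) $ i $ j = pairing (?h $ i) (column j g)" for i j
    by (simp add: matrix_matrix_mult_def pairing_def column_def)
  have r: "?h $ 1 = crossk (column 2 g) (column 3 g)" "?h $ 2 = crossk (column 3 g) (column 1 g)"
    "?h $ 3 = crossk (column 1 g) (column 2 g)"
    by (simp_all add: transpose_def colmat_def vec_eq_iff)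
  have p: "pairing (crossk (column 2 g) (column 3 g)) (column 1 g) = 1"
    "pairing (crossk (column 3 g) (column 1 g)) (column 2 g) = 1"
    using d pairing_crossk_rotate by metis+
  have "(?h ** g) $ i $ j = mat 1 $ i $ j" for i j
    using exhaust_3[of i] exhaust_3[of j] by (elim disjE; simp only: e r; simp add: mat_def d p)
  then have "?h ** g = mat 1"
    by (simp only: vec_eq_iff) simp
  then have "g ** ?h = mat 1" by (simp add: matrix_left_right_inverse)
  then show ?thesis by (rule SL3_inv_unique[OF assms])
qed

lemma haar_inv [measurable]: "matrix_inv \<in> haar \<rightarrow>\<^sub>M haar"
proof (rule measurable_to_haar)
  let ?f = "\<lambda>g::'a^3^3. transpose (colmat (crossk (column 2 g) (column 3 g)) (crossk (column 3 g) (column 1 g)) (crossk (column 1 g) (column 2 g)))"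
  have "?f \<in> borel_measurable haar" by (intro continuous_haar continuous_intros)
  then show "matrix_inv \<in> borel_measurable (haar :: ('a^3^3) measure)"
    by (subst measurable_cong[where g = ?f]) (simp_all add: matrix_inv_SL3)
qed (simp add: SL3_inv)

lemma pair_haar: "pair_sigma_finite haar haar"
  by (intro pair_sigma_finite.intro sigma_finite_haar)

text \<open>Left invariance alone gives invariance of the null sets under inversion: by Fubini
  \<open>{y. y\<inverse> x \<in> N}\<close> is null for almost every \<open>x\<close>.\<close>

lemma AE_haar_inv:
  assumes "AE x in haar. P (x :: 'k::rc_field^3^3)"
  shows "AE x in haar. P (matrix_inv x)"
proof -
  interpret pair_sigma_finite "haar :: ('k^3^3) measure" haar by (rule pair_haar)
  obtain Q where Q: "Measurable.pred haar Q" "AE x in haar. Q x" "\<forall>x\<in>SL3. Q x \<longrightarrow> P x"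
    using AE_null_pred[OF assms] unfolding space_haar by blast
  note Q(1)[measurable]
  have m: "(\<lambda>p. matrix_inv (fst p) ** snd p) \<in> haar \<Otimes>\<^sub>M haar \<rightarrow>\<^sub>M (haar :: ('k^3^3) measure)"
  proof -
    have "(\<lambda>p. (matrix_inv (fst p), snd p)) \<in> haar \<Otimes>\<^sub>M haar \<rightarrow>\<^sub>M haar \<Otimes>\<^sub>M (haar :: ('k^3^3) measure)"
      by measurable
    from measurable_compose[OF this haar_mult] show ?thesis by simp
  qed
  have "AE y in haar. AE x in haar. Q (matrix_inv y ** x)"
    using AE_space by (rule eventually_mono) (auto intro!: AE_haar_left[OF Q(2)] SL3_inv)
  moreover have "{p \<in> space (haar \<Otimes>\<^sub>M haar). Q (matrix_inv (fst p) ** snd p)} \<in> sets (haar \<Otimes>\<^sub>M haar)"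
    using measurable_compose[OF m Q(1)] by (simp add: pred_def)
  ultimately have "AE x in haar. AE y in haar. Q (matrix_inv y ** x)"
    by (subst (asm) AE_commute) auto
  then obtain x where x: "x \<in> SL3" "AE y in haar. Q (matrix_inv y ** x)"
    using AE_haar_ex by blast
  have "AE y in haar. Q (matrix_inv (x ** y) ** x)"
    by (rule AE_haar_left[OF x(2) x(1)])
  then show ?thesis
    using AE_space
  proof eventually_elim
    case (elim y)
    then show ?case
      using x(1) by (intro Q(3)[rule_format]) (simp_all add: SL3_inv SL3_inv_mult flip: matrix_mul_assoc)
  qed
qed

text \<open>Right translation by \<open>b\<close> is inversion, followed by left translation by the
  inverse of \<open>b\<close>, followed by inversion.\<close>

lemma AE_haar_right:
  assumes "AE x in haar. P (x :: 'k::rc_field^3^3)" "b \<in> SL3"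
  shows "AE x in haar. P (x ** b)"
proof -
  have "AE x in haar. P (matrix_inv (matrix_inv b ** matrix_inv x))"
    by (rule AE_haar_inv[OF AE_haar_left[OF AE_haar_inv[OF assms(1)] SL3_inv(3)[OF assms(2)]]])
  then show ?thesis
    using AE_space
    by eventually_elim (use assms(2) in \<open>simp add: SL3_inv SL3_inv_mult SL3_inv_inv\<close>)
qed

section \<open>Generic columns and covectors\<close>

lemma AE_haar_column:
  fixes f :: "'k::rc_field^3"
  assumes "f \<noteq> 0"
  shows "AE h in haar. pairing f (column 1 h) \<noteq> 0"
proof -
  \<comment> \<open>A proper linear subspace of the matrices, hence Lebesgue null.
    \<open>to_SL3\<close> only rescales the first column, which does not affect whether
    \<open>f\<close> vanishes on it.\<close>
  let ?S = "{m :: 'k^3^3. pairing f (column 1 m) = 0}"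
  have s: "subspace ?S"
  proof (rule subspaceI)
    fix x y :: "'k^3^3" and c :: real
    have "column 1 (x + y) = column 1 x + column 1 y" "column 1 (c *\<^sub>R x) = of_real c *s column 1 x"
      by (simp_all add: column_def vec_eq_iff) (simp add: scaleR_conv_of_real)
    then show "x \<in> ?S \<Longrightarrow> y \<in> ?S \<Longrightarrow> x + y \<in> ?S" "x \<in> ?S \<Longrightarrow> c *\<^sub>R x \<in> ?S"
      by (simp_all add: pairing_add_right)
  qed (simp add: pairing_3 column_def)
  have "?S \<noteq> UNIV"
  proof -
    obtain x where "pairing f x \<noteq> 0" using pairing_ex[OF assms] by blast
    then have "colmat x 0 0 \<notin> ?S" by simp
    then show ?thesis by blast
  qed
  then have "dim ?S < DIM('k^3^3)"
  proof -
    have "span ?S = ?S" using s by (simp only: span_eq_iff)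
    then have "dim ?S \<noteq> DIM('k^3^3)" using dim_eq_full[of ?S] \<open>?S \<noteq> UNIV\<close> by metis
    then show ?thesis using dim_subset_UNIV[of ?S] by (simp only: le_neq_implies_less not_False_eq_True)
  qed
  then have "negligible ?S" by (rule negligible_lowdim)
  then have "AE m in lborel. pairing f (column 1 (m::'k^3^3)) \<noteq> 0"
    by (simp add: AE_lborel_negligible)
  then have "AE m in lborel. m \<in> small_det \<longrightarrow> pairing f (column 1 (to_SL3 (m::'k^3^3))) \<noteq> 0"
    by eventually_elim (auto simp: to_SL3_def small_det_def)
  moreover have "(\<lambda>h::'k^3^3. pairing f (column 1 h)) \<in> borel_measurable haar"
    by (intro continuous_haar continuous_intros)
  ultimately show ?thesis
    by (subst AE_haar_iff) measurable
qed

lemma vec_SL3_ex: "v \<noteq> 0 \<Longrightarrow> \<exists>g\<in>SL3. column 1 g = (v :: 'k::rc_field^3)"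
proof -
  assume v: "v \<noteq> 0"
  obtain i where i: "v $ i \<noteq> 0" using v by (auto simp: vec_eq_iff)
  obtain b where b: "crossk v b \<noteq> 0"
  proof -
    have "crossk v (axis 1 1) $ 2 = v $ 3" "crossk v (axis 1 1) $ 3 = - v $ 2" "crossk v (axis 2 1) $ 3 = v $ 1"
      by (simp_all add: axis_def)
    then have "\<exists>b. crossk v b \<noteq> 0"
      using i exhaust_3[of i] by (metis neg_equal_0_iff_equal zero_index)
    then show thesis using that by blast
  qed
  obtain x where x: "pairing (crossk v b) x \<noteq> 0" using pairing_ex[OF b] by blast
  then have "colmat v b (inverse (pairing (crossk v b) x) *s x) \<in> SL3"
    by (simp add: SL3_def det_colmat)
  then show ?thesis by force
qed

text \<open>\<open>covec h\<close> is the third row of the inverse of \<open>h\<close>. If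
  \<open>b\<close> has first column \<open>v\<close>, the pairing is the third entry of the first
  column of that inverse times \<open>b\<close>, so the statement on columns applies after a right
  translation and an inversion.\<close>

lemma AE_haar_covec:
  fixes v :: "'k::rc_field^3"
  assumes "v \<noteq> 0"
  shows "AE h in haar. pairing (covec h) v \<noteq> 0"
proof -
  obtain b where b: "b \<in> SL3" "column 1 b = v" using vec_SL3_ex[OF assms] by blast
  have "AE h in haar. pairing (axis 3 1 :: 'k^3) (column 1 h) \<noteq> 0"
    by (rule AE_haar_column) (simp add: axis_eq_0_iff)
  from AE_haar_inv[OF AE_haar_right[OF this b(1)]]
  show ?thesis
    using AE_space
  proof eventually_elim
    case (elim h)
    have "pairing (covec h) v = (matrix_inv h *v v) $ 3"
      using pairing_covec[of h "matrix_inv h *v v"] elim(2) by (simp add: SL3_inv_vec SL3_def)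
    then show ?case
      using elim(1) by (simp add: column_mult b(2) pairing_commute[of "axis 3 1"])
  qed
qed

subsection \<open>The flag measure\<close>

text \<open>The generating family in \<open>flag_measure\<close> is already closed, being the
  quotient structure of the orbit map. Measurable sets of flags can therefore be recognised directly
  by their preimages.\<close>

lemma flag_sets_sigma_algebra:
  "sigma_algebra flags {E. E \<subseteq> flags \<and> {g \<in> SL3. flag_act g std_flag \<in> E} \<in> sets haar}"
proof -
  have f: "flag_act g std_flag \<in> flags" if "g \<in> SL3" for g :: "'a^3^3"
    using that by (simp add: flag_act_std_in SL3_det_nz)
  have c: "{g \<in> SL3. flag_act g std_flag \<in> flags - E} = space haar - {g \<in> SL3. flag_act g std_flag \<in> E}" for E :: "'a flag set"
    using f by auto
  have u: "{g \<in> SL3. flag_act g std_flag \<in> (\<Union>i. A i)} = (\<Union>i. {g \<in> SL3. flag_act g std_flag \<in> A i})" for A :: "nat \<Rightarrow> 'a flag set"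
    by auto
  show ?thesis
    unfolding sigma_algebra_iff2 mem_Collect_eq c u
    by (intro conjI allI impI ballI subsetI sets.Diff sets.top sets.countable_UN) auto
qed

lemma space_flag [simp]: "space flag_measure = flags"
  by (auto simp: flag_measure_def space_measure_of_conv)

lemma sets_flag: "sets (flag_measure :: 'k::rc_field flag measure) = {E. E \<subseteq> flags \<and> {g \<in> SL3. flag_act g std_flag \<in> E} \<in> sets haar}"
proof -
  have "sets (flag_measure :: 'k flag measure) = sigma_sets flags {E. E \<subseteq> flags \<and> {g \<in> SL3. flag_act g std_flag \<in> E} \<in> sets haar}"
    unfolding flag_measure_def sets_distr by (rule sets_measure_of) auto
  then show ?thesis
    using sigma_algebra.sigma_sets_eq[OF flag_sets_sigma_algebra] by simp
qed

lemma measurable_std_flag [measurable]: "(\<lambda>g. flag_act g std_flag) \<in> haar \<rightarrow>\<^sub>M flag_measure"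
  by (rule measurableI) (auto simp: sets_flag flag_act_std_in SL3_det_nz vimage_def Int_def conj_commute)

text \<open>The universal property of the quotient Borel structure: measurability on flags is tested
  on the group.\<close>

lemma measurable_flag:
  assumes "(\<lambda>g. f (flag_act g std_flag)) \<in> haar \<rightarrow>\<^sub>M N" "\<And>F. F \<in> flags \<Longrightarrow> f F \<in> space N"
  shows "f \<in> flag_measure \<rightarrow>\<^sub>M N"
proof (rule measurableI)
  fix A assume A: "A \<in> sets N"
  have "{g \<in> SL3. flag_act g std_flag \<in> f -` A \<inter> flags} = (\<lambda>g. f (flag_act g std_flag)) -` A \<inter> space haar"
    by (auto simp: flag_act_std_in SL3_det_nz)
  also have "\<dots> \<in> sets haar" using assms(1) A by (rule measurable_sets)
  finally show "f -` A \<inter> space flag_measure \<in> sets flag_measure"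
    by (simp add: sets_flag)
qed (use assms(2) in auto)

lemma flag_measure_eq:
  "flag_measure = distr (density haar (\<lambda>g. ennreal (exp (- (norm g)\<^sup>2)))) flag_measure (\<lambda>g. flag_act g std_flag)"
  unfolding flag_measure_def by (rule distr_cong) (simp_all add: sets_distr)

text \<open>The Gaussian density that makes \<open>flag_measure\<close> finite is strictly positive,
  so it leaves the null sets unchanged.\<close>

lemma AE_flag_iff:
  assumes "Measurable.pred flag_measure P"
  shows "(AE g in haar. P (flag_act g std_flag)) \<longleftrightarrow> (AE F in flag_measure. P F)"
proof -
  have m: "(\<lambda>g. flag_act g std_flag) \<in> density haar (\<lambda>g. ennreal (exp (- (norm g)\<^sup>2))) \<rightarrow>\<^sub>M flag_measure"
    by simp
  have "{x \<in> space flag_measure. P x} \<in> sets flag_measure" using assms by (simp add: pred_def)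
  from AE_distr_iff[OF m this] have "(AE F in flag_measure. P F) \<longleftrightarrow>
    (AE g in density haar (\<lambda>g. ennreal (exp (- (norm g)\<^sup>2))). P (flag_act g std_flag))"
    by (simp only: flag_measure_eq[symmetric])
  also have "\<dots> \<longleftrightarrow> (AE g in haar. P (flag_act g std_flag))"
    by (subst AE_density) auto
  finally show ?thesis ..
qed

lemma sigma_finite_flag: "sigma_finite_measure (flag_measure :: 'k::rc_field flag measure)"
proof -
  let ?D = "density (haar :: ('k^3^3) measure) (\<lambda>g. ennreal (exp (- (norm g)\<^sup>2)))"
  have m: "(\<lambda>g. flag_act g std_flag) \<in> ?D \<rightarrow>\<^sub>M flag_measure" by simp
  have "emeasure ?D (space ?D) = (\<integral>\<^sup>+g. ennreal (exp (- (norm (g::'k^3^3))\<^sup>2)) * indicator SL3 g \<partial>haar)"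
    by (subst emeasure_density) (auto simp flip: space_haar)
  also have "\<dots> \<le> (\<integral>\<^sup>+g. ennreal (exp (- (norm (g::'k^3^3))\<^sup>2)) \<partial>haar)"
    by (rule nn_integral_mono) (auto simp: indicator_def)
  also have "\<dots> < \<infinity>" by (rule gauss_haar)
  finally have "finite_measure ?D" by (intro finite_measureI) simp
  then have "finite_measure (distr ?D flag_measure (\<lambda>g. flag_act g std_flag))"
    using m by (rule finite_measure.finite_measure_distr)
  then have "finite_measure (flag_measure :: 'k flag measure)"
    by (simp only: flag_measure_eq[symmetric])
  then show ?thesis by (rule finite_measure.axioms(1))
qed

interpretation haar: sigma_finite_measure "haar :: ('k::rc_field^3^3) measure"
  by (rule sigma_finite_haar)

interpretation flag: sigma_finite_measure "flag_measure :: 'k::rc_field flag measure"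
  by (rule sigma_finite_flag)

lemma AE_pow_flag_iff:
  assumes "Measurable.pred (pow_measure flag_measure n) P"
  shows "(AE x in pow_measure haar n. P (map_pow n (\<lambda>g. flag_act g std_flag) x)) \<longleftrightarrow>
    (AE y in pow_measure flag_measure n. P y)"
  by (rule AE_map_pow_iff[OF sigma_finite_haar sigma_finite_flag measurable_std_flag AE_flag_iff assms])

lemma AE_pow_flagD:
  assumes "AE y in pow_measure flag_measure n. P y"
  shows "AE x in pow_measure haar n. P (map_pow n (\<lambda>g. flag_act g std_flag) x)"
proof -
  obtain Q where Q: "Measurable.pred (pow_measure flag_measure n) Q" "AE y in pow_measure flag_measure n. Q y"
    "\<forall>y\<in>space (pow_measure flag_measure n). Q y \<longrightarrow> P y"
    using AE_null_pred[OF assms] by blast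
  have "AE x in pow_measure haar n. Q (map_pow n (\<lambda>g. flag_act g std_flag) x)"
    using Q(2) by (simp only: AE_pow_flag_iff[OF Q(1)])
  then show ?thesis
    using AE_space
  proof eventually_elim
    case (elim x)
    then show ?case
      using measurable_space[OF measurable_map_pow[OF measurable_std_flag] elim(2)] Q(3) by blast
  qed
qed

lemma translate_eq_map_pow: "translate act n g = map_pow n (act g)"
  by (simp add: fun_eq_iff translate_def map_pow_def)

lemma AE_map_powD:
  assumes M: "sigma_finite_measure M" and f: "f \<in> M \<rightarrow>\<^sub>M M"
    and AE: "\<And>P. Measurable.pred M P \<Longrightarrow> (AE x in M. P (f x)) \<longleftrightarrow> (AE y in M. P y)"
    and P: "AE x in pow_measure M n. P x"
  shows "AE x in pow_measure M n. P (map_pow n f x)"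
proof -
  obtain Q where Q: "Measurable.pred (pow_measure M n) Q" "AE y in pow_measure M n. Q y"
    "\<forall>y\<in>space (pow_measure M n). Q y \<longrightarrow> P y"
    using AE_null_pred[OF P] by blast
  have "AE x in pow_measure M n. Q (map_pow n f x)"
    using Q(2) AE_map_pow_iff[OF M M f AE Q(1)] by simp
  then show ?thesis
    using AE_space
  proof eventually_elim
    case (elim x)
    then show ?case
      using measurable_space[OF measurable_map_pow[OF f] elim(2)] Q(3) by blast
  qed
qed

lemma AE_haar_left_iff:
  assumes "g \<in> SL3"
  shows "(AE x in haar. P (g ** x)) \<longleftrightarrow> (AE x in haar. P (x :: 'k::rc_field^3^3))"
proof
  assume "AE x in haar. P (g ** x)"
  from AE_haar_left[OF this SL3_inv(3)[OF assms]] show "AE x in haar. P x"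
    by (simp add: SL3_inv_mat[OF assms])
qed (rule AE_haar_left[OF _ assms])

lemma AE_pow_haar_translate:
  "g \<in> SL3 \<Longrightarrow> AE x in pow_measure haar n. P x \<Longrightarrow> AE x in pow_measure haar n. P (translate (**) n g x)"
  unfolding translate_eq_map_pow
  by (rule AE_map_powD[OF sigma_finite_haar haar_left AE_haar_left_iff])

lemma measurable_flag_act [measurable]:
  assumes "g \<in> SL3"
  shows "flag_act g \<in> flag_measure \<rightarrow>\<^sub>M flag_measure"
proof (rule measurable_flag)
  show "(\<lambda>h. flag_act g (flag_act h std_flag)) \<in> haar \<rightarrow>\<^sub>M flag_measure"
    using measurable_compose[OF haar_left[OF assms] measurable_std_flag] by (simp add: flag_act_mult)
qed (use assms flag_act_in in auto)

lemma AE_flag_act_iff: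
  assumes g: "g \<in> SL3" and P: "Measurable.pred flag_measure P"
  shows "(AE F in flag_measure. P (flag_act g F)) \<longleftrightarrow> (AE F in flag_measure. P F)"
proof -
  have "Measurable.pred flag_measure (\<lambda>F. P (flag_act g F))"
    using measurable_compose[OF measurable_flag_act[OF g] P] .
  then have "(AE F in flag_measure. P (flag_act g F)) \<longleftrightarrow> (AE h in haar. P (flag_act (g ** h) std_flag))"
    by (simp only: AE_flag_iff[symmetric] flag_act_mult)
  also have "\<dots> \<longleftrightarrow> (AE F in flag_measure. P F)"
    by (simp only: AE_haar_left_iff[OF g, of "\<lambda>h. P (flag_act h std_flag)"] AE_flag_iff[OF P])
  finally show ?thesis .
qed

lemma AE_pow_flag_translate:
  "g \<in> SL3 \<Longrightarrow> AE x in pow_measure flag_measure n. P x \<Longrightarrow> AE x in pow_measure flag_measure n. P (translate flag_act n g x)"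
  unfolding translate_eq_map_pow
  by (rule AE_map_powD[OF sigma_finite_flag measurable_flag_act AE_flag_act_iff])

subsection \<open>Small powers\<close>

lemma insert_at_0: "insert_at n 0 a x 0 = a"
  and insert_at_Suc: "j < n \<Longrightarrow> insert_at n 0 a x (Suc j) = x j"
  by (simp_all add: insert_at_def)

context sigma_finite_measure
begin

lemma AE_pow_1: "(AE x in pow_measure M (Suc 0). P (x 0)) \<longleftrightarrow> (AE a in M. P a)"
proof
  assume "AE x in pow_measure M (Suc 0). P (x 0)"
  from AE_pow_insert_at[OF _ this, of 0]
  have a: "AE a in M. AE x in pow_measure M 0. P a"
    by (simp add: insert_at_0)
  have e: "pow_measure M 0 = count_space {\<lambda>_. undefined}" by (simp add: PiM_empty)
  show "AE a in M. P a"
    using a unfolding e AE_count_space by simp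
qed (rule AE_pow_component, simp)

lemma AE_pow_2D:
  assumes "AE x in pow_measure M 2. P (x 0) (x 1)"
  shows "AE a in M. AE b in M. P a b"
proof -
  have "AE a in M. AE x in pow_measure M (Suc 0). P a (x 0)"
    using AE_pow_insert_at[of 0 "Suc 0" "\<lambda>x. P (x 0) (x 1)"] assms
    unfolding numeral_2_eq_2 by (simp add: insert_at_0 insert_at_Suc)
  then show ?thesis by (simp only: AE_pow_1)
qed

lemma AE_pow_3D:
  assumes "AE x in pow_measure M 3. P (x 0) (x 1) (x 2)"
  shows "AE a in M. AE b in M. AE c in M. P a b c"
proof -
  have "AE a in M. AE x in pow_measure M 2. P a (x 0) (x 1)"
    using AE_pow_insert_at[of 0 "Suc (Suc 0)" "\<lambda>x. P (x 0) (x 1) (x 2)"] assms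
    unfolding numeral_2_eq_2 numeral_3_eq_3 by (simp add: insert_at_0 insert_at_Suc)
  then show ?thesis by (rule eventually_mono) (rule AE_pow_2D)
qed

lemma pred_insert_at:
  assumes "Measurable.pred (pow_measure M (Suc n)) P" "a \<in> space M"
  shows "Measurable.pred (pow_measure M n) (\<lambda>x. P (insert_at n 0 a x))"
proof -
  have "(\<lambda>x. (a, x)) \<in> pow_measure M n \<rightarrow>\<^sub>M M \<Otimes>\<^sub>M pow_measure M n" using assms(2) by measurable
  from measurable_compose[OF this measurable_compose[OF measurable_insert_at[OF le0] assms(1)]]
  show ?thesis by simp
qed

text \<open>The direction of Fubini from iterated to joint statements, which requires measurability;
  its converse \<open>AE_pow_2D\<close> holds for every property.\<close>

lemma AE_pow_2I:
  assumes "Measurable.pred (pow_measure M 2) (\<lambda>x. P (x 0) (x 1))" "AE a in M. AE b in M. P a b"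
  shows "AE x in pow_measure M 2. P (x 0) (x 1)"
proof -
  have "AE a in M. AE x in pow_measure M (Suc 0). P a (x 0)"
    using assms(2) by (simp only: AE_pow_1)
  then show ?thesis
    using AE_pow_insert_at_iff[of 0 "Suc 0" "\<lambda>x. P (x 0) (x 1)"] assms(1)
    unfolding numeral_2_eq_2 by (simp add: insert_at_0 insert_at_Suc)
qed

lemma AE_pow_3I:
  assumes "Measurable.pred (pow_measure M 3) (\<lambda>x. P (x 0) (x 1) (x 2))" "AE a in M. AE b in M. AE c in M. P a b c"
  shows "AE x in pow_measure M 3. P (x 0) (x 1) (x 2)"
proof -
  have "AE a in M. AE x in pow_measure M 2. P a (x 0) (x 1)"
    using assms(2) AE_space
  proof eventually_elim
    case (elim a)
    have "Measurable.pred (pow_measure M 2) (\<lambda>x. P a (x 0) (x 1))"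
      using pred_insert_at[where n = "Suc (Suc 0)" and P = "\<lambda>x. P (x 0) (x 1) (x 2)" and a = a] assms(1) elim(2)
      unfolding numeral_2_eq_2 numeral_3_eq_3 by (simp add: insert_at_0 insert_at_Suc)
    then show ?case using elim(1) by (rule AE_pow_2I)
  qed
  then show ?thesis
    using AE_pow_insert_at_iff[of 0 "Suc (Suc 0)" "\<lambda>x. P (x 0) (x 1) (x 2)"] assms(1)
    unfolding numeral_2_eq_2 numeral_3_eq_3 by (simp add: insert_at_0 insert_at_Suc)
qed

end

subsection \<open>Invariants of flags\<close>

lemma borel_measurable_pairing:
  fixes f g :: "'a \<Rightarrow> 'k::rc_field^3"
  assumes "f \<in> borel_measurable M" "g \<in> borel_measurable M"
  shows "(\<lambda>x. pairing (f x) (g x)) \<in> borel_measurable M"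
  by (rule continuous_measurable2[of pairing f M g, OF _ assms]) (intro continuous_intros)

lemma borel_measurable_crossk:
  fixes f g :: "'a \<Rightarrow> 'k::rc_field^3"
  assumes "f \<in> borel_measurable M" "g \<in> borel_measurable M"
  shows "(\<lambda>x. crossk (f x) (g x)) \<in> borel_measurable M"
  by (rule continuous_measurable2[of crossk f M g, OF _ assms]) (intro continuous_intros)

lemma borel_measurable_matrix_vector:
  fixes f :: "'a \<Rightarrow> 'k::rc_field^3^3"
  assumes "f \<in> borel_measurable M" "g \<in> borel_measurable M"
  shows "(\<lambda>x. f x *v g x) \<in> borel_measurable M" "(\<lambda>x. transpose (f x) *v g x) \<in> borel_measurable M"
  by (rule continuous_measurable2[of "(*v)" f M g, OF _ assms], intro continuous_intros,
      rule continuous_measurable2[of "\<lambda>f g. transpose f *v g" f M g, OF _ assms], intro continuous_intros)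

lemma normalize3_measurable: "(normalize3 :: 'k::rc_field^3 \<Rightarrow> _) \<in> borel_measurable borel"
proof -
  have c: "(\<lambda>v::'k^3. v $ i) \<in> borel_measurable borel" for i
    by (intro borel_measurable_continuous_onI continuous_intros)
  have s: "(\<lambda>v::'k^3. inverse (v $ i) *s v) \<in> borel_measurable borel" for i
    using c[of i] by (intro continuous_measurable2[of "(*s)" "\<lambda>v. inverse (v $ i)" borel "\<lambda>v. v"] continuous_intros) auto
  have p: "Measurable.pred borel (\<lambda>v::'k^3. v $ i \<noteq> 0)" for i using c[of i] by measurable
  show ?thesis
    unfolding normalize3_def using s p by (intro measurable_If) auto
qed

lemma fpoint_measurable [measurable]: "fpoint \<in> borel_measurable (flag_measure :: 'k::rc_field flag measure)"
proof (rule measurable_flag)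
  have "(\<lambda>g::'k^3^3. normalize3 (column 1 g)) \<in> borel_measurable haar"
    by (intro measurable_compose[OF _ normalize3_measurable] continuous_haar continuous_intros)
  then show "(\<lambda>g. fpoint (flag_act g std_flag :: 'k flag)) \<in> borel_measurable haar"
    by (subst measurable_cong[where g = "\<lambda>g. normalize3 (column 1 g)"]) (simp_all add: fpoint_std)
qed simp

lemma fcov_measurable [measurable]: "fcov \<in> borel_measurable (flag_measure :: 'k::rc_field flag measure)"
proof (rule measurable_flag)
  have "(\<lambda>g::'k^3^3. normalize3 (covec g)) \<in> borel_measurable haar"
    by (intro measurable_compose[OF _ normalize3_measurable] continuous_haar continuous_intros)
  then show "(\<lambda>g. fcov (flag_act g std_flag :: 'k flag)) \<in> borel_measurable haar"
    by (subst measurable_cong[where g = "\<lambda>g. normalize3 (covec g)"]) (simp_all add: fcov_std)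
qed simp

text \<open>\<open>height g F\<close> is \<open>log a\<^sub>2\<close> for the Iwasawa component \<open>a\<close> of \<open>h\<inverse> g\<close>, where
  \<open>F = h P\<close>, up to a constant that depends only on the normalisation of the coordinates of \<open>F\<close>.\<close>

definition incid :: "'k::rc_field flag \<Rightarrow> 'k flag \<Rightarrow> real" where
  "incid F F' = norm (pairing (fcov F) (fpoint F'))"

text \<open>The function B for the lift of a flag by its normalised coordinates
  \<open>fpoint\<close> and \<open>fcov\<close>.\<close>

definition bracket :: "'k::rc_field flag \<Rightarrow> 'k flag \<Rightarrow> real" where
  "bracket F F' = ln (incid F F') - ln (incid F' F)"

definition height :: "'k::rc_field^3^3 \<Rightarrow> 'k flag \<Rightarrow> real" where
  "height g F = ln (norm (matrix_inv g *v fpoint F)) - ln (norm (transpose g *v fcov F))"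

lemma incid_measurable [measurable (raw)]:
  "f \<in> M \<rightarrow>\<^sub>M flag_measure \<Longrightarrow> g \<in> M \<rightarrow>\<^sub>M flag_measure \<Longrightarrow> (\<lambda>x. incid (f x) (g x)) \<in> borel_measurable M"
  unfolding incid_def
  using measurable_compose[OF _ fcov_measurable] measurable_compose[OF _ fpoint_measurable]
  by (intro borel_measurable_norm[THEN measurable_compose[rotated]] borel_measurable_pairing) auto

lemma bracket_measurable [measurable (raw)]:
  "f \<in> M \<rightarrow>\<^sub>M flag_measure \<Longrightarrow> g \<in> M \<rightarrow>\<^sub>M flag_measure \<Longrightarrow> (\<lambda>x. bracket (f x) (g x)) \<in> borel_measurable M"
  unfolding bracket_def by (intro borel_measurable_diff borel_measurable_ln incid_measurable)

lemma height_measurable [measurable (raw)]: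
  assumes f: "f \<in> M \<rightarrow>\<^sub>M haar" and g: "g \<in> M \<rightarrow>\<^sub>M flag_measure"
  shows "(\<lambda>x. height (f x) (g x)) \<in> borel_measurable M"
proof -
  have "(\<lambda>x. matrix_inv (f x)) \<in> borel_measurable M" "f \<in> borel_measurable M"
    using measurable_compose[OF measurable_compose[OF f haar_inv] haar_id] measurable_compose[OF f haar_id] by auto
  moreover have "(\<lambda>x. fpoint (g x)) \<in> borel_measurable M" "(\<lambda>x. fcov (g x)) \<in> borel_measurable M"
    using measurable_compose[OF g fcov_measurable] measurable_compose[OF g fpoint_measurable] by auto
  ultimately have "(\<lambda>x. matrix_inv (f x) *v fpoint (g x)) \<in> borel_measurable M"
    "(\<lambda>x. transpose (f x) *v fcov (g x)) \<in> borel_measurable M"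
    using borel_measurable_matrix_vector by auto
  then show ?thesis unfolding height_def by measurable
qed

lemma incid_std:
  "g \<in> SL3 \<Longrightarrow> h \<in> SL3 \<Longrightarrow>
    incid (flag_act g std_flag) (flag_act h std_flag) = 0 \<longleftrightarrow> pairing (covec g) (column 1 h) = 0"
  using fpoint_ex[of h] fcov_ex[of g] by (auto simp: incid_def)

lemma height_nz:
  assumes "g \<in> SL3" "F \<in> flags"
  shows "matrix_inv g *v fpoint F \<noteq> 0" "transpose g *v fcov F \<noteq> 0"
proof -
  show "matrix_inv g *v fpoint F \<noteq> 0"
    using SL3_inv_vec(2)[OF assms(1), of "fpoint F"] flag_eqs(1)[OF assms(2)] by auto
  obtain x where "pairing (fcov F) x \<noteq> 0" using pairing_ex flag_eqs(2)[OF assms(2)] by blast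
  then have "pairing (transpose g *v fcov F) (matrix_inv g *v x) \<noteq> 0"
    by (simp add: pairing_transpose SL3_inv_vec[OF assms(1)])
  then show "transpose g *v fcov F \<noteq> 0" by auto
qed

lemma pairing_eqI: "(\<And>x. pairing f x = pairing f' x) \<Longrightarrow> f = f'"
  using pairing_axis by (metis vec_eq_iff)

text \<open>The factors \<open>p\<close> and \<open>c\<close> by which the normalised coordinates change under the action.\<close>

lemma flag_act_factors:
  assumes k: "k \<in> SL3"
  shows "\<exists>p c. \<forall>F\<in>flags. p F > 0 \<and> c F > 0 \<and>
    (\<forall>F'\<in>flags. incid (flag_act k F) (flag_act k F') = c F * p F' * incid F F') \<and>
    (\<forall>g\<in>SL3. height (k ** g) (flag_act k F) = height g F + ln (p F) - ln (c F))"
proof -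
  define P where "P F = (SOME a. a \<noteq> 0 \<and> fpoint (flag_act k F) = a *s (k *v fpoint F))" for F
  define C where "C F = (SOME a. a \<noteq> 0 \<and> (\<forall>x. pairing (fcov (flag_act k F)) (k *v x) = a * pairing (fcov F) x))" for F
  have P: "P F \<noteq> 0" "fpoint (flag_act k F) = P F *s (k *v fpoint F)" if "F \<in> flags" for F
    using someI_ex[OF fpoint_act[OF that k]] by (auto simp: P_def)
  have "C F \<noteq> 0 \<and> (\<forall>x. pairing (fcov (flag_act k F)) (k *v x) = C F * pairing (fcov F) x)" if "F \<in> flags" for F
    unfolding C_def by (rule someI_ex[OF fcov_act[OF that k]])
  then have C: "C F \<noteq> 0" "pairing (fcov (flag_act k F)) (k *v x) = C F * pairing (fcov F) x" if "F \<in> flags" for F x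
    using that by blast+
  have "incid (flag_act k F) (flag_act k F') = norm (C F) * norm (P F') * incid F F'"
    if "F \<in> flags" "F' \<in> flags" for F F'
    using P(2)[OF that(2)] C(2)[OF that(1)] by (simp add: incid_def norm_mult)
  moreover have "height (k ** g) (flag_act k F) = height g F + ln (norm (P F)) - ln (norm (C F))"
    if "F \<in> flags" "g \<in> SL3" for F g
  proof -
    have "matrix_inv (k ** g) *v fpoint (flag_act k F) = P F *s (matrix_inv g *v fpoint F)"
      using P(2)[OF that(1)] k that(2)
      by (simp add: SL3_inv_mult SL3_inv_vec vec.scale flip: matrix_vector_mul_assoc)
    moreover have "transpose (k ** g) *v fcov (flag_act k F) = C F *s (transpose g *v fcov F)"
      by (rule pairing_eqI) (simp add: pairing_transpose C(2)[OF that(1)] flip: matrix_vector_mul_assoc)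
    ultimately show ?thesis
      using P(1)[OF that(1)] C(1)[OF that(1)] height_nz[OF that(2,1)]
      by (simp add: height_def norm_scale ln_mult)
  qed
  ultimately show ?thesis
    using P(1) C(1) by (intro exI[of _ "\<lambda>F. norm (P F)"] exI[of _ "\<lambda>F. norm (C F)"]) auto
qed

text \<open>If the coordinates of a flag scale by p and c, the bracket gains log c - log p at
  \<open>F\<close> minus the same at \<open>F'\<close>, while the difference of heights gains the
  opposite. This yields the invariance of \<open>zigzag\<close>, and also that of cyclic sums of
  brackets, in which the heights cancel.\<close>

lemma bracket_height_act:
  assumes k: "k \<in> SL3" and g: "g \<in> SL3" and F: "F \<in> flags" "F' \<in> flags" and nz: "incid F F' \<noteq> 0" "incid F' F \<noteq> 0"
  shows "bracket (flag_act k F) (flag_act k F') + height (k ** g) (flag_act k F) - height (k ** g) (flag_act k F')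
    = bracket F F' + height g F - height g F'"
proof -
  obtain p c where pc: "\<forall>F\<in>flags. p F > 0 \<and> c F > 0 \<and>
    (\<forall>F'\<in>flags. incid (flag_act k F) (flag_act k F') = c F * p F' * incid F F') \<and>
    (\<forall>g\<in>SL3. height (k ** g) (flag_act k F) = height g F + ln (p F) - ln (c F))"
    using flag_act_factors[OF k] by blast
  have pos: "p F > 0" "c F > 0" "p F' > 0" "c F' > 0" using pc F by auto
  have i: "incid (flag_act k F) (flag_act k F') = c F * p F' * incid F F'"
    "incid (flag_act k F') (flag_act k F) = c F' * p F * incid F' F"
    and h: "height (k ** g) (flag_act k F) = height g F + ln (p F) - ln (c F)"
    "height (k ** g) (flag_act k F') = height g F' + ln (p F') - ln (c F')"
    using pc F g by blast+
  have "incid F F' > 0" "incid F' F > 0" using nz by (auto simp: incid_def)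
  then show ?thesis
    using pos unfolding bracket_def i h by (simp add: ln_mult)
qed

lemma pred_neq_0:
  fixes f :: "'a \<Rightarrow> 'b::{t1_space, zero}"
  assumes "f \<in> borel_measurable M"
  shows "Measurable.pred M (\<lambda>x. f x \<noteq> 0)"
proof -
  have "f -` (- {0}) \<inter> space M \<in> sets M" by (rule measurable_sets[OF assms]) auto
  then show ?thesis by (simp add: pred_def vimage_def Int_def conj_commute)
qed

lemma AE_pow_incid:
  assumes ij: "i < n" "j < n" "i \<noteq> j"
  shows "AE y in pow_measure (flag_measure :: 'k::rc_field flag measure) n. incid (y i) (y j) \<noteq> 0"
proof -
  obtain m where m: "n = Suc m" "j \<le> m" using ij by (cases n) auto
  let ?P = "\<lambda>x. incid (map_pow n (\<lambda>g. flag_act g std_flag :: 'k flag) x i) (map_pow n (\<lambda>g. flag_act g std_flag) x j) \<noteq> 0"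
  have comp: "(\<lambda>y. y i) \<in> pow_measure flag_measure n \<rightarrow>\<^sub>M (flag_measure :: 'k flag measure)"
    "(\<lambda>y. y j) \<in> pow_measure flag_measure n \<rightarrow>\<^sub>M (flag_measure :: 'k flag measure)"
    using ij by (auto intro: measurable_component_singleton)
  have p: "Measurable.pred (pow_measure (flag_measure :: 'k flag measure) n) (\<lambda>y. incid (y i) (y j) \<noteq> 0)"
    by (rule pred_neq_0[OF incid_measurable[OF comp]])
  have "Measurable.pred (pow_measure (haar :: ('k^3^3) measure) n) ?P"
    using measurable_compose[OF measurable_map_pow[OF measurable_std_flag] p] .
  moreover have "AE a in haar. AE x in pow_measure haar m. ?P (insert_at m j a x)"
    using AE_space
  proof (rule eventually_mono)
    fix a :: "'k^3^3" assume a: "a \<in> space haar"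
    \<comment> \<open>The position of coordinate \<open>i\<close> once coordinate \<open>j\<close>
      has been split off.\<close>
    define i' where "i' = (if i < j then i else i - 1)"
    have i': "i' < m" and ins: "\<And>x. insert_at m j a x i = x i'" "\<And>x. insert_at m j a x j = a"
      using ij m by (auto simp: i'_def insert_at_def)
    have "AE h in haar. pairing (covec h) (column 1 a) \<noteq> 0"
      using a by (intro AE_haar_covec column_nz) (simp add: SL3_det_nz)
    then have "AE x in pow_measure haar m. pairing (covec (x i')) (column 1 a) \<noteq> 0"
      by (rule haar.AE_pow_component[OF i'])
    then show "AE x in pow_measure haar m. ?P (insert_at m j a x)"
      using AE_space
    proof eventually_elim
      case (elim x)
      then have "x i' \<in> SL3" using i' by (auto simp: space_PiM)
      then show ?case
        using elim(1) a ij by (simp add: map_pow_def ins incid_std)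
    qed
  qed
  ultimately have "AE x in pow_measure haar n. ?P x"
    unfolding m(1) by (subst haar.AE_pow_insert_at_iff[OF m(2)])
  then show ?thesis
    by (simp only: AE_pow_flag_iff[OF p])
qed

subsection \<open>General position and the triple ratio\<close>

lemma proj_points_iff: "p \<in> proj_points \<longleftrightarrow> (\<exists>v. v \<noteq> 0 \<and> p = range (\<lambda>c. c *s (v :: 'k::rc_field^3)))"
proof
  assume "p \<in> proj_points"
  then have p: "vec.subspace p" "vec.dim p = 1" by (auto simp: proj_points_def)
  obtain B where B: "B \<subseteq> p" "vec.independent B" "p \<subseteq> vec.span B" "card B = vec.dim p"
    using vec.basis_exists[of p] by blast
  then obtain a where a: "B = {a}" using p by (auto simp: card_1_singleton_iff)
  have "p = vec.span {a}"
    using B p a by (simp add: vec.span_minimal subset_antisym)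
  moreover have "a \<noteq> 0" using B(2) a by auto
  ultimately show "\<exists>v. v \<noteq> 0 \<and> p = range (\<lambda>c. c *s v)" by (auto simp: vec.span_singleton)
next
  assume "\<exists>v. v \<noteq> 0 \<and> p = range (\<lambda>c. c *s v)"
  then obtain v where v: "v \<noteq> 0" "p = vec.span {v}" by (auto simp: vec.span_singleton)
  have i: "vec.independent {v}" using v(1) by simp
  have "vec.dim p = 1"
    using vec.dim_span_eq_card_independent[OF i] unfolding v(2) by simp
  then show "p \<in> proj_points" by (simp add: proj_points_def v(2))
qed

lemma proj_lines_iff: "l \<in> proj_lines \<longleftrightarrow> (\<exists>f. f \<noteq> 0 \<and> l = {x. pairing f (x :: 'k::rc_field^3) = 0})"
proof
  assume l: "l \<in> proj_lines"
  then have l2: "vec.subspace l" "vec.dim l = 2" by (auto simp: proj_lines_def)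
  then have "\<not> l \<subseteq> {0}" using vec.dim_eq_0[of l] by auto
  then obtain v where v: "v \<in> l" "v \<noteq> 0" by blast
  have "range (\<lambda>c. c *s v) \<subseteq> l" using v(1) l2(1) by (auto intro: vec.subspace_scale)
  \<comment> \<open>Any point on the line completes it to a flag, and the covector of a flag is
    already known to cut out its line.\<close>
  then have "(range (\<lambda>c. c *s v), l) \<in> flags"
    using l v(2) proj_points_iff by (auto simp: flags_def)
  from flag_eqs(2,4)[OF this] show "\<exists>f. f \<noteq> 0 \<and> l = {x. pairing f x = 0}" by auto
next
  assume "\<exists>f. f \<noteq> 0 \<and> l = {x. pairing f x = 0}"
  then obtain f where f: "f \<noteq> 0" "l = {x. pairing f x = 0}" by blast
  obtain b where b: "b \<in> SL3" "column 1 b = f" using vec_SL3_ex[OF f(1)] by blast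
  define k where "k = matrix_inv (transpose b)"
  have tb: "transpose b \<in> SL3" using b(1) by (simp add: SL3_def det_transpose)
  have k: "k \<in> SL3" by (simp add: k_def SL3_inv tb)
  \<comment> \<open>\<open>f\<close> is the first row of \<open>transpose b\<close>, so \<open>l\<close> is the image of \<open>{x. x $ 1 = 0}\<close> under its inverse\<close>
  have "pairing f (k *v x) = x $ 1" for x
  proof -
    have "pairing f (k *v x) = (transpose b *v (k *v x)) $ 1"
      by (simp add: pairing_3 matrix_vector_mult_def transpose_def sum_3 column_def flip: b(2))
    then show ?thesis by (simp add: k_def SL3_inv_vec[OF tb])
  qed
  then have fk: "pairing f (column 2 k) = 0" "pairing f (column 3 k) = 0"
    by (simp_all add: axis_def flip: mult_axis)
  \<comment> \<open>A cyclic shift of the columns keeps the determinant and puts the two columns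
    killed by \<open>f\<close> in front, where they span the line of a flag.\<close>
  define g where "g = colmat (column 2 k) (column 3 k) (column 1 k)"
  have "det g = det k"
    unfolding g_def det_colmat using pairing_crossk_rotate det_colmat colmat_columns[of k] by metis
  then have g: "g \<in> SL3" using k by (simp add: SL3_def)
  have "\<exists>c. f = c *s covec g"
  proof (rule covector_eq)
    fix x assume "pairing (covec g) x = 0"
    then have "x \<in> snd (flag_act g std_flag)" using g by (simp add: snd_flag_act_std SL3_det_nz)
    then obtain y where "x = g *v y" "y $ 3 = 0"
      by (auto simp: flag_act_def std_flag_def span_axis_12)
    moreover have "column 1 g = column 2 k" "column 2 g = column 3 k" by (simp_all add: g_def)
    ultimately have "x = y $ 1 *s column 2 k + y $ 2 *s column 3 k"
      using mult_vec_columns[of g y] by simp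
    then show "pairing f x = 0" by (simp add: pairing_add_right fk)
  qed (use covec_nz g SL3_det_nz in blast)
  then obtain c where c: "f = c *s covec g" by blast
  then have "c \<noteq> 0" using f(1) by auto
  then have "l = snd (flag_act g std_flag)"
    using c g by (simp add: f(2) snd_flag_act_std SL3_det_nz)
  moreover have "flag_act g std_flag \<in> flags" using g by (simp add: flag_act_std_in SL3_det_nz)
  ultimately show "l \<in> proj_lines" by (auto simp: flags_def)
qed

lemma common_zero_ex: "\<exists>f. f \<noteq> 0 \<and> pairing f a = 0 \<and> pairing f b = 0"
  for a b :: "'k::rc_field^3"
proof (cases "crossk a b = 0")
  case False
  then show ?thesis by (intro exI[of _ "crossk a b"]) simp
next
  case True
  show ?thesis
  proof (cases "a = 0 \<and> b = 0")
    case True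
    then show ?thesis by (intro exI[of _ "axis 1 1"]) (simp add: axis_eq_0_iff)
  next
    case False
    then obtain v where v: "v \<noteq> 0" "\<exists>c. a = c *s v" "\<exists>c. b = c *s v"
      using True crossk_eq_0[of a b] by (metis vec.scale_one vec.scale_zero_left)
    obtain g where g: "g \<in> SL3" "column 1 g = v" using vec_SL3_ex[OF v(1)] by blast
    have "pairing (covec g) v = 0" using pairing_covec_column(1)[of g] g(2) by simp
    moreover have "covec g \<noteq> 0" using g(1) by (intro covec_nz SL3_det_nz)
    ultimately show ?thesis using v(2,3) by (intro exI[of _ "covec g"]) auto
  qed
qed

lemma three_dependent_iff:
  fixes a b c :: "'k::rc_field^3"
  shows "(\<exists>f. f \<noteq> 0 \<and> pairing f a = 0 \<and> pairing f b = 0 \<and> pairing f c = 0) \<longleftrightarrow> pairing (crossk a b) c = 0"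
proof
  assume "\<exists>f. f \<noteq> 0 \<and> pairing f a = 0 \<and> pairing f b = 0 \<and> pairing f c = 0"
  then obtain f where f: "f \<noteq> 0" "pairing f a = 0" "pairing f b = 0" "pairing f c = 0" by blast
  show "pairing (crossk a b) c = 0"
  proof (rule ccontr)
    assume nz: "pairing (crossk a b) c \<noteq> 0"
    \<comment> \<open>Cramer's rule: the determinant times any vector is a combination of
      \<open>a\<close>, \<open>b\<close>, \<open>c\<close>, so a functional killing all three would
      be zero.\<close>
    have "x $ i * pairing (crossk a b) c = a $ i * pairing (crossk b c) x + b $ i * pairing (crossk c a) x
      + c $ i * pairing (crossk a b) x" for x i
      using exhaust_3[of i] by (auto simp: pairing_3 algebra_simps)
    then have e: "pairing (crossk a b) c *s x = pairing (crossk b c) x *s a + pairing (crossk c a) x *s b + pairing (crossk a b) x *s c" for x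
      by (simp add: vec_eq_iff mult.commute)
    have "pairing f (pairing (crossk a b) c *s x) = 0" for x
      unfolding e by (simp add: pairing_add_right f)
    then show False using nz pairing_ex[OF f(1)] by (auto simp only: pairing_scale_right mult_eq_0_iff)
  qed
next
  assume d: "pairing (crossk a b) c = 0"
  show "\<exists>f. f \<noteq> 0 \<and> pairing f a = 0 \<and> pairing f b = 0 \<and> pairing f c = 0"
  proof (cases "crossk a b = 0")
    case False
    then show ?thesis using d by (intro exI[of _ "crossk a b"]) simp
  next
    case True
    obtain f where f: "f \<noteq> 0" "pairing f a = 0" "pairing f c = 0" using common_zero_ex by blast
    show ?thesis
    proof (cases "a = 0")
      case True
      then show ?thesis using common_zero_ex[of b c] by auto
    next
      case False
      then obtain r where "b = r *s a" using crossk_eq_0 True by blast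
      then show ?thesis using f by auto
    qed
  qed
qed

lemma range_scale_subset:
  "range (\<lambda>c. c *s v) \<subseteq> {x. pairing f x = 0} \<longleftrightarrow> pairing f (v :: 'k::field^3) = 0"
proof
  assume "range (\<lambda>c. c *s v) \<subseteq> {x. pairing f x = 0}"
  then have "1 *s v \<in> {x. pairing f x = 0}" by blast
  then show "pairing f v = 0" by simp
qed auto

lemma aligned_iff:
  assumes "F0 \<in> flags" "F1 \<in> flags" "F2 \<in> flags"
  shows "(\<exists>l\<in>proj_lines. fst F0 \<subseteq> l \<and> fst F1 \<subseteq> l \<and> fst F2 \<subseteq> l) \<longleftrightarrow>
    pairing (crossk (fpoint F0) (fpoint F1)) (fpoint F2) = 0"
proof -
  have "(\<exists>l\<in>proj_lines. fst F0 \<subseteq> l \<and> fst F1 \<subseteq> l \<and> fst F2 \<subseteq> l) \<longleftrightarrow>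
    (\<exists>f. f \<noteq> 0 \<and> pairing f (fpoint F0) = 0 \<and> pairing f (fpoint F1) = 0 \<and> pairing f (fpoint F2) = 0)"
  proof -
    have ex: "(\<exists>l. (\<exists>f. f \<noteq> 0 \<and> l = {x. pairing f x = 0}) \<and> Q l) \<longleftrightarrow> (\<exists>f. f \<noteq> 0 \<and> Q {x. pairing f (x :: 'a^3) = 0})" for Q
      by blast
    show ?thesis
      unfolding Bex_def proj_lines_iff ex flag_eqs(3)[OF assms(1)] flag_eqs(3)[OF assms(2)] flag_eqs(3)[OF assms(3)]
        range_scale_subset ..
  qed
  then show ?thesis by (simp only: three_dependent_iff)
qed

lemma concurrent_iff:
  assumes "F0 \<in> flags" "F1 \<in> flags" "F2 \<in> flags"
  shows "(\<exists>p\<in>proj_points. p \<subseteq> snd F0 \<and> p \<subseteq> snd F1 \<and> p \<subseteq> snd F2) \<longleftrightarrow>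
    pairing (crossk (fcov F0) (fcov F1)) (fcov F2) = 0"
proof -
  have "(\<exists>p\<in>proj_points. p \<subseteq> snd F0 \<and> p \<subseteq> snd F1 \<and> p \<subseteq> snd F2) \<longleftrightarrow>
    (\<exists>v. v \<noteq> 0 \<and> pairing v (fcov F0) = 0 \<and> pairing v (fcov F1) = 0 \<and> pairing v (fcov F2) = 0)"
  proof -
    have ex: "(\<exists>p. (\<exists>v. v \<noteq> 0 \<and> p = range (\<lambda>c. c *s v)) \<and> Q p) \<longleftrightarrow> (\<exists>v. v \<noteq> 0 \<and> Q (range (\<lambda>c. c *s (v :: 'a^3))))" for Q
      by blast
    show ?thesis
      unfolding Bex_def proj_points_iff ex flag_eqs(4)[OF assms(1)] flag_eqs(4)[OF assms(2)] flag_eqs(4)[OF assms(3)]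
        range_scale_subset by (simp add: pairing_commute[of "fcov _"])
  qed
  then show ?thesis by (simp only: three_dependent_iff)
qed

lemma incident_iff:
  assumes "F0 \<in> flags" "F1 \<in> flags"
  shows "fst F0 \<subseteq> snd F1 \<longleftrightarrow> incid F1 F0 = 0"
  unfolding flag_eqs(3)[OF assms(1)] flag_eqs(4)[OF assms(2)] range_scale_subset by (simp add: incid_def)

text \<open>General position in coordinates, where it is visibly measurable. One determinant for the
  points and one for the lines cover all orders of the indices.\<close>

definition generic3 :: "(nat \<Rightarrow> 'k::rc_field flag) \<Rightarrow> bool" where
  "generic3 F \<longleftrightarrow> pairing (crossk (fpoint (F 0)) (fpoint (F 1))) (fpoint (F 2)) \<noteq> 0 \<and>
     pairing (crossk (fcov (F 0)) (fcov (F 1))) (fcov (F 2)) \<noteq> 0 \<and>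
     incid (F 0) (F 1) \<noteq> 0 \<and> incid (F 1) (F 0) \<noteq> 0 \<and> incid (F 0) (F 2) \<noteq> 0 \<and>
     incid (F 2) (F 0) \<noteq> 0 \<and> incid (F 1) (F 2) \<noteq> 0 \<and> incid (F 2) (F 1) \<noteq> 0"

lemma all_less_3: "(\<forall>i<3. P i) \<longleftrightarrow> P 0 \<and> P 1 \<and> P (2::nat)"
  by (auto simp: numeral_3_eq_3 numeral_2_eq_2 less_Suc_eq)

lemma general_position_iff:
  assumes F: "F 0 \<in> flags" "F 1 \<in> flags" "F 2 \<in> flags"
  shows "general_position 3 F \<longleftrightarrow> generic3 F"
proof -
  let ?A = "\<lambda>i j k. \<exists>l\<in>proj_lines. fst (F i) \<subseteq> l \<and> fst (F j) \<subseteq> l \<and> fst (F k) \<subseteq> l"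
  let ?C = "\<lambda>i j k. \<exists>p\<in>proj_points. p \<subseteq> snd (F i) \<and> p \<subseteq> snd (F j) \<and> p \<subseteq> snd (F k)"
  have "general_position 3 F \<longleftrightarrow> (\<not> ?A 0 1 2 \<and> \<not> ?C 0 1 2) \<and>
     \<not> fst (F 0) \<subseteq> snd (F 1) \<and> \<not> fst (F 0) \<subseteq> snd (F 2) \<and> \<not> fst (F 1) \<subseteq> snd (F 0) \<and>
     \<not> fst (F 1) \<subseteq> snd (F 2) \<and> \<not> fst (F 2) \<subseteq> snd (F 0) \<and> \<not> fst (F 2) \<subseteq> snd (F 1)"
    unfolding general_position_def all_less_3
    by (simp only: zero_neq_one one_neq_zero refl simp_thms zero_neq_numeral numeral_neq_zero
        one_eq_numeral_iff numeral_eq_one_iff semiring_norm) blast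
  then show ?thesis
    unfolding aligned_iff[OF F] concurrent_iff[OF F] generic3_def
      incident_iff[OF F(1) F(2)] incident_iff[OF F(1) F(3)] incident_iff[OF F(2) F(1)]
      incident_iff[OF F(2) F(3)] incident_iff[OF F(3) F(1)] incident_iff[OF F(3) F(2)] by blast
qed

section \<open>The cross ratio and the triple ratio in coordinates\<close>

lemma span_2: "vec.span {u, v :: 'k::rc_field^3} = {a *s u + b *s v | a b. True}"
  by (auto simp: vec.span_insert vec.span_singleton diff_eq_eq) (metis add.commute diff_add_cancel)+

text \<open>Solving f(x u + v) = 0 for the affine coordinate x; f(u) being nonzero means that the
  zero of \<open>f\<close> is not the point at infinity.\<close>

lemma kernel_in_span:
  fixes u v :: "'k::rc_field^3"
  assumes "l = vec.span {u, v}" "pairing f u \<noteq> 0"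
  shows "l \<inter> {x. pairing f x = 0} = range (\<lambda>c. c *s ((- pairing f v / pairing f u) *s u + v))"
proof (intro equalityI subsetI)
  fix x assume "x \<in> l \<inter> {x. pairing f x = 0}"
  then obtain a b where x: "x = a *s u + b *s v" "a * pairing f u + b * pairing f v = 0"
    by (auto simp: assms(1) span_2 pairing_add_right)
  then have "a = b * (- pairing f v / pairing f u)"
    using assms(2) by (simp add: field_simps eq_neg_iff_add_eq_0)
  then have "x = b *s ((- pairing f v / pairing f u) *s u + v)"
    by (simp add: x(1) vec.scale_right_distrib)
  then show "x \<in> range (\<lambda>c. c *s ((- pairing f v / pairing f u) *s u + v))" by blast
next
  fix x assume "x \<in> range (\<lambda>c. c *s ((- pairing f v / pairing f u) *s u + v))"
  then obtain c where c: "x = c *s ((- pairing f v / pairing f u) *s u + v)" by blast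
  then have "x = (c * (- pairing f v / pairing f u)) *s u + c *s v"
    by (simp add: vec.scale_right_distrib)
  then have "x \<in> l" unfolding assms(1) span_2 by blast
  moreover have "pairing f x = 0" using assms(2) by (simp add: c pairing_add_right pairing_diff_right)
  ultimately show "x \<in> l \<inter> {x. pairing f x = 0}" by simp
qed



lemma range_scale_scale: "r \<noteq> 0 \<Longrightarrow> range (\<lambda>c. c *s (r *s v)) = range (\<lambda>c. c *s (v :: 'k::field^3))"
proof (intro equalityI subsetI)
  fix x assume "r \<noteq> 0" "x \<in> range (\<lambda>c. c *s v)"
  then obtain c where "x = c *s v" by blast
  then have "x = (c / r) *s (r *s v)" using \<open>r \<noteq> 0\<close> by simp
  then show "x \<in> range (\<lambda>c. c *s (r *s v))" by blast
qed auto

text \<open>In an affine coordinate with point \<open>u\<close> at infinity a functional \<open>f\<close> on the line is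
  \<open>x \<mapsto> f(u) (x - x\<^sub>0)\<close>, where \<open>x\<^sub>0\<close> is the coordinate of its zero. So the cross ratio is a ratio of
  values of two functionals.\<close>

lemma cross_ratio_functionals:
  fixes f0 f2 :: "'k::rc_field^3"
  assumes l: "l \<in> proj_lines" and w: "w \<in> l" and z: "z \<in> l"
    and nz: "pairing f0 w \<noteq> 0" "pairing f2 w \<noteq> 0" "pairing f0 z \<noteq> 0" "pairing f2 z \<noteq> 0"
    and wz: "crossk w z \<noteq> 0"
  shows "cross_ratio l (l \<inter> {x. pairing f0 x = 0}) (l \<inter> {x. pairing f2 x = 0})
      (range (\<lambda>c. c *s w)) (range (\<lambda>c. c *s z))
    = (pairing f0 w * pairing f2 z) / (pairing f2 w * pairing f0 z)"
  unfolding cross_ratio_def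
proof (rule the_equality)
  \<comment> \<open>The point \<open>u = w + t *s z\<close> is to lie at infinity. The excluded
    values are those at which it would be \<open>w\<close>, the zero of \<open>f0\<close> or the
    zero of \<open>f2\<close>; it is never a multiple of \<open>z\<close>.\<close>
  define t :: 'k where "t = (SOME t. t \<notin> {0, - pairing f0 w / pairing f0 z, - pairing f2 w / pairing f2 z})"
  have "finite {0, - pairing f0 w / pairing f0 z, - pairing f2 w / pairing f2 z}" by simp
  moreover have "infinite (UNIV :: 'k set)"
    by (rule infinite_UNIV_char_0)
  ultimately have "\<exists>t. t \<notin> {0, - pairing f0 w / pairing f0 z, - pairing f2 w / pairing f2 z}"
    by (rule ex_new_if_finite[rotated])
  then have t: "t \<notin> {0, - pairing f0 w / pairing f0 z, - pairing f2 w / pairing f2 z}"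
    unfolding t_def by (rule someI_ex)
  define u where "u = w + t *s z"
  have u0: "pairing f0 u \<noteq> 0" "pairing f2 u \<noteq> 0"
    using t nz by (auto simp: u_def pairing_add_right field_simps add_eq_0_iff)
  obtain f where f: "f \<noteq> 0" "l = {x. pairing f x = 0}" using l proj_lines_iff by blast
  have lspan: "l = vec.span {u, z}"
  proof (intro equalityI subsetI)
    fix x assume x: "x \<in> l"
    have "pairing (crossk w z) x = 0"
      using f w z x three_dependent_iff[of w z x] by auto

    obtain i where i: "crossk w z $ i \<noteq> 0" using wz by (auto simp: vec_eq_iff)
    define a b where "a = crossk x z $ i / crossk w z $ i" and "b = crossk w x $ i / crossk w z $ i"
    have d: "x $ 1 * crossk w z $ 1 + x $ 2 * crossk w z $ 2 + x $ 3 * crossk w z $ 3 = 0"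
      using \<open>pairing (crossk w z) x = 0\<close> by (simp add: pairing_3 mult.commute)
    \<comment> \<open>Cramer's rule in the plane of \<open>w\<close> and \<open>z\<close>, with a
      correction term equal to the determinant of \<open>w\<close>, \<open>z\<close>,
      \<open>x\<close>, which vanishes because \<open>x\<close> lies on the line.\<close>
    have "crossk w z $ k * x $ j = crossk x z $ k * w $ j + crossk w x $ k * z $ j
        + (if k = j then x $ 1 * crossk w z $ 1 + x $ 2 * crossk w z $ 2 + x $ 3 * crossk w z $ 3 else 0)" for j k
      using exhaust_3[of k] exhaust_3[of j] by (elim disjE) (simp_all add: algebra_simps)
    then have "crossk w z $ i * x $ j = crossk x z $ i * w $ j + crossk w x $ i * z $ j" for j
      unfolding d by simp
    then have "x = a *s w + b *s z"
      using i by (simp add: a_def b_def vec_eq_iff field_simps)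
    then have "x = a *s u + (b - a * t) *s z"
      by (simp add: u_def vec_eq_iff algebra_simps)
    then show "x \<in> vec.span {u, z}" unfolding span_2 by blast
  next
    fix x assume "x \<in> vec.span {u, z}"
    then show "x \<in> l" using w z by (auto simp: span_2 u_def f(2) pairing_add_right)
  qed
  have "range (\<lambda>c. c *s w) = range (\<lambda>c. c *s ((- 1 / t) *s u + z))"
  proof -
    \<comment> \<open>Dividing \<open>u = w + t *s z\<close> by \<open>- t\<close> shows that
      \<open>w\<close> has coordinate -1/t, while \<open>z\<close> has coordinate 0.\<close>
    have "(- 1 / t) *s u + z = (- 1 / t) *s w"
      using t by (simp add: u_def vec_eq_iff field_simps)
    then show ?thesis using range_scale_scale[of "- 1 / t" w] t by (simp only:) simp
  qed
  moreover have "range (\<lambda>c. c *s z) = range (\<lambda>c. c *s (0 *s u + z))" by simp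
  moreover note kernel_in_span[OF lspan u0(1)] kernel_in_span[OF lspan u0(2)]
  moreover have "(pairing f0 w * pairing f2 z) / (pairing f2 w * pairing f0 z)
     = ((- 1 / t - (- pairing f0 z / pairing f0 u)) * (0 - (- pairing f2 z / pairing f2 u))) /
       ((- 1 / t - (- pairing f2 z / pairing f2 u)) * (0 - (- pairing f0 z / pairing f0 u)))"
  proof -
    have e: "- 1 / t - (- pairing f z / pairing f u) = - pairing f w / (t * pairing f u)" if "pairing f u \<noteq> 0" for f
      using t that by (simp add: u_def pairing_add_right divide_simps)
    have "t \<noteq> 0" using t by simp
    then show ?thesis unfolding e[OF u0(1)] e[OF u0(2)] using u0 nz by (simp add: divide_simps)
  qed
  ultimately show "\<exists>u v x0 x1 x2 x3. l \<in> proj_lines \<and> vec.span {u, v} = l \<and>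
      l \<inter> {x. pairing f0 x = 0} = vec.span {x0 *s u + v} \<and> l \<inter> {x. pairing f2 x = 0} = vec.span {x1 *s u + v} \<and>
      range (\<lambda>c. c *s w) = vec.span {x2 *s u + v} \<and> range (\<lambda>c. c *s z) = vec.span {x3 *s u + v} \<and>
      pairing f0 w * pairing f2 z / (pairing f2 w * pairing f0 z) = (x2 - x0) * (x3 - x1) / ((x2 - x1) * (x3 - x0))"
    using l lspan unfolding vec.span_singleton by blast
next
  fix c
  assume "\<exists>u v x0 x1 x2 x3. l \<in> proj_lines \<and> vec.span {u, v} = l \<and>
      l \<inter> {x. pairing f0 x = 0} = vec.span {x0 *s u + v} \<and> l \<inter> {x. pairing f2 x = 0} = vec.span {x1 *s u + v} \<and>
      range (\<lambda>c. c *s w) = vec.span {x2 *s u + v} \<and> range (\<lambda>c. c *s z) = vec.span {x3 *s u + v} \<and>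
      c = (x2 - x0) * (x3 - x1) / ((x2 - x1) * (x3 - x0))"
  then obtain u v x0 x1 x2 x3 where uv: "vec.span {u, v} = l"
    and X0: "l \<inter> {x. pairing f0 x = 0} = vec.span {x0 *s u + v}" and X1: "l \<inter> {x. pairing f2 x = 0} = vec.span {x1 *s u + v}"
    and X2: "range (\<lambda>c. c *s w) = vec.span {x2 *s u + v}" and X3: "range (\<lambda>c. c *s z) = vec.span {x3 *s u + v}"
    and c: "c = (x2 - x0) * (x3 - x1) / ((x2 - x1) * (x3 - x0))" by blast
  have "x0 *s u + v \<in> l \<inter> {x. pairing f0 x = 0}" "x1 *s u + v \<in> l \<inter> {x. pairing f2 x = 0}"
    unfolding X0 X1 by (auto intro: vec.span_base)
  then have v0: "pairing f0 v = - x0 * pairing f0 u" "pairing f2 v = - x1 * pairing f2 u"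
    by (simp_all add: pairing_add_right eq_neg_iff_add_eq_0 add.commute)
  obtain a b where w2: "w = a *s u + b *s v" using w uv span_2 by blast
  \<comment> \<open>A functional vanishing at \<open>u\<close> would by \<open>v0\<close> vanish at
    \<open>v\<close>, hence on the whole line, contrary to its value at \<open>w\<close>.\<close>
  have u0: "pairing f0 u \<noteq> 0" "pairing f2 u \<noteq> 0"
    using nz(1,2) v0 by (auto simp: w2 pairing_add_right)
  have aff: "pairing f0 (x *s u + v) = pairing f0 u * (x - x0)" "pairing f2 (x *s u + v) = pairing f2 u * (x - x1)" for x
    by (simp_all add: pairing_add_right v0 algebra_simps)
  \<comment> \<open>The scalars \<open>r\<close> and \<open>s\<close> relating \<open>w\<close> and
    \<open>z\<close> to their affine representatives cancel in the quotient, as do the values of the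
    functionals at \<open>u\<close>.\<close>
  have "w \<in> vec.span {x2 *s u + v}" "z \<in> vec.span {x3 *s u + v}"
    unfolding X2[symmetric] X3[symmetric] by (metis rangeI vec.scale_one)+
  then obtain r s where r: "w = r *s (x2 *s u + v)" and s: "z = s *s (x3 *s u + v)"
    by (auto simp: vec.span_singleton)
  have p: "pairing f0 w = r * (pairing f0 u * (x2 - x0))" "pairing f2 w = r * (pairing f2 u * (x2 - x1))"
    "pairing f0 z = s * (pairing f0 u * (x3 - x0))" "pairing f2 z = s * (pairing f2 u * (x3 - x1))"
    by (simp_all only: r s pairing_scale_right aff)
  then have "r \<noteq> 0" "s \<noteq> 0" using nz by auto
  then show "c = pairing f0 w * pairing f2 z / (pairing f2 w * pairing f0 z)"
    using u0 by (simp add: c p)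
qed

lemma triple_ratio_eq:
  assumes F: "F 0 \<in> flags" "F 1 \<in> flags" "F 2 \<in> flags" and g: "generic3 F"
  shows "triple_ratio (F 0) (F 1) (F 2) =
    (pairing (fcov (F 0)) (fpoint (F 1)) * pairing (fcov (F 1)) (fpoint (F 2)) * pairing (fcov (F 2)) (fpoint (F 0))) /
    (pairing (fcov (F 0)) (fpoint (F 2)) * pairing (fcov (F 1)) (fpoint (F 0)) * pairing (fcov (F 2)) (fpoint (F 1)))"
proof -
  let ?f0 = "fcov (F 0)" and ?f1 = "fcov (F 1)" and ?f2 = "fcov (F 2)"
  let ?v0 = "fpoint (F 0)" and ?v1 = "fpoint (F 1)" and ?v2 = "fpoint (F 2)"
  have nz: "pairing ?f0 ?v1 \<noteq> 0" "pairing ?f1 ?v0 \<noteq> 0" "pairing ?f0 ?v2 \<noteq> 0" "pairing ?f2 ?v0 \<noteq> 0"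
    "pairing ?f1 ?v2 \<noteq> 0" "pairing ?f2 ?v1 \<noteq> 0"
    and d: "pairing (crossk ?v0 ?v1) ?v2 \<noteq> 0"
    using g by (auto simp: generic3_def incid_def)
  have self: "pairing ?f0 ?v0 = 0" "pairing ?f1 ?v1 = 0" "pairing ?f2 ?v2 = 0"
    by (rule flag_eqs(5)[OF F(1)], rule flag_eqs(5)[OF F(2)], rule flag_eqs(5)[OF F(3)])
  \<comment> \<open>The combination of \<open>?v0\<close> and \<open>?v2\<close> killed by
    \<open>?f1\<close>: it represents the intersection of the line of the middle flag with the line
    through the two other points.\<close>
  define z where "z = pairing ?f1 ?v2 *s ?v0 - pairing ?f1 ?v0 *s ?v2"
  have z: "pairing ?f0 z = - (pairing ?f1 ?v0 * pairing ?f0 ?v2)" "pairing ?f1 z = 0" "pairing ?f2 z = pairing ?f1 ?v2 * pairing ?f2 ?v0"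
    by (simp_all add: z_def pairing_diff_right self)
  have l1: "snd (F 1) \<in> proj_lines" using F(2) by (auto simp: flags_def)
  have X3: "snd (F 1) \<inter> vec.span (fst (F 0) \<union> fst (F 2)) = range (\<lambda>c. c *s z)"
  proof -
    have "vec.span (fst (F 0) \<union> fst (F 2)) = vec.span {?v0, ?v2}"
    proof (rule subset_antisym)
      show "vec.span (fst (F 0) \<union> fst (F 2)) \<subseteq> vec.span {?v0, ?v2}"
        using flag_eqs(3)[OF F(1)] flag_eqs(3)[OF F(3)]
        by (intro vec.span_minimal) (auto intro!: vec.span_scale intro: vec.span_base)
      have "?v0 \<in> fst (F 0)" "?v2 \<in> fst (F 2)"
        unfolding flag_eqs(3)[OF F(1)] flag_eqs(3)[OF F(3)] by (metis rangeI vec.scale_one)+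
      then show "vec.span {?v0, ?v2} \<subseteq> vec.span (fst (F 0) \<union> fst (F 2))"
        by (intro vec.span_mono) auto
    qed
    then have "snd (F 1) \<inter> vec.span (fst (F 0) \<union> fst (F 2))
       = range (\<lambda>c. c *s ((- pairing ?f1 ?v2 / pairing ?f1 ?v0) *s ?v0 + ?v2))"
      using kernel_in_span[of _ ?v0 ?v2 ?f1, OF refl nz(2)] flag_eqs(4)[OF F(2)] by (simp add: Int_commute)
    also have "(- pairing ?f1 ?v2 / pairing ?f1 ?v0) *s ?v0 + ?v2 = (- 1 / pairing ?f1 ?v0) *s z"
      using nz(2) by (simp add: z_def vec_eq_iff field_simps)
    finally show ?thesis using range_scale_scale[of "- 1 / pairing ?f1 ?v0" z] nz(2) by (simp only:) simp
  qed
  have "cross_ratio (snd (F 1)) (snd (F 1) \<inter> {x. pairing ?f0 x = 0}) (snd (F 1) \<inter> {x. pairing ?f2 x = 0})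
      (range (\<lambda>c. c *s ?v1)) (range (\<lambda>c. c *s z))
    = (pairing ?f0 ?v1 * pairing ?f2 z) / (pairing ?f2 ?v1 * pairing ?f0 z)"
  proof (rule cross_ratio_functionals[OF l1])
    show "crossk ?v1 z \<noteq> 0"
    proof
      assume "crossk ?v1 z = 0"
      then have "pairing (crossk ?v1 z) ?v2 = 0" by simp
      moreover have "pairing (crossk ?v1 z) ?v2 = - (pairing ?f1 ?v2 * pairing (crossk ?v0 ?v1) ?v2)"
        by (simp add: z_def pairing_3 algebra_simps)
      ultimately show False using nz d by simp
    qed
  qed (use nz z self in \<open>simp_all add: flag_eqs(4)[OF F(2)] del: One_nat_def\<close>)
  then have "triple_ratio (F 0) (F 1) (F 2) = - ((pairing ?f0 ?v1 * pairing ?f2 z) / (pairing ?f2 ?v1 * pairing ?f0 z))"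
    unfolding triple_ratio_def X3
    by (simp only: flag_eqs(3)[OF F(2)] flag_eqs(4)[OF F(1)] flag_eqs(4)[OF F(3)] Int_commute[of "{x. pairing ?f0 x = 0}"])
  \<comment> \<open>The minus sign of \<open>pairing ?f0 z\<close> cancels the one in the definition
    of the triple ratio.\<close>
  then show ?thesis
    unfolding z using nz by (simp add: field_simps)
qed

lemma ln_triple_ratio:
  assumes F: "F 0 \<in> flags" "F 1 \<in> flags" "F 2 \<in> flags" and g: "generic3 F"
  shows "ln (norm (triple_ratio (F 0) (F 1) (F 2))) = bracket (F 0) (F 1) + bracket (F 1) (F 2) + bracket (F 2) (F 0)"
    and "triple_ratio (F 0) (F 1) (F 2) \<noteq> 0"
proof -
  have pos: "incid (F 0) (F 1) > 0" "incid (F 1) (F 0) > 0" "incid (F 0) (F 2) > 0" "incid (F 2) (F 0) > 0"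
    "incid (F 1) (F 2) > 0" "incid (F 2) (F 1) > 0"
    using g by (auto simp: generic3_def incid_def)
  have n: "norm (triple_ratio (F 0) (F 1) (F 2)) =
    (incid (F 0) (F 1) * incid (F 1) (F 2) * incid (F 2) (F 0)) / (incid (F 0) (F 2) * incid (F 1) (F 0) * incid (F 2) (F 1))"
    unfolding triple_ratio_eq[OF assms] by (simp add: incid_def norm_mult norm_divide)
  then show "ln (norm (triple_ratio (F 0) (F 1) (F 2))) = bracket (F 0) (F 1) + bracket (F 1) (F 2) + bracket (F 2) (F 0)"
    using pos by (simp add: bracket_def ln_mult ln_div)
  show "triple_ratio (F 0) (F 1) (F 2) \<noteq> 0"
    using n pos by auto
qed

lemma s_cochain_eq:
  assumes F: "F 0 \<in> flags" "F 1 \<in> flags" "F 2 \<in> flags"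
  shows "s_cochain \<phi> F = (if generic3 F
    then form_coeff \<phi> * (bracket (F 0) (F 1) + bracket (F 1) (F 2) + bracket (F 2) (F 0)) else 0)"
  using ln_triple_ratio(1)[OF F] by (simp add: s_cochain_def general_position_iff[OF F] form_at_def)

lemma general_position_permute:
  assumes "\<sigma> permutes {..<n}"
  shows "general_position n (\<lambda>i\<in>{..<n}. F (\<sigma> i)) \<longleftrightarrow> general_position n F"
proof -
  have imp: "general_position n (\<lambda>i\<in>{..<n}. F (\<sigma> i))" if "general_position n F" "\<sigma> permutes {..<n}" for \<sigma> F
  proof -
    have lt: "\<sigma> i < n" if "i < n" for i
      using permutes_in_image[OF \<open>\<sigma> permutes {..<n}\<close>, of i] that by simp
    have ne: "\<sigma> i \<noteq> \<sigma> j" if "i \<noteq> j" for i j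
      using permutes_inj[OF \<open>\<sigma> permutes {..<n}\<close>] that by (auto dest: injD)
    have q: "\<not> (\<exists>l\<in>proj_lines. fst (F i) \<subseteq> l \<and> fst (F j) \<subseteq> l \<and> fst (F k) \<subseteq> l)"
        "\<not> (\<exists>p\<in>proj_points. p \<subseteq> snd (F i) \<and> p \<subseteq> snd (F j) \<and> p \<subseteq> snd (F k))"
      if "i < n" "j < n" "k < n" "i \<noteq> j \<and> j \<noteq> k \<and> i \<noteq> k" for i j k
      using \<open>general_position n F\<close> that unfolding general_position_def by blast+
    have r: "\<not> fst (F i) \<subseteq> snd (F j)" if "i < n" "j < n" "i \<noteq> j" for i j
      using \<open>general_position n F\<close> that unfolding general_position_def by blast
    show ?thesis
      unfolding general_position_def
    proof (intro conjI allI impI)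
      fix i j k assume ijk: "i < n" "j < n" "k < n" "i \<noteq> j \<and> j \<noteq> k \<and> i \<noteq> k"
      then have "\<sigma> i \<noteq> \<sigma> j \<and> \<sigma> j \<noteq> \<sigma> k \<and> \<sigma> i \<noteq> \<sigma> k" using ne by blast
      note * = q[OF lt lt lt this, OF ijk(1-3)]
      show "\<not> (\<exists>l\<in>proj_lines. fst ((\<lambda>i\<in>{..<n}. F (\<sigma> i)) i) \<subseteq> l \<and> fst ((\<lambda>i\<in>{..<n}. F (\<sigma> i)) j) \<subseteq> l
          \<and> fst ((\<lambda>i\<in>{..<n}. F (\<sigma> i)) k) \<subseteq> l)"
        using *(1) ijk by simp
      show "\<not> (\<exists>p\<in>proj_points. p \<subseteq> snd ((\<lambda>i\<in>{..<n}. F (\<sigma> i)) i) \<and> p \<subseteq> snd ((\<lambda>i\<in>{..<n}. F (\<sigma> i)) j)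
          \<and> p \<subseteq> snd ((\<lambda>i\<in>{..<n}. F (\<sigma> i)) k))"
        using *(2) ijk by simp
    next
      fix i j assume "i < n" "j < n" "i \<noteq> j"
      then show "\<not> fst ((\<lambda>i\<in>{..<n}. F (\<sigma> i)) i) \<subseteq> snd ((\<lambda>i\<in>{..<n}. F (\<sigma> i)) j)"
        using r[OF lt lt ne] by simp
    qed
  qed
  show ?thesis
  proof
    assume "general_position n (\<lambda>i\<in>{..<n}. F (\<sigma> i))"
    from imp[OF this permutes_inv[OF assms]]
    have "general_position n (\<lambda>i\<in>{..<n}. (\<lambda>i\<in>{..<n}. F (\<sigma> i)) (inv \<sigma> i))" .
    moreover have "(\<lambda>i\<in>{..<n}. (\<lambda>i\<in>{..<n}. F (\<sigma> i)) (inv \<sigma> i)) = (\<lambda>i\<in>{..<n}. F i)"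
      using permutes_in_image[OF permutes_inv[OF assms]] permutes_inverses(1)[OF assms]
      by (auto simp: fun_eq_iff restrict_def)
    moreover have "general_position n (\<lambda>i\<in>{..<n}. F i) \<longleftrightarrow> general_position n F"
      unfolding general_position_def by simp
    ultimately show "general_position n F" by simp
  qed (rule imp[OF _ assms])
qed

lemma bracket_swap: "bracket F F' = - bracket F' F"
  by (simp add: bracket_def)

text \<open>Signs multiply, so transpositions suffice. A transposition reverses the cyclic order and
  so negates the cyclic sum of antisymmetric brackets. General position is symmetric in the flags,
  so the default value 0 outside it is consistent.\<close>

lemma alternating_s_cochain: "alternating 3 flags (s_cochain \<phi>)"
proof -
  let ?R = "\<lambda>\<sigma>. \<forall>F. F 0 \<in> flags \<longrightarrow> F 1 \<in> flags \<longrightarrow> F 2 \<in> flags \<longrightarrow>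
      s_cochain \<phi> (\<lambda>i\<in>{..<3}. F (\<sigma> i)) = of_int (sign \<sigma>) * s_cochain \<phi> F"
  have s_restrict: "s_cochain \<phi> (\<lambda>i\<in>{..<3}. F i) = s_cochain \<phi> F" for F
    using general_position_permute[OF permutes_id, of 3 F] by (simp add: s_cochain_def)
  have transp: "s_cochain \<phi> (\<lambda>i\<in>{..<3}. F (Transposition.transpose a b i)) = - s_cochain \<phi> F"
    if ab: "a < 3" "b < 3" "a \<noteq> b" and F: "F 0 \<in> flags" "F 1 \<in> flags" "F 2 \<in> flags" for a b F
  proof -
    let ?G = "\<lambda>i\<in>{..<3}. F (Transposition.transpose a b i)"
    have p: "Transposition.transpose a b permutes {..<3}" using ab by (intro permutes_swap_id) auto
    have fl: "F i \<in> flags" if "i < 3" for i using F that all_less_3[of "\<lambda>i. F i \<in> flags"] by blast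
    have G: "?G 0 \<in> flags" "?G 1 \<in> flags" "?G 2 \<in> flags"
      using fl permutes_in_image[OF p] by auto
    have ga: "generic3 ?G \<longleftrightarrow> generic3 F"
      using general_position_permute[OF p, of F] by (simp only: general_position_iff[of F, OF F] general_position_iff[of ?G, OF G])
    have br: "bracket (?G 0) (?G 1) + bracket (?G 1) (?G 2) + bracket (?G 2) (?G 0) =
       - (bracket (F 0) (F 1) + bracket (F 1) (F 2) + bracket (F 2) (F 0))"
    proof -
      have "a = 0 \<or> a = 1 \<or> a = 2" "b = 0 \<or> b = 1 \<or> b = 2" using ab by auto
      then show ?thesis
        using ab(3) bracket_swap[of "F 0" "F 1"] bracket_swap[of "F 1" "F 2"] bracket_swap[of "F 2" "F 0"]
        by (elim disjE) (simp_all add: Transposition.transpose_def)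
    qed
    show ?thesis
      unfolding s_cochain_eq[of F, OF F] s_cochain_eq[of ?G, OF G] ga br by (simp only: mult_minus_right minus_zero split: if_split) simp
  qed
  have "?R \<sigma>" if "\<sigma> permutes {..<3}" for \<sigma>
    using that finite_lessThan
  proof (induction \<sigma> rule: permutes_induct)
    case id
    have "sign (\<lambda>a::nat. a) = 1" using sign_id by (simp only: id_def)
    then show ?case by (simp only: id_def s_restrict of_int_1 mult_1 simp_thms)
  next
    case (swap a b p)
    show ?case
    proof (cases "a = b")
      case False
      show ?thesis
      proof (intro allI impI)
        fix F :: "nat \<Rightarrow> 'a flag" assume F: "F 0 \<in> flags" "F 1 \<in> flags" "F 2 \<in> flags"
        let ?F' = "\<lambda>i\<in>{..<3}. F (Transposition.transpose a b i)"
        have ab: "a < 3" "b < 3" using swap by auto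
        have fl: "F i \<in> flags" if "i < 3" for i using F that all_less_3[of "\<lambda>i. F i \<in> flags"] by blast
        have pa: "Transposition.transpose a b permutes {..<3}" using ab by (intro permutes_swap_id) auto
        have F': "?F' 0 \<in> flags" "?F' 1 \<in> flags" "?F' 2 \<in> flags"
          using fl permutes_in_image[OF pa] by auto
        have "(\<lambda>i\<in>{..<3}. F ((Transposition.transpose a b \<circ> p) i)) = (\<lambda>i\<in>{..<3}. ?F' (p i))"
          using permutes_in_image[OF \<open>p permutes {..<3}\<close>] by (auto simp: fun_eq_iff restrict_def)
        then have "s_cochain \<phi> (\<lambda>i\<in>{..<3}. F ((Transposition.transpose a b \<circ> p) i)) = of_int (sign p) * s_cochain \<phi> ?F'"
          using swap.IH F' by (simp only: simp_thms)
        also have "s_cochain \<phi> ?F' = - s_cochain \<phi> F"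
          by (rule transp[OF ab False F])
        also have "of_int (sign p) * - s_cochain \<phi> F = of_int (sign (Transposition.transpose a b \<circ> p)) * s_cochain \<phi> F"
          using False permutes_imp_permutation[OF finite_lessThan \<open>p permutes {..<3}\<close>]
          by (simp add: sign_compose permutation_swap_id sign_swap_id)
        finally show "s_cochain \<phi> (\<lambda>i\<in>{..<3}. F ((Transposition.transpose a b \<circ> p) i))
            = of_int (sign (Transposition.transpose a b \<circ> p)) * s_cochain \<phi> F" .
      qed
    qed (use swap in simp)
  qed
  then show ?thesis
    unfolding alternating_def by (auto simp: PiE_iff)
qed

subsection \<open>Genericity\<close>

lemma AE_flag_fpoint:
  fixes f :: "'k::rc_field^3"
  assumes "f \<noteq> 0"
  shows "AE F in flag_measure. pairing f (fpoint F) \<noteq> 0"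
proof -
  have m: "Measurable.pred flag_measure (\<lambda>F. pairing f (fpoint F) \<noteq> 0)"
    by (intro pred_neq_0 borel_measurable_pairing fpoint_measurable) simp
  have "AE h in haar. pairing f (fpoint (flag_act h std_flag)) \<noteq> 0"
    using AE_haar_column[OF assms] AE_space
  proof eventually_elim
    case (elim h)
    then show ?case using fpoint_ex[of h] by auto
  qed
  then show ?thesis by (simp only: AE_flag_iff[OF m])
qed

lemma AE_flag_fcov:
  fixes v :: "'k::rc_field^3"
  assumes "v \<noteq> 0"
  shows "AE F in flag_measure. pairing (fcov F) v \<noteq> 0"
proof -
  have m: "Measurable.pred flag_measure (\<lambda>F. pairing (fcov F) v \<noteq> 0)"
    by (intro pred_neq_0 borel_measurable_pairing fcov_measurable) simp
  have "AE h in haar. pairing (fcov (flag_act h std_flag)) v \<noteq> 0"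
    using AE_haar_covec[OF assms] AE_space
  proof eventually_elim
    case (elim h)
    then show ?case using fcov_ex[of h] by auto
  qed
  then show ?thesis by (simp only: AE_flag_iff[OF m])
qed

lemma flag_component: "i < n \<Longrightarrow> (\<lambda>y. y i) \<in> pow_measure M n \<rightarrow>\<^sub>M M"
  by (rule measurable_component_singleton) simp

lemma AE_pow_det_fpoint:
  "AE y in pow_measure (flag_measure :: 'k::rc_field flag measure) 3.
     pairing (crossk (fpoint (y 0)) (fpoint (y 1))) (fpoint (y 2)) \<noteq> 0"
proof (rule flag.AE_pow_3I)
  show "Measurable.pred (pow_measure (flag_measure :: 'k flag measure) 3)
     (\<lambda>y. pairing (crossk (fpoint (y 0)) (fpoint (y 1))) (fpoint (y 2)) \<noteq> 0)"
    by (intro pred_neq_0 borel_measurable_pairing borel_measurable_crossk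
        measurable_compose[OF _ fpoint_measurable] flag_component) simp_all
  show "AE a in flag_measure. AE b in flag_measure. AE c in (flag_measure :: 'k flag measure).
     pairing (crossk (fpoint a) (fpoint b)) (fpoint c) \<noteq> 0"
    using AE_space
  proof eventually_elim
    case (elim a)
    then have a: "a \<in> flags" by simp
    show ?case
      using AE_flag_fpoint[OF flag_eqs(2)[OF a]]
    proof eventually_elim
      case (elim b)
      \<comment> \<open>The covector of \<open>a\<close> kills the point of \<open>a\<close> but not
        that of \<open>b\<close>, so the two points are distinct.\<close>
      have "crossk (fpoint a) (fpoint b) \<noteq> 0"
        using crossk_eq_0[of "fpoint a" "fpoint b"] flag_eqs(1,5)[OF a] elim by auto
      then show ?case by (rule AE_flag_fpoint)
    qed
  qed
qed

lemma AE_pow_det_fcov: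
  "AE y in pow_measure (flag_measure :: 'k::rc_field flag measure) 3.
     pairing (crossk (fcov (y 0)) (fcov (y 1))) (fcov (y 2)) \<noteq> 0"
proof (rule flag.AE_pow_3I)
  show "Measurable.pred (pow_measure (flag_measure :: 'k flag measure) 3)
     (\<lambda>y. pairing (crossk (fcov (y 0)) (fcov (y 1))) (fcov (y 2)) \<noteq> 0)"
    by (intro pred_neq_0 borel_measurable_pairing borel_measurable_crossk
        measurable_compose[OF _ fcov_measurable] flag_component) simp_all
  show "AE a in flag_measure. AE b in flag_measure. AE c in (flag_measure :: 'k flag measure).
     pairing (crossk (fcov a) (fcov b)) (fcov c) \<noteq> 0"
    using AE_space
  proof eventually_elim
    case (elim a)
    then have a: "a \<in> flags" by simp
    show ?case
      using AE_flag_fcov[OF flag_eqs(1)[OF a]]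
    proof eventually_elim
      case (elim b)
      have "crossk (fcov a) (fcov b) \<noteq> 0"
        using crossk_eq_0[of "fcov a" "fcov b"] flag_eqs(2,5)[OF a] elim by auto
      then have "AE c in flag_measure. pairing (fcov c) (crossk (fcov a) (fcov b)) \<noteq> 0"
        by (rule AE_flag_fcov)
      then show ?case by (simp only: pairing_commute)
    qed
  qed
qed

lemma AE_generic3: "AE y in pow_measure (flag_measure :: 'k::rc_field flag measure) 3. generic3 y"
proof -
  have "AE y in pow_measure (flag_measure :: 'k flag measure) 3. incid (y 0) (y 1) \<noteq> 0"
    "AE y in pow_measure (flag_measure :: 'k flag measure) 3. incid (y 1) (y 0) \<noteq> 0"
    "AE y in pow_measure (flag_measure :: 'k flag measure) 3. incid (y 0) (y 2) \<noteq> 0"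
    "AE y in pow_measure (flag_measure :: 'k flag measure) 3. incid (y 2) (y 0) \<noteq> 0"
    "AE y in pow_measure (flag_measure :: 'k flag measure) 3. incid (y 1) (y 2) \<noteq> 0"
    "AE y in pow_measure (flag_measure :: 'k flag measure) 3. incid (y 2) (y 1) \<noteq> 0"
    by (rule AE_pow_incid; simp)+
  with AE_pow_det_fpoint AE_pow_det_fcov show ?thesis
    unfolding generic3_def by eventually_elim simp
qed

lemma space_pow_flag: "y \<in> space (pow_measure flag_measure n) \<Longrightarrow> i < n \<Longrightarrow> y i \<in> flags"
  by (auto simp: space_PiM)

lemma space_pow_haar: "x \<in> space (pow_measure haar n) \<Longrightarrow> i < n \<Longrightarrow> x i \<in> SL3"
  by (auto simp: space_PiM)

lemma AE_triple_ratio: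
  "AE F in pow_measure (flag_measure :: 'k::rc_field flag measure) 3.
     general_position 3 F \<and> triple_ratio (F 0) (F 1) (F 2) \<noteq> 0"
  using AE_generic3 AE_space
proof eventually_elim
  case (elim F)
  have "F 0 \<in> flags" "F 1 \<in> flags" "F 2 \<in> flags"
    using space_pow_flag[OF elim(2)] by auto
  then show ?case
    using elim(1) general_position_iff ln_triple_ratio(2) by blast
qed

subsection \<open>The triple ratio cocycle\<close>

lemma pred_conj:
  "Measurable.pred M P \<Longrightarrow> Measurable.pred M Q \<Longrightarrow> Measurable.pred M (\<lambda>x. P x \<and> Q x)"
  by measurable

lemma s_cochain_measurable:
  "s_cochain \<phi> \<in> borel_measurable (pow_measure (flag_measure :: 'k::rc_field flag measure) 3)"
proof -
  let ?M = "pow_measure (flag_measure :: 'k flag measure) 3"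
  have c: "(\<lambda>y. y 0) \<in> ?M \<rightarrow>\<^sub>M flag_measure" "(\<lambda>y. y 1) \<in> ?M \<rightarrow>\<^sub>M flag_measure" "(\<lambda>y. y 2) \<in> ?M \<rightarrow>\<^sub>M flag_measure"
    by (intro flag_component; simp)+
  have "Measurable.pred ?M generic3"
    unfolding generic3_def
  proof (intro pred_conj pred_neq_0)
    show "(\<lambda>y. pairing (crossk (fpoint (y 0)) (fpoint (y 1))) (fpoint (y 2))) \<in> borel_measurable ?M"
      by (intro borel_measurable_pairing borel_measurable_crossk measurable_compose[OF _ fpoint_measurable] c)
    show "(\<lambda>y. pairing (crossk (fcov (y 0)) (fcov (y 1))) (fcov (y 2))) \<in> borel_measurable ?M"
      by (intro borel_measurable_pairing borel_measurable_crossk measurable_compose[OF _ fcov_measurable] c)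
  qed (intro incid_measurable c)+
  moreover have "(\<lambda>F. form_coeff \<phi> * (bracket (F 0) (F 1) + bracket (F 1) (F 2) + bracket (F 2) (F 0))) \<in> borel_measurable ?M"
    by (intro borel_measurable_times borel_measurable_add bracket_measurable c) simp
  ultimately have "(\<lambda>F. if generic3 F
    then form_coeff \<phi> * (bracket (F 0) (F 1) + bracket (F 1) (F 2) + bracket (F 2) (F 0)) else 0) \<in> borel_measurable ?M"
    by (intro measurable_If) auto
  then show ?thesis
    by (subst measurable_cong[OF s_cochain_eq]) (auto intro: space_pow_flag)
qed

lemma s_cochain_generic:
  assumes "y \<in> space (pow_measure flag_measure 3)" "generic3 y"
  shows "s_cochain \<phi> y = form_coeff \<phi> * (bracket (y 0) (y 1) + bracket (y 1) (y 2) + bracket (y 2) (y 0))"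
  using assms by (subst s_cochain_eq) (auto intro: space_pow_flag)

lemma translate_in_space_flag:
  "g \<in> SL3 \<Longrightarrow> y \<in> space (pow_measure flag_measure n) \<Longrightarrow> translate flag_act n g y \<in> space (pow_measure flag_measure n)"
  by (auto simp: space_PiM translate_def PiE_iff flag_act_in)

lemma s_cochain_L0_inv: "s_cochain \<phi> \<in> L0_inv flag_act (flag_measure :: 'k::rc_field flag measure) 3"
  unfolding L0_inv_def
proof (intro CollectI conjI ballI)
  show "s_cochain \<phi> \<in> borel_measurable (pow_measure (flag_measure :: 'k flag measure) 3)"
    by (rule s_cochain_measurable)
  fix g :: "'k^3^3" assume g: "g \<in> SL3"
  show "AE x in pow_measure flag_measure 3. s_cochain \<phi> (translate flag_act 3 g x) = s_cochain \<phi> x"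
    using AE_generic3 AE_pow_flag_translate[OF g AE_generic3] AE_space
  proof eventually_elim
    case (elim y)
    have fl: "y 0 \<in> flags" "y 1 \<in> flags" "y 2 \<in> flags" using space_pow_flag[OF elim(3)] by auto
    have nz: "incid (y 0) (y 1) \<noteq> 0" "incid (y 1) (y 0) \<noteq> 0" "incid (y 0) (y 2) \<noteq> 0"
     "incid (y 2) (y 0) \<noteq> 0" "incid (y 1) (y 2) \<noteq> 0" "incid (y 2) (y 1) \<noteq> 0"
      using elim(1) by (auto simp: generic3_def)
    have t: "translate flag_act 3 g y 0 = flag_act g (y 0)" "translate flag_act 3 g y 1 = flag_act g (y 1)"
      "translate flag_act 3 g y 2 = flag_act g (y 2)" by (simp_all add: translate_def)
    \<comment> \<open>With \<open>mat 1\<close> as base element, the height terms of the three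
      brackets cancel around the triangle.\<close>
    show ?case
      unfolding s_cochain_generic[OF elim(3,1)] s_cochain_generic[OF translate_in_space_flag[OF g elim(3)] elim(2)] t
      using bracket_height_act[OF g one_SL3 fl(1,2) nz(1,2)] bracket_height_act[OF g one_SL3 fl(2,3) nz(5,6)]
        bracket_height_act[OF g one_SL3 fl(3,1) nz(4,3)]
      by simp
  qed
qed

lemma skip_in_space: "i \<le> n \<Longrightarrow> x \<in> space (pow_measure M (Suc n)) \<Longrightarrow> skip n i x \<in> space (pow_measure M n)"
  by (auto simp: space_PiM skip_def PiE_iff)

lemma hdiff_1: "hdiff (Suc 0) f x = f (skip (Suc 0) 0 x) - f (skip (Suc 0) (Suc 0) x)"
  by (simp add: hdiff_def)

lemma hdiff_2: "hdiff 2 f x = f (skip 2 0 x) - f (skip 2 1 x) + f (skip 2 2 x)"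
  by (simp add: hdiff_def numeral_2_eq_2)

lemma hdiff_3: "hdiff 3 f x = f (skip 3 0 x) - f (skip 3 1 x) + f (skip 3 2 x) - f (skip 3 3 x)"
  by (simp add: hdiff_def numeral_3_eq_3 numeral_2_eq_2)

text \<open>On generic triples the cochain is a multiple of the differential of the antisymmetric
  \<open>bracket\<close>, so the cocycle identity is formal. What needs proof is that almost every
  quadruple has four generic faces.\<close>

lemma s_cochain_cocycle: "s_cochain \<phi> \<in> cocycles flag_act (flag_measure :: 'k::rc_field flag measure) 2"
proof -
  have "AE x in pow_measure (flag_measure :: 'k flag measure) (Suc 3). generic3 (skip 3 0 x)"
    "AE x in pow_measure (flag_measure :: 'k flag measure) (Suc 3). generic3 (skip 3 1 x)"
    "AE x in pow_measure (flag_measure :: 'k flag measure) (Suc 3). generic3 (skip 3 2 x)"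
    "AE x in pow_measure (flag_measure :: 'k flag measure) (Suc 3). generic3 (skip 3 3 x)"
    by (rule flag.AE_pow_skip[OF _ AE_generic3]; simp)+
  then have "AE x in pow_measure (flag_measure :: 'k flag measure) (Suc 3). hdiff 3 (s_cochain \<phi>) x = 0"
    using AE_space
  proof eventually_elim
    case (elim x)
    then have gen: "generic3 (skip 3 0 x)" "generic3 (skip 3 1 x)" "generic3 (skip 3 2 x)" "generic3 (skip 3 3 x)"
      by simp_all
    have sp: "skip 3 i x \<in> space (pow_measure flag_measure 3)" if "i \<le> 3" for i
      by (rule skip_in_space[OF that elim(5)])
    have le: "(0::nat) \<le> 3" "(1::nat) \<le> 3" "(2::nat) \<le> 3" "(3::nat) \<le> 3" by simp_all
    show ?case
      unfolding hdiff_3 s_cochain_generic[OF sp[OF le(1)] gen(1)] s_cochain_generic[OF sp[OF le(2)] gen(2)]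
        s_cochain_generic[OF sp[OF le(3)] gen(3)] s_cochain_generic[OF sp[OF le(4)] gen(4)]
      by (simp add: skip_def bracket_def algebra_simps numeral_2_eq_2 numeral_3_eq_3)
  qed
  moreover have e: "Suc 2 = 3" by simp
  ultimately show ?thesis
    unfolding cocycles_def e using s_cochain_L0_inv[of \<phi>] by blast
qed

subsection \<open>Triviality on the group\<close>

text \<open>The form with two coefficients covers sums, differences and negation at once, here and
  in the analogous lemmas on cochains and bicochains.\<close>

lemma hdiff_lin: "hdiff n (\<lambda>x. a * f x + b * g x) x = a * hdiff n f x + b * hdiff n g x"
  by (simp add: hdiff_def sum_distrib_left sum.distrib algebra_simps)

lemma L0_inv_lin:
  fixes act :: "'k::rc_field^3^3 \<Rightarrow> 'a \<Rightarrow> 'a"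
  assumes "f \<in> L0_inv act M n" "g \<in> L0_inv act M n"
  shows "(\<lambda>x. a * f x + b * g x) \<in> L0_inv act M n"
  unfolding L0_inv_def
proof (intro CollectI conjI ballI)
  show "(\<lambda>x. a * f x + b * g x) \<in> borel_measurable (pow_measure M n)"
    using assms unfolding L0_inv_def by (intro borel_measurable_add borel_measurable_times) auto
  fix k :: "'k^3^3" assume "k \<in> SL3"
  then have "AE x in pow_measure M n. f (translate act n k x) = f x" "AE x in pow_measure M n. g (translate act n k x) = g x"
    using assms by (auto simp: L0_inv_def)
  then show "AE x in pow_measure M n. a * f (translate act n k x) + b * g (translate act n k x) = a * f x + b * g x"
    by eventually_elim simp
qed

lemma coboundaries_lin:
  assumes "f \<in> coboundaries act M (Suc n)" "g \<in> coboundaries act M (Suc n)"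
  shows "(\<lambda>x. a * f x + b * g x) \<in> coboundaries act M (Suc n)"
proof -
  obtain h k where h: "h \<in> L0_inv act M (Suc n)" "AE x in pow_measure M (Suc (Suc n)). f x = hdiff (Suc n) h x"
    and k: "k \<in> L0_inv act M (Suc n)" "AE x in pow_measure M (Suc (Suc n)). g x = hdiff (Suc n) k x"
    using assms by (auto simp: coboundaries_def)
  have "AE x in pow_measure M (Suc (Suc n)). a * f x + b * g x = hdiff (Suc n) (\<lambda>x. a * h x + b * k x) x"
    using h(2) k(2) by eventually_elim (simp add: hdiff_lin)
  then show ?thesis
    using L0_inv_lin[OF h(1) k(1)] L0_inv_lin[of f act M _ g a b] assms
    unfolding coboundaries_def by auto
qed

lemma zero_L0_inv: "(\<lambda>_. 0) \<in> L0_inv act M n"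
  by (simp add: L0_inv_def)

lemma zero_coboundary: "(\<lambda>_. 0) \<in> coboundaries act M (Suc n)"
  using zero_L0_inv[of act M "Suc n"] by (auto simp: coboundaries_def zero_L0_inv hdiff_def intro!: bexI[of _ "\<lambda>_. 0"])

lemma cohom_class_eq:
  assumes "(\<lambda>x. f x - g x) \<in> coboundaries act M (Suc n)"
  shows "cohom_class act M (Suc n) f = cohom_class act M (Suc n) g"
proof -
  have "(\<lambda>x. f' x - f x) \<in> coboundaries act M (Suc n) \<longleftrightarrow> (\<lambda>x. f' x - g x) \<in> coboundaries act M (Suc n)" for f'
    using coboundaries_lin[OF _ assms, of "\<lambda>x. f' x - f x" 1 1] coboundaries_lin[OF _ assms, of "\<lambda>x. f' x - g x" 1 "-1"]
    by auto
  then show ?thesis by (simp add: cohom_class_def)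
qed

lemma map_pow_translate:
  "map_pow n (\<lambda>g. flag_act g std_flag) (translate (**) n g x) = translate flag_act n g (map_pow n (\<lambda>g. flag_act g std_flag) x)"
  by (auto simp: map_pow_def translate_def flag_act_mult fun_eq_iff)

lemma L0_inv_pullback:
  assumes "f \<in> L0_inv flag_act (flag_measure :: 'k::rc_field flag measure) n"
  shows "(\<lambda>x. f (map_pow n (\<lambda>g. flag_act g std_flag) x)) \<in> L0_inv (**) haar n"
  unfolding L0_inv_def
proof (intro CollectI conjI ballI)
  have "f \<in> borel_measurable (pow_measure flag_measure n)" using assms by (simp add: L0_inv_def)
  from measurable_compose[OF measurable_map_pow[OF measurable_std_flag] this]
  show "(\<lambda>x. f (map_pow n (\<lambda>g. flag_act g std_flag) x)) \<in> borel_measurable (pow_measure haar n)" .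
  fix g :: "'k^3^3" assume "g \<in> SL3"
  then have "AE y in pow_measure flag_measure n. f (translate flag_act n g y) = f y"
    using assms by (simp add: L0_inv_def)
  from AE_pow_flagD[OF this]
  show "AE x in pow_measure haar n. f (map_pow n (\<lambda>g. flag_act g std_flag) (translate (**) n g x))
      = f (map_pow n (\<lambda>g. flag_act g std_flag) x)"
    by (simp only: map_pow_translate)
qed

lemma skip_map_pow: "i \<le> n \<Longrightarrow> skip n i (map_pow (Suc n) f x) = map_pow n f (skip n i x)"
  by (auto simp: skip_def map_pow_def fun_eq_iff)

lemma hdiff_map_pow: "hdiff n f (map_pow (Suc n) p x) = hdiff n (\<lambda>x. f (map_pow n p x)) x"
  unfolding hdiff_def by (intro sum.cong) (auto simp: skip_map_pow)

lemma coboundaries_pullback: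
  assumes "f \<in> coboundaries flag_act (flag_measure :: 'k::rc_field flag measure) (Suc n)"
  shows "(\<lambda>x. f (map_pow (Suc (Suc n)) (\<lambda>g. flag_act g std_flag) x)) \<in> coboundaries (**) haar (Suc n)"
proof -
  obtain h where h: "h \<in> L0_inv flag_act flag_measure (Suc n)" "AE x in pow_measure flag_measure (Suc (Suc n)). f x = hdiff (Suc n) h x"
    and f: "f \<in> L0_inv flag_act flag_measure (Suc (Suc n))"
    using assms by (auto simp: coboundaries_def)
  from AE_pow_flagD[OF h(2)] L0_inv_pullback[OF h(1)] L0_inv_pullback[OF f]
  show ?thesis
    unfolding coboundaries_def hdiff_map_pow by auto
qed

lemma ev_cochain_map_pow: "ev_cochain std_flag n f = (\<lambda>x. f (map_pow (Suc n) (\<lambda>g. flag_act g std_flag) x))"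
  by (simp add: ev_cochain_def map_pow_def)

text \<open>The function B for the lift of a coset by the columns of its representative, which makes
  it invariant under left translation.\<close>

definition lnD :: "'k::rc_field^3^3 \<Rightarrow> 'k^3^3 \<Rightarrow> real" where
  "lnD g h = ln (norm (pairing (covec g) (column 1 h))) - ln (norm (pairing (covec h) (column 1 g)))"

text \<open>Normalisation changes the lift of each flag by scalars depending on that flag alone;
  \<open>u\<close> collects their logarithms, and its differences cancel in cyclic sums.\<close>

lemma bracket_std:
  "\<exists>u. \<forall>g\<in>SL3. \<forall>h\<in>SL3. incid (flag_act g std_flag) (flag_act h std_flag) \<noteq> 0 \<longrightarrow>
     incid (flag_act h std_flag) (flag_act g std_flag) \<noteq> 0 \<longrightarrow>
     bracket (flag_act g std_flag) (flag_act h std_flag) = lnD g h + u g - u (h :: 'k::rc_field^3^3)"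
proof -
  obtain P where P: "\<And>g :: 'k^3^3. g \<in> SL3 \<Longrightarrow> P g \<noteq> 0 \<and> fpoint (flag_act g std_flag) = P g *s column 1 g"
    using fpoint_ex by metis
  obtain C where C: "\<And>g :: 'k^3^3. g \<in> SL3 \<Longrightarrow> C g \<noteq> 0 \<and> fcov (flag_act g std_flag) = C g *s covec g"
    using fcov_ex by metis
  have i: "incid (flag_act g std_flag) (flag_act h std_flag) = norm (C g) * norm (P h) * norm (pairing (covec g) (column 1 h))"
    if "g \<in> SL3" "h \<in> SL3" for g h :: "'k^3^3"
    using C[OF that(1)] P[OF that(2)] by (simp add: incid_def norm_mult)
  have "bracket (flag_act g std_flag) (flag_act h std_flag) =
      lnD g h + (ln (norm (C g)) - ln (norm (P g))) - (ln (norm (C h)) - ln (norm (P h)))"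
    if "g \<in> SL3" "h \<in> SL3" "incid (flag_act g std_flag) (flag_act h std_flag) \<noteq> 0"
      "incid (flag_act h std_flag) (flag_act g std_flag) \<noteq> 0" for g h :: "'k^3^3"
    using C[OF that(1)] P[OF that(2)] C[OF that(2)] P[OF that(1)] that(3,4)
    unfolding bracket_def i[OF that(1,2)] i[OF that(2,1)] lnD_def
    by (simp add: ln_mult)
  then show ?thesis
    by (intro exI[of _ "\<lambda>g. ln (norm (C g)) - ln (norm (P g))"]) blast
qed

lemma s_cochain_std:
  assumes x: "\<And>i. i < 3 \<Longrightarrow> x i \<in> SL3" and g: "generic3 (map_pow 3 (\<lambda>g. flag_act g std_flag) x)"
  shows "s_cochain \<phi> (map_pow 3 (\<lambda>g. flag_act g std_flag) x) =
    form_coeff \<phi> * (lnD (x 0) (x 1) + lnD (x 1) (x 2) + lnD (x 2) (x 0))"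
proof -
  let ?y = "map_pow 3 (\<lambda>g. flag_act g std_flag) x"
  have y: "?y i = flag_act (x i) std_flag" if "i < 3" for i using that by (simp add: map_pow_def)
  have y012: "?y 0 = flag_act (x 0) std_flag" "?y 1 = flag_act (x 1) std_flag" "?y 2 = flag_act (x 2) std_flag"
    by (simp_all add: y)
  have fl: "?y 0 \<in> flags" "?y 1 \<in> flags" "?y 2 \<in> flags"
    using x by (auto simp: y flag_act_std_in SL3_det_nz)
  have x012: "x 0 \<in> SL3" "x 1 \<in> SL3" "x 2 \<in> SL3" using x by auto
  obtain u where u: "\<And>g h. g \<in> SL3 \<Longrightarrow> h \<in> SL3 \<Longrightarrow> incid (flag_act g std_flag) (flag_act h std_flag) \<noteq> 0 \<Longrightarrow>
     incid (flag_act h std_flag) (flag_act g std_flag) \<noteq> 0 \<Longrightarrow>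
     bracket (flag_act g std_flag) (flag_act h std_flag) = lnD g h + u g - u (h :: 'a^3^3)"
    using bracket_std by blast
  have nz: "incid (?y 0) (?y 1) \<noteq> 0" "incid (?y 1) (?y 0) \<noteq> 0" "incid (?y 0) (?y 2) \<noteq> 0"
     "incid (?y 2) (?y 0) \<noteq> 0" "incid (?y 1) (?y 2) \<noteq> 0" "incid (?y 2) (?y 1) \<noteq> 0"
    using g by (auto simp: generic3_def)
  have "bracket (?y 0) (?y 1) + bracket (?y 1) (?y 2) + bracket (?y 2) (?y 0) = lnD (x 0) (x 1) + lnD (x 1) (x 2) + lnD (x 2) (x 0)"
    using u[OF x012(1,2)] u[OF x012(2,3)] u[OF x012(3,1)] nz unfolding y012 by simp
  then show ?thesis
    by (subst s_cochain_eq[OF fl]) (simp only: g if_True)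
qed

lemma lnD_measurable:
  fixes f g :: "'a \<Rightarrow> 'k::rc_field^3^3"
  assumes "f \<in> M \<rightarrow>\<^sub>M haar" "g \<in> M \<rightarrow>\<^sub>M haar"
  shows "(\<lambda>x. lnD (f x) (g x)) \<in> borel_measurable M"
proof -
  have c: "(\<lambda>g. covec g) \<in> borel_measurable (haar :: ('k^3^3) measure)" "(\<lambda>g. column 1 g) \<in> borel_measurable (haar :: ('k^3^3) measure)"
    by (intro continuous_haar continuous_intros)+
  have "(\<lambda>x. pairing (covec (f x)) (column 1 (g x))) \<in> borel_measurable M"
    "(\<lambda>x. pairing (covec (g x)) (column 1 (f x))) \<in> borel_measurable M"
    by (intro borel_measurable_pairing measurable_compose[OF assms(1) c(1)] measurable_compose[OF assms(1) c(2)]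
        measurable_compose[OF assms(2) c(1)] measurable_compose[OF assms(2) c(2)])+
  then show ?thesis
    unfolding lnD_def by measurable
qed

lemma lnD_mult: "k \<in> SL3 \<Longrightarrow> lnD (k ** g) (k ** h) = lnD g h"
  by (simp add: lnD_def column_mult covec_mult SL3_def)

lemma lnD_swap: "lnD g h = - lnD h g"
  by (simp add: lnD_def)

lemma ev_s_cochain_coboundary:
  "ev_cochain std_flag 2 (s_cochain \<phi>) \<in> coboundaries (**) (haar :: ('k::rc_field^3^3) measure) 2"
proof -
  let ?h = "\<lambda>x::nat \<Rightarrow> 'k^3^3. form_coeff \<phi> * lnD (x 0) (x 1)"
  have h: "?h \<in> L0_inv (**) haar 2"
    unfolding L0_inv_def
  proof (intro CollectI conjI ballI)
    show "?h \<in> borel_measurable (pow_measure haar 2)"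
      by (intro borel_measurable_times lnD_measurable flag_component) simp_all
    fix k :: "'k^3^3" assume k: "k \<in> SL3"
    show "AE x in pow_measure haar 2. ?h (translate (**) 2 k x) = ?h x"
      by (simp add: translate_def lnD_mult[OF k])
  qed
  have "AE x in pow_measure haar 3. generic3 (map_pow 3 (\<lambda>g. flag_act g std_flag :: 'k flag) x)"
    by (rule AE_pow_flagD[OF AE_generic3])
  then have "AE x in pow_measure haar 3. s_cochain \<phi> (map_pow 3 (\<lambda>g. flag_act g std_flag) x) = hdiff 2 ?h x"
    using AE_space
  proof eventually_elim
    case (elim x)
    have "hdiff 2 ?h x = form_coeff \<phi> * (lnD (x 0) (x 1) + lnD (x 1) (x 2) + lnD (x 2) (x 0))"
      unfolding hdiff_2 using lnD_swap[of "x 2" "x 0"] by (simp add: skip_def numeral_2_eq_2 algebra_simps)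
    then show ?case
      using s_cochain_std[OF space_pow_haar[OF elim(2)] elim(1), of \<phi>] by simp
  qed
  moreover have e: "Suc 2 = 3" by simp
  ultimately show ?thesis
    unfolding coboundaries_def ev_cochain_map_pow e
    using h L0_inv_pullback[OF s_cochain_L0_inv[of \<phi>]] by (auto simp del: One_nat_def)
qed

lemma cohom_class_self: "f \<in> cocycles act M (Suc n) \<Longrightarrow> f \<in> cohom_class act M (Suc n) f"
  using zero_coboundary[of act M n] by (simp add: cohom_class_def)

lemma s_cochain_NHm:
  "cohom_class flag_act flag_measure 2 (s_cochain \<phi>) \<in> NHm 2"
proof -
  let ?c = "cohom_class flag_act flag_measure 2 (s_cochain \<phi>)"
  have "?c \<in> Hm flag_act flag_measure 2"
    unfolding Hm_def using s_cochain_cocycle by blast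
  \<comment> \<open>The image under \<open>ev\<close> is a union over all representatives, so every
    cocycle in the class has to be treated; the coboundary separating it from
    \<open>s_cochain\<close> is pulled back to the group.\<close>
  moreover have "cohom_class (**) haar 2 (ev_cochain std_flag 2 f) = cohom_class (**) haar 2 (\<lambda>_. 0)" if "f \<in> ?c" for f
  proof -
    have "(\<lambda>x. f x - s_cochain \<phi> x) \<in> coboundaries flag_act flag_measure (Suc (Suc 0))"
      using that by (simp add: cohom_class_def numeral_2_eq_2)
    from coboundaries_lin[OF coboundaries_pullback[OF this] ev_s_cochain_coboundary[of \<phi>, unfolded numeral_2_eq_2], of 1 1]
    have "(\<lambda>x. ev_cochain std_flag 2 f x - 0) \<in> coboundaries (**) haar (Suc (Suc 0))"
      by (simp add: ev_cochain_map_pow numeral_2_eq_2)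
    then show ?thesis
      unfolding numeral_2_eq_2 by (rule cohom_class_eq)
  qed
  moreover have "s_cochain \<phi> \<in> ?c"
    using cohom_class_self[of "s_cochain \<phi>" flag_act flag_measure "Suc 0"] s_cochain_cocycle[of \<phi>]
    unfolding numeral_2_eq_2 by blast
  ultimately show ?thesis
    unfolding NHm_def ev_def by blast
qed

subsection \<open>Formal properties of the double complex\<close>

lemma bi_eq_refl [simp]: "bi_eq p q F F"
  by (simp add: bi_eq_def)

lemma bi_eq_sym: "bi_eq p q F F' \<Longrightarrow> bi_eq p q F' F"
  by (simp add: bi_eq_def eq_commute)

lemma bi_eq_lin:
  assumes "bi_eq p q F F'" "bi_eq p q G G'"
  shows "bi_eq p q (\<lambda>x y. a * F x y + b * G x y) (\<lambda>x y. a * F' x y + b * G' x y)"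
  using assms unfolding bi_eq_def
proof eventually_elim
  case (elim x)
  then show ?case by eventually_elim simp
qed

lemma bi_eq_trans:
  assumes "bi_eq p q F F'" "bi_eq p q F' F''"
  shows "bi_eq p q F F''"
  using assms unfolding bi_eq_def
proof eventually_elim
  case (elim x)
  then show ?case by eventually_elim simp
qed

lemma bi_eq_d_right:
  fixes F F' :: "'k::rc_field bicochain"
  assumes "bi_eq p q F F'"
  shows "bi_eq p (Suc q) (d_right p q F) (d_right p q F')"
  using assms unfolding bi_eq_def
proof eventually_elim
  case (elim x)
  have "AE y in pow_measure flag_measure (Suc q). \<forall>i\<in>{..q}. F x (skip q i y) = F' x (skip q i y)"
    using flag.AE_pow_skip[OF _ elim] by (intro AE_finite_allI) auto
  then show ?case
    by eventually_elim (simp add: d_right_def hdiff_def)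
qed

lemma bi_eq_d_up:
  fixes F F' :: "'k::rc_field bicochain"
  assumes "bi_eq p q F F'"
  shows "bi_eq (Suc p) q (d_up p F) (d_up p F')"
proof -
  have "AE x in pow_measure haar (Suc (Suc p)). \<forall>i\<in>{..Suc p}. AE y in pow_measure flag_measure q. F (skip (Suc p) i x) y = F' (skip (Suc p) i x) y"
    using haar.AE_pow_skip[OF _ assms[unfolded bi_eq_def]] by (intro AE_finite_allI) auto
  then show ?thesis
    unfolding bi_eq_def
  proof eventually_elim
    case (elim x)
    then have "AE y in pow_measure flag_measure q. \<forall>i\<in>{..Suc p}. F (skip (Suc p) i x) y = F' (skip (Suc p) i x) y"
      by (intro AE_finite_allI) auto
    then show ?case
      by eventually_elim (simp add: d_up_def hdiff_def)
  qed
qed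

lemma d_right_lin: "d_right p q (\<lambda>x y. a * F x y + b * G x y) = (\<lambda>x y. a * d_right p q F x y + b * d_right p q G x y)"
  by (simp add: d_right_def fun_eq_iff hdiff_lin algebra_simps)

lemma d_up_lin: "d_up p (\<lambda>x y. a * F x y + b * G x y) = (\<lambda>x y. a * d_up p F x y + b * d_up p G x y)"
  by (simp add: d_up_def fun_eq_iff hdiff_lin)

lemma d_right_zero: "d_right p q (\<lambda>_ _. 0) = (\<lambda>_ _. 0)"
  by (simp add: d_right_def hdiff_def fun_eq_iff)

lemma d_up_zero: "d_up p (\<lambda>_ _. 0) = (\<lambda>_ _. 0)"
  by (simp add: d_up_def hdiff_def fun_eq_iff)

lemma hdiff_swap: "hdiff n (\<lambda>x. hdiff m (F x) y) x = hdiff m (\<lambda>y. hdiff n (\<lambda>x. F x y) x) y"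
  unfolding hdiff_def sum_distrib_left by (subst sum.swap) (simp only: mult.left_commute)

text \<open>The two alternating sums commute; the sign of \<open>d_right\<close>, which changes with
  \<open>p\<close>, turns this into anticommutation.\<close>

lemma d_up_d_right: "d_up p (d_right p q F) = (\<lambda>x y. - d_right (Suc p) q (d_up p F) x y)"
proof (intro ext)
  fix x y
  have "d_up p (d_right p q F) x y = (-1) ^ (p + 1) * hdiff (Suc p) (\<lambda>x. hdiff q (F x) y) x"
    using hdiff_lin[of "Suc p" "(-1) ^ (p + 1)" "\<lambda>x. hdiff q (F x) y" 0 "\<lambda>_. 0" x]
    by (simp add: d_up_def d_right_def)
  also have "hdiff (Suc p) (\<lambda>x. hdiff q (F x) y) x = hdiff q (\<lambda>y. hdiff (Suc p) (\<lambda>x. F x y) x) y"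
    by (rule hdiff_swap)
  also have "(-1) ^ (p + 1) * \<dots> = - d_right (Suc p) q (d_up p F) x y"
    by (simp add: d_right_def d_up_def)
  finally show "d_up p (d_right p q F) x y = - d_right (Suc p) q (d_up p F) x y" .
qed

lemma d_right_d_right_1: "d_right p 1 (d_right p 0 F) = (\<lambda>_ _. 0 :: real)"
  for F :: "'k::rc_field bicochain"
proof (intro ext)
  fix x :: "nat \<Rightarrow> 'k^3^3" and y :: "nat \<Rightarrow> 'k flag"
  have "skip 0 0 (skip (Suc 0) (Suc 0) y) = skip 0 0 (skip (Suc 0) 0 y)" by (simp add: skip_def)
  then show "d_right p 1 (d_right p 0 F) x y = 0"
    by (simp add: d_right_def hdiff_def)
qed

lemma d_right_d_right_2: "d_right p 2 (d_right p 1 F) = (\<lambda>_ _. 0 :: real)"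
  for F :: "'k::rc_field bicochain"
proof (intro ext)
  fix x :: "nat \<Rightarrow> 'k^3^3" and y :: "nat \<Rightarrow> 'k flag"
  have "skip (Suc 0) 0 (skip 2 (Suc 0) y) = skip (Suc 0) 0 (skip 2 0 y)"
    "skip (Suc 0) 0 (skip 2 2 y) = skip (Suc 0) (Suc 0) (skip 2 0 y)"
    "skip (Suc 0) (Suc 0) (skip 2 2 y) = skip (Suc 0) (Suc 0) (skip 2 (Suc 0) y)"
    by (simp_all add: skip_def fun_eq_iff restrict_def numeral_2_eq_2)
  then show "d_right p 2 (d_right p 1 F) x y = 0"
    unfolding d_right_def hdiff_2 by (simp add: hdiff_1 right_diff_distrib)
qed

definition bitranslate :: "nat \<Rightarrow> nat \<Rightarrow> 'k::rc_field^3^3 \<Rightarrow> 'k bicochain \<Rightarrow> 'k bicochain" where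
  "bitranslate p q g F = (\<lambda>x y. F (translate (**) (Suc p) g x) (translate flag_act q g y))"

lemma bicochains_iff: "F \<in> bicochains p q \<longleftrightarrow>
   case_prod F \<in> borel_measurable (pow_measure haar (Suc p) \<Otimes>\<^sub>M pow_measure flag_measure q) \<and>
   (\<forall>g\<in>SL3. bi_eq p q (bitranslate p q g F) F)"
  by (simp add: bicochains_def bitranslate_def)

lemma bicochains_lin:
  assumes "F \<in> bicochains p q" "G \<in> bicochains p q"
  shows "(\<lambda>x y. a * F x y + b * G x y) \<in> bicochains p q"
  unfolding bicochains_iff
proof (intro conjI ballI)
  have "(\<lambda>z. a * case_prod F z + b * case_prod G z) \<in> borel_measurable (pow_measure haar (Suc p) \<Otimes>\<^sub>M pow_measure flag_measure q)"
    using assms unfolding bicochains_iff by (intro borel_measurable_add borel_measurable_times) auto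
  then show "(\<lambda>(x, y). a * F x y + b * G x y) \<in> borel_measurable (pow_measure haar (Suc p) \<Otimes>\<^sub>M pow_measure flag_measure q)"
    by (simp add: case_prod_beta')
  fix g :: "'a^3^3" assume "g \<in> SL3"
  then have "bi_eq p q (bitranslate p q g F) F" "bi_eq p q (bitranslate p q g G) G"
    using assms by (auto simp: bicochains_iff)
  from bi_eq_lin[OF this, of a b]
  show "bi_eq p q (bitranslate p q g (\<lambda>x y. a * F x y + b * G x y)) (\<lambda>x y. a * F x y + b * G x y)"
    by (simp add: bitranslate_def)
qed

lemma zero_bicochains: "(\<lambda>_ _. 0) \<in> bicochains p q"
  by (simp add: bicochains_iff bitranslate_def)

lemma skip_translate: "i \<le> n \<Longrightarrow> skip n i (translate act (Suc n) g x) = translate act n g (skip n i x)"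
  by (auto simp: skip_def translate_def fun_eq_iff)

lemma bitranslate_d_right: "bitranslate p (Suc q) g (d_right p q F) = d_right p q (bitranslate p q g F)"
  by (simp add: bitranslate_def d_right_def hdiff_def skip_translate fun_eq_iff)

lemma d_right_bicochains:
  assumes "F \<in> bicochains p q"
  shows "d_right p q F \<in> bicochains p (Suc q)"
  unfolding bicochains_iff
proof (intro conjI ballI)
  let ?M = "pow_measure haar (Suc p) \<Otimes>\<^sub>M pow_measure flag_measure (Suc q)"
  have "(\<lambda>z. (fst z, skip q i (snd z))) \<in> ?M \<rightarrow>\<^sub>M pow_measure haar (Suc p) \<Otimes>\<^sub>M pow_measure flag_measure q" if "i \<le> q" for i
  proof -
    have "(\<lambda>y. skip q i y) \<in> pow_measure flag_measure (Suc q) \<rightarrow>\<^sub>M pow_measure flag_measure q"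
      unfolding skip_def using that by (intro measurable_restrict) auto
    then show ?thesis by (intro measurable_Pair measurable_fst measurable_compose[OF measurable_snd])
  qed
  note m = this
  have F: "case_prod F \<in> borel_measurable (pow_measure haar (Suc p) \<Otimes>\<^sub>M pow_measure flag_measure q)"
    using assms by (simp add: bicochains_iff)
  have "(\<lambda>z. F (fst z) (skip q i (snd z))) \<in> borel_measurable ?M" if "i \<le> q" for i
    using measurable_compose[OF m[OF that] F] by (simp only: case_prod_conv)
  then have "(\<lambda>z. (-1) ^ (p + 1) * (\<Sum>i\<le>q. (-1) ^ i * F (fst z) (skip q i (snd z)))) \<in> borel_measurable ?M"
    by (intro borel_measurable_times borel_measurable_sum) auto
  then show "case_prod (d_right p q F) \<in> borel_measurable ?M"
    by (simp add: d_right_def hdiff_def case_prod_beta')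
  fix g :: "'a^3^3" assume "g \<in> SL3"
  then show "bi_eq p (Suc q) (bitranslate p (Suc q) g (d_right p q F)) (d_right p q F)"
    using assms unfolding bitranslate_d_right by (intro bi_eq_d_right) (simp add: bicochains_iff)
qed

lemma E1_cocycles_lin:
  assumes "F \<in> E1_cocycles p q" "G \<in> E1_cocycles p q"
  shows "(\<lambda>x y. a * F x y + b * G x y) \<in> E1_cocycles p q"
  using assms bicochains_lin[of F p q G a b] bi_eq_lin[of "Suc p" q "d_up p F" "\<lambda>_ _. 0" "d_up p G" "\<lambda>_ _. 0" a b]
  by (simp add: E1_cocycles_def d_up_lin)

lemma zero_E1_cocycles: "(\<lambda>_ _. 0) \<in> E1_cocycles p q"
  by (simp add: E1_cocycles_def d_up_zero zero_bicochains)

lemma E1_coboundaries_lin: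
  assumes "F \<in> E1_coboundaries p q" "G \<in> E1_coboundaries p q"
  shows "(\<lambda>x y. a * F x y + b * G x y) \<in> E1_coboundaries p q"
proof (cases p)
  case 0
  then show ?thesis
    using assms bicochains_lin[of F p q G a b] bi_eq_lin[of 0 q F "\<lambda>_ _. 0" G "\<lambda>_ _. 0" a b]
    by (simp add: E1_coboundaries_def)
next
  case (Suc p')
  obtain \<beta> \<gamma> where "\<beta> \<in> bicochains p' q" "bi_eq p q F (d_up p' \<beta>)" "\<gamma> \<in> bicochains p' q" "bi_eq p q G (d_up p' \<gamma>)"
    using assms by (auto simp: E1_coboundaries_def Suc)
  then have "(\<lambda>x y. a * \<beta> x y + b * \<gamma> x y) \<in> bicochains p' q"
    "bi_eq p q (\<lambda>x y. a * F x y + b * G x y) (d_up p' (\<lambda>x y. a * \<beta> x y + b * \<gamma> x y))"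
    by (auto intro: bicochains_lin bi_eq_lin simp: d_up_lin)
  moreover have "(\<lambda>x y. a * F x y + b * G x y) \<in> bicochains p q"
    using assms by (intro bicochains_lin) (auto simp: E1_coboundaries_def)
  ultimately show ?thesis
    unfolding E1_coboundaries_def Suc by auto
qed

lemma zero_E1_coboundaries: "(\<lambda>_ _. 0) \<in> E1_coboundaries p q"
  by (cases p) (auto simp: E1_coboundaries_def zero_bicochains d_up_zero intro!: bexI[of _ "\<lambda>_ _. 0"])

lemma E2_coboundaries_lin:
  assumes "F \<in> E2_coboundaries p (Suc q)" "G \<in> E2_coboundaries p (Suc q)"
  shows "(\<lambda>x y. a * F x y + b * G x y) \<in> E2_coboundaries p (Suc q)"
proof -
  obtain \<zeta> \<xi> where z: "\<zeta> \<in> E1_cocycles p q" "(\<lambda>x y. F x y - d_right p q \<zeta> x y) \<in> E1_coboundaries p (Suc q)"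
      "\<xi> \<in> E1_cocycles p q" "(\<lambda>x y. G x y - d_right p q \<xi> x y) \<in> E1_coboundaries p (Suc q)"
    using assms by (auto simp: E2_coboundaries_def)
  from E1_coboundaries_lin[OF z(2,4), of a b]
  have "(\<lambda>x y. (a * F x y + b * G x y) - d_right p q (\<lambda>x y. a * \<zeta> x y + b * \<xi> x y) x y) \<in> E1_coboundaries p (Suc q)"
    by (simp add: d_right_lin algebra_simps)
  moreover have "(\<lambda>x y. a * F x y + b * G x y) \<in> E1_cocycles p (Suc q)"
    using assms by (intro E1_cocycles_lin) (auto simp: E2_coboundaries_def)
  ultimately show ?thesis
    using E1_cocycles_lin[OF z(1,3), of a b] by (auto simp: E2_coboundaries_def)
qed

lemma zero_E2_coboundaries: "(\<lambda>_ _. 0) \<in> E2_coboundaries p (Suc q)"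
  using zero_E1_cocycles zero_E1_coboundaries
  by (auto simp: E2_coboundaries_def d_right_zero intro!: bexI[of _ "\<lambda>_ _. 0"])

lemma E2_class_eq:
  assumes "(\<lambda>x y. F x y - G x y) \<in> E2_coboundaries p (Suc q)"
  shows "E2_class p (Suc q) F = E2_class p (Suc q) G"
proof -
  have "(\<lambda>x y. H x y - F x y) \<in> E2_coboundaries p (Suc q) \<longleftrightarrow> (\<lambda>x y. H x y - G x y) \<in> E2_coboundaries p (Suc q)" for H
    using E2_coboundaries_lin[OF _ assms, of "\<lambda>x y. H x y - F x y" 1 1]
      E2_coboundaries_lin[OF _ assms, of "\<lambda>x y. H x y - G x y" 1 "-1"] by auto
  then show ?thesis by (simp add: E2_class_def)
qed

lemma E2_class_self: "F \<in> E2_cocycles p (Suc q) \<Longrightarrow> F \<in> E2_class p (Suc q) F"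
  using zero_E2_coboundaries[of p q] by (simp add: E2_class_def)

text \<open>\<open>haar\<close> is not the zero measure. This extracts statements about flags from
  statements about bicochains that do not involve the group variable.\<close>

lemma AE_const_pow_haar: "(AE x in pow_measure (haar :: ('k::rc_field^3^3) measure) (Suc 0). P) \<longleftrightarrow> P"
  using haar.AE_pow_1[of "\<lambda>_. P"] AE_haar_ex[of "\<lambda>_. P"] one_SL3 by auto

lemma const_E1_cocycles:
  assumes "k \<in> L0_inv flag_act (flag_measure :: 'k::rc_field flag measure) n"
  shows "(\<lambda>_. k) \<in> E1_cocycles 0 n"
  unfolding E1_cocycles_def bicochains_iff
proof (intro CollectI conjI ballI)
  have "k \<in> borel_measurable (pow_measure flag_measure n)" using assms by (simp add: L0_inv_def)
  from measurable_compose[OF measurable_snd this]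
  show "(\<lambda>(x, y). k y) \<in> borel_measurable (pow_measure haar (Suc 0) \<Otimes>\<^sub>M pow_measure flag_measure n)"
    by (simp add: case_prod_beta')
  show "bi_eq 0 n (bitranslate 0 n g (\<lambda>_. k)) (\<lambda>_. k)" if "g \<in> SL3" for g
    using assms that by (simp add: bi_eq_def bitranslate_def L0_inv_def)
  show "bi_eq (Suc 0) n (d_up 0 (\<lambda>_. k)) (\<lambda>_ _. 0)"
    by (simp add: bi_eq_def d_up_def hdiff_1)
qed

subsection \<open>The image of a form under the differential\<close>

text \<open>For \<open>h\<close> the chosen representative of the flag, \<open>log_a2\<close> of the
  inverse of \<open>h\<close> times \<open>g\<close> differs from the height by a constant depending
  only on the flag, which cancels in the difference over the two group variables.\<close>

lemma form_bicochain_eq: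
  assumes \<phi>: "\<phi> \<in> lie_a_dual_w0" and g: "g 0 \<in> SL3" "g 1 \<in> SL3" and F: "F 0 \<in> flags"
  shows "form_bicochain \<phi> g F = form_coeff \<phi> * (height (g 1) (F 0) - height (g 0) (F 0))"
proof -
  let ?h = "lift (F 0)"
  have h: "?h \<in> SL3" "flag_act ?h std_flag = F 0" using lift[OF F] by auto
  obtain c where c: "c \<noteq> 0" "fpoint (F 0) = c *s column 1 ?h" using fpoint_ex[OF h(1)] h(2) by auto
  obtain d where d: "d \<noteq> 0" "fcov (F 0) = d *s covec ?h" using fcov_ex[OF h(1)] h(2) by auto
  have "log_a2 (matrix_inv ?h ** k) = height k (F 0) - ln (norm c) + ln (norm d)" if k: "k \<in> SL3" for k
  proof -
    have "matrix_inv (matrix_inv ?h ** k) *v axis 1 1 = matrix_inv k *v column 1 ?h"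
      by (simp add: SL3_inv_mult SL3_inv h(1) k SL3_inv_inv mult_axis column_mult)
    moreover have "transpose (matrix_inv ?h ** k) *v axis 3 1 = transpose k *v covec ?h"
    proof (rule pairing_eqI)
      fix x
      have "pairing (covec ?h) (k *v x) = (matrix_inv ?h *v (k *v x)) $ 3"
        using pairing_covec[of ?h "matrix_inv ?h *v (k *v x)"] h(1) by (simp add: SL3_inv_vec SL3_def)
      then show "pairing (transpose (matrix_inv ?h ** k) *v axis 3 1) x = pairing (transpose k *v covec ?h) x"
        by (simp add: pairing_transpose pairing_commute[of "axis 3 1"] flip: matrix_vector_mul_assoc)
    qed
    moreover have "matrix_inv k *v fpoint (F 0) = c *s (matrix_inv k *v column 1 ?h)"
      "transpose k *v fcov (F 0) = d *s (transpose k *v covec ?h)"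
      by (simp_all add: c d vec.scale vec_eq_iff matrix_vector_mult_def sum_3 algebra_simps)
    ultimately show ?thesis
      using height_nz[OF k F] c(1) d(1) by (simp add: log_a2_def height_def norm_scale ln_mult)
  qed
  moreover have "form_bicochain \<phi> g F = form_cocycle \<phi> (pi_A (matrix_inv ?h ** g 0)) (pi_A (matrix_inv ?h ** g 1))"
    unfolding form_bicochain_def lift_def Let_def ..
  ultimately show ?thesis
    using g by (simp add: form_cocycle_pi_A[OF \<phi>] SL3_mult SL3_inv h(1))
qed

text \<open>The cochain \<open>\<gamma>\<^sub>1\<close> of the zigzag: its \<open>d_right\<close> loses the heights and leaves the triple ratio.\<close>

definition zigzag :: "real \<Rightarrow> 'k::rc_field bicochain" where
  "zigzag c x y = - c * (bracket (y 0) (y 1) + height (x 0) (y 0) - height (x 0) (y 1))"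

lemma zigzag_bicochain: "zigzag c \<in> bicochains 0 2"
  unfolding bicochains_iff
proof (intro conjI ballI)
  let ?M = "pow_measure (haar :: ('a^3^3) measure) (Suc 0) \<Otimes>\<^sub>M pow_measure flag_measure 2"
  have m: "(\<lambda>z. fst z 0) \<in> ?M \<rightarrow>\<^sub>M haar" "(\<lambda>z. snd z 0) \<in> ?M \<rightarrow>\<^sub>M flag_measure" "(\<lambda>z. snd z 1) \<in> ?M \<rightarrow>\<^sub>M flag_measure"
    by (rule measurable_compose[OF measurable_fst flag_component] measurable_compose[OF measurable_snd flag_component]; simp)+
  have "(\<lambda>z. - c * (bracket (snd z 0) (snd z 1) + height (fst z 0) (snd z 0) - height (fst z 0) (snd z 1))) \<in> borel_measurable ?M"
    by (intro borel_measurable_times borel_measurable_diff borel_measurable_add bracket_measurable height_measurable m) simp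
  then show "case_prod (zigzag c) \<in> borel_measurable ?M"
    by (simp add: zigzag_def case_prod_beta')
  fix k :: "'a^3^3" assume k: "k \<in> SL3"
  show "bi_eq 0 2 (bitranslate 0 2 k (zigzag c)) (zigzag c)"
    unfolding bi_eq_def
    using AE_space
  proof eventually_elim
    case (elim x)
    have x: "x 0 \<in> SL3" using space_pow_haar[OF elim, of 0] by simp
    have "AE y in pow_measure (flag_measure :: 'a flag measure) 2. incid (y 0) (y 1) \<noteq> 0"
      "AE y in pow_measure (flag_measure :: 'a flag measure) 2. incid (y 1) (y 0) \<noteq> 0"
      by (rule AE_pow_incid; simp)+
    then show ?case
      using AE_space
    proof eventually_elim
      case (elim y)
      have "y 0 \<in> flags" "y 1 \<in> flags" using space_pow_flag[OF elim(3)] by auto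
      from bracket_height_act[OF k x this elim(1,2)]
      show ?case by (simp add: bitranslate_def zigzag_def translate_def)
    qed
  qed
qed

text \<open>The bracket does not involve the group variable, so \<open>d_up\<close> leaves
  differences of heights. On the other side \<open>d_right\<close> carries the sign + for
  \<open>p = 1\<close>.\<close>

lemma d_up_zigzag:
  assumes \<phi>: "\<phi> \<in> lie_a_dual_w0" and x: "x \<in> space (pow_measure haar 2)" and y: "y \<in> space (pow_measure flag_measure 2)"
  shows "d_right 1 1 (form_bicochain \<phi>) x y = d_up 0 (zigzag (form_coeff \<phi>)) x y"
proof -
  have xs: "x 0 \<in> SL3" "x (Suc 0) \<in> SL3" using space_pow_haar[OF x] by auto
  have ys: "y 0 \<in> flags" "y (Suc 0) \<in> flags" using space_pow_flag[OF y] by auto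
  have "form_bicochain \<phi> x (skip (Suc 0) i y) = form_coeff \<phi> * (height (x (Suc 0)) (y (Suc 0 - i)) - height (x 0) (y (Suc 0 - i)))"
    if "i = 0 \<or> i = Suc 0" for i
    using that xs ys by (subst form_bicochain_eq[OF \<phi>]) (auto simp: skip_def)
  from this[of 0] this[of "Suc 0"]
  show ?thesis
    by (simp add: d_right_def d_up_def hdiff_1 zigzag_def skip_def algebra_simps)
qed

lemma bi_eq_d_up_zigzag:
  "\<phi> \<in> lie_a_dual_w0 \<Longrightarrow> bi_eq 1 2 (d_right 1 1 (form_bicochain \<phi>)) (d_up 0 (zigzag (form_coeff \<phi>)))"
  unfolding bi_eq_def
proof -
  assume \<phi>: "\<phi> \<in> lie_a_dual_w0"
  have e: "Suc 1 = 2" by simp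
  show "AE x in pow_measure haar (Suc 1). AE y in pow_measure flag_measure 2.
     d_right 1 1 (form_bicochain \<phi>) x y = d_up 0 (zigzag (form_coeff \<phi>)) x y"
    unfolding e using AE_space
  proof eventually_elim
    case (elim x)
    show ?case
      using AE_space
      by eventually_elim (rule d_up_zigzag[OF \<phi> elim])
  qed
qed

text \<open>The minus sign in \<open>zigzag\<close> is there to cancel the sign of
  \<open>d_right\<close> for \<open>p = 0\<close>. The heights enter as a difference over the two
  flags and so drop out of the alternating sum.\<close>

lemma d_right_zigzag:
  "bi_eq 0 3 (d_right 0 2 (zigzag (form_coeff \<phi>))) (\<lambda>_. s_cochain \<phi>)"
  unfolding bi_eq_def
proof (rule AE_I2)
  fix x :: "nat \<Rightarrow> 'a^3^3"
  show "AE y in pow_measure flag_measure 3. d_right 0 2 (zigzag (form_coeff \<phi>)) x y = s_cochain \<phi> y"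
    using AE_generic3 AE_space
  proof eventually_elim
    case (elim y)
    have "d_right 0 2 (zigzag (form_coeff \<phi>)) x y = form_coeff \<phi> * (bracket (y 0) (y 1) + bracket (y 1) (y 2) + bracket (y 2) (y 0))"
      using bracket_swap[of "y 2" "y 0"]
      unfolding d_right_def hdiff_2 by (simp add: zigzag_def skip_def numeral_2_eq_2 algebra_simps)
    then show ?case by (simp only: s_cochain_generic[OF elim(2,1)])
  qed
qed

lemma form_bicochain_E1_cocycle:
  assumes \<phi>: "\<phi> \<in> lie_a_dual_w0"
  shows "form_bicochain \<phi> \<in> E1_cocycles 1 1"
  unfolding E1_cocycles_def bicochains_iff
proof (intro CollectI conjI ballI)
  let ?M = "pow_measure (haar :: ('a^3^3) measure) (Suc 1) \<Otimes>\<^sub>M pow_measure flag_measure 1"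
  have m: "(\<lambda>z. fst z 0) \<in> ?M \<rightarrow>\<^sub>M haar" "(\<lambda>z. fst z 1) \<in> ?M \<rightarrow>\<^sub>M haar" "(\<lambda>z. snd z 0) \<in> ?M \<rightarrow>\<^sub>M flag_measure"
    by (rule measurable_compose[OF measurable_fst flag_component] measurable_compose[OF measurable_snd flag_component]; simp)+
  have "(\<lambda>z. form_coeff \<phi> * (height (fst z 1) (snd z 0) - height (fst z 0) (snd z 0))) \<in> borel_measurable ?M"
    by (intro borel_measurable_times borel_measurable_diff height_measurable m) simp
  moreover have "case_prod (form_bicochain \<phi>) z = form_coeff \<phi> * (height (fst z 1) (snd z 0) - height (fst z 0) (snd z 0))"
    if "z \<in> space ?M" for z
  proof -
    have z: "fst z \<in> space (pow_measure haar (Suc 1))" "snd z \<in> space (pow_measure flag_measure 1)"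
      using that by (auto simp: space_pair_measure)
    have "form_bicochain \<phi> (fst z) (snd z) = form_coeff \<phi> * (height (fst z 1) (snd z 0) - height (fst z 0) (snd z 0))"
      by (rule form_bicochain_eq[OF \<phi>]; (rule space_pow_haar[OF z(1)] space_pow_flag[OF z(2)])?; simp)
    then show ?thesis by (simp add: case_prod_beta')
  qed
  ultimately show "case_prod (form_bicochain \<phi>) \<in> borel_measurable ?M"
    by (subst measurable_cong) auto
next
  fix k :: "'a^3^3" assume k: "k \<in> SL3"
  obtain p c where pc: "\<forall>F\<in>flags. p F > 0 \<and> c F > 0 \<and>
    (\<forall>F'\<in>flags. incid (flag_act k F) (flag_act k F') = c F * p F' * incid F F') \<and>
    (\<forall>g\<in>SL3. height (k ** g) (flag_act k F) = height g F + ln (p F) - ln (c F))"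
    using flag_act_factors[OF k] by blast
  show "bi_eq 1 1 (bitranslate 1 1 k (form_bicochain \<phi>)) (form_bicochain \<phi>)"
    unfolding bi_eq_def
  proof (rule AE_I2)
    fix x assume x: "x \<in> space (pow_measure (haar :: ('a^3^3) measure) (Suc 1))"
    have xs: "x 0 \<in> SL3" "x (Suc 0) \<in> SL3" using space_pow_haar[OF x] by auto
    show "AE y in pow_measure flag_measure 1. bitranslate 1 1 k (form_bicochain \<phi>) x y = form_bicochain \<phi> x y"
    proof (rule AE_I2)
      fix y assume "y \<in> space (pow_measure (flag_measure :: 'a flag measure) 1)"
      then have y: "y 0 \<in> flags" by (rule space_pow_flag) simp
      have "form_bicochain \<phi> (translate (**) (Suc 1) k x) (translate flag_act 1 k y)
         = form_coeff \<phi> * (height (k ** x (Suc 0)) (flag_act k (y 0)) - height (k ** x 0) (flag_act k (y 0)))"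
        using xs y k by (subst form_bicochain_eq[OF \<phi>]) (simp_all add: translate_def SL3_mult flag_act_in)
      \<comment> \<open>The change of height under \<open>k\<close> depends on the flag but not on
        the group variable, so it cancels.\<close>
      also have "\<dots> = form_coeff \<phi> * (height (x (Suc 0)) (y 0) - height (x 0) (y 0))"
        using pc y xs by simp
      also have "\<dots> = form_bicochain \<phi> x y"
        using xs y by (subst form_bicochain_eq[OF \<phi>]) simp_all
      finally show "bitranslate 1 1 k (form_bicochain \<phi>) x y = form_bicochain \<phi> x y"
        by (simp only: bitranslate_def)
    qed
  qed
next
  show "bi_eq (Suc 1) 1 (d_up 1 (form_bicochain \<phi>)) (\<lambda>_ _. 0)"
    unfolding bi_eq_def
  proof (rule AE_I2, rule AE_I2)
    fix x y assume x: "x \<in> space (pow_measure (haar :: ('a^3^3) measure) (Suc (Suc 1)))"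
      and y1: "y \<in> space (pow_measure (flag_measure :: 'a flag measure) 1)"
    have y: "y 0 \<in> flags" by (rule space_pow_flag[OF y1]) simp
    have xs: "x 0 \<in> SL3" "x (Suc 0) \<in> SL3" "x (Suc (Suc 0)) \<in> SL3" using space_pow_haar[OF x] by auto
    have s: "skip (Suc 1) i x 0 \<in> SL3" "skip (Suc 1) i x 1 \<in> SL3" if "i \<le> 2" for i
      using skip_in_space[OF _ x, of i] that space_pow_haar[of "skip (Suc 1) i x"] by auto
    have "hdiff (Suc 1) (\<lambda>x'. form_bicochain \<phi> x' y) x = hdiff 2 (\<lambda>x'. form_coeff \<phi> * (height (x' 1) (y 0) - height (x' 0) (y 0))) x"
      unfolding hdiff_def by (rule sum.cong) (use s y form_bicochain_eq[OF \<phi>] in \<open>auto simp: numeral_2_eq_2\<close>)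
    then show "d_up 1 (form_bicochain \<phi>) x y = 0"
      unfolding d_up_def hdiff_2 by (simp add: skip_def numeral_2_eq_2 algebra_simps)
  qed
qed

lemma form_bicochain_E2_cocycle:
  assumes \<phi>: "\<phi> \<in> lie_a_dual_w0"
  shows "form_bicochain \<phi> \<in> E2_cocycles 1 (Suc 0)"
proof -
  have b: "form_bicochain \<phi> \<in> bicochains 1 1" using form_bicochain_E1_cocycle[OF \<phi>] by (simp add: E1_cocycles_def)
  have "d_right 1 1 (form_bicochain \<phi>) \<in> E1_coboundaries 1 2"
    using d_right_bicochains[OF b] bi_eq_d_up_zigzag[OF \<phi>] zigzag_bicochain
    by (auto simp: E1_coboundaries_def numeral_2_eq_2)
  then show ?thesis
    using form_bicochain_E1_cocycle[OF \<phi>] by (simp add: E2_cocycles_def numeral_2_eq_2)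
qed

text \<open>Independence of the choices. Two choices of \<open>\<gamma>\<^sub>0\<close> differ by
  \<open>d_right \<zeta> + d_up \<beta>\<close>, and the corresponding cochains in the next step
  differ, after correction by \<open>\<beta>\<close>, by a \<open>d_up\<close>-closed
  \<open>\<xi>\<close>, whose \<open>d_right\<close> is a coboundary.\<close>

lemma d2_representative:
  fixes \<phi> :: "'k::rc_field^3^3 \<Rightarrow> real"
  assumes \<phi>: "\<phi> \<in> lie_a_dual_w0" and \<gamma>0: "\<gamma>\<^sub>0 \<in> form_to_E2 \<phi>"
    and \<gamma>1: "\<gamma>\<^sub>1 \<in> bicochains 0 2" "bi_eq 1 2 (d_right 1 1 \<gamma>\<^sub>0) (d_up 0 \<gamma>\<^sub>1)"
  shows "E2_class 0 3 (d_right 0 2 \<gamma>\<^sub>1) = E2_class 0 3 (\<lambda>_. s_cochain \<phi>)"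
proof -
  let ?f = "form_bicochain \<phi>" and ?z = "zigzag (form_coeff \<phi>)"
  have "(\<lambda>x y. \<gamma>\<^sub>0 x y - ?f x y) \<in> E2_coboundaries 1 (Suc 0)"
    using \<gamma>0 by (simp add: form_to_E2_def E2_class_def)
  then obtain \<zeta> where "(\<lambda>x y. (\<gamma>\<^sub>0 x y - ?f x y) - d_right 1 0 \<zeta> x y) \<in> E1_coboundaries 1 (Suc 0)"
    by (auto simp: E2_coboundaries_def)
  then obtain \<beta> where \<beta>: "\<beta> \<in> bicochains 0 1" "bi_eq 1 1 (\<lambda>x y. (\<gamma>\<^sub>0 x y - ?f x y) - d_right 1 0 \<zeta> x y) (d_up 0 \<beta>)"
    by (auto simp: E1_coboundaries_def)
  \<comment> \<open>Writing z for the zigzag and f for the form, \<open>d_up\<close> of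
    \<open>\<gamma>\<^sub>1\<close> - z is \<open>d_right\<close> of \<open>\<gamma>\<^sub>0\<close>
    - f, which equals \<open>d_right\<close> of \<open>d_up \<beta>\<close>. By anticommutation this
    is minus \<open>d_up\<close> of \<open>d_right 0 1 \<beta>\<close>; hence the plus sign of the
    last term.\<close>
  define \<xi> where "\<xi> = (\<lambda>x y. 1 * (1 * \<gamma>\<^sub>1 x y + (-1) * ?z x y) + 1 * d_right 0 1 \<beta> x y)"
  have \<xi>b: "\<xi> \<in> bicochains 0 2"
    unfolding \<xi>_def using d_right_bicochains[OF \<beta>(1)]
    by (intro bicochains_lin \<gamma>1 zigzag_bicochain) (simp add: numeral_2_eq_2)
  have \<xi>0: "bi_eq 1 2 (d_up 0 \<xi>) (\<lambda>_ _. 0)"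
  proof -
    have "bi_eq 1 2 (d_up 0 \<xi>) (\<lambda>x y. 1 * (1 * d_right 1 1 \<gamma>\<^sub>0 x y + (-1) * d_right 1 1 ?f x y) + 1 * d_up 0 (d_right 0 1 \<beta>) x y)"
      unfolding \<xi>_def d_up_lin
      by (intro bi_eq_lin bi_eq_sym[OF \<gamma>1(2)] bi_eq_sym[OF bi_eq_d_up_zigzag[OF \<phi>]] bi_eq_refl)
    also have "(\<lambda>x y. 1 * (1 * d_right 1 1 \<gamma>\<^sub>0 x y + (-1) * d_right 1 1 ?f x y) + 1 * d_up 0 (d_right 0 1 \<beta>) x y)
      = d_right 1 1 (\<lambda>x y. 1 * (1 * \<gamma>\<^sub>0 x y + (-1) * ?f x y) + (-1) * d_up 0 \<beta> x y)"
      unfolding d_right_lin by (simp add: d_up_d_right)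
    finally have 1: "bi_eq 1 2 (d_up 0 \<xi>) (d_right 1 1 (\<lambda>x y. 1 * (1 * \<gamma>\<^sub>0 x y + (-1) * ?f x y) + (-1) * d_up 0 \<beta> x y))" .
    have "bi_eq 1 1 (\<lambda>x y. 1 * (1 * \<gamma>\<^sub>0 x y + (-1) * ?f x y) + (-1) * d_up 0 \<beta> x y)
       (\<lambda>x y. 1 * (1 * \<gamma>\<^sub>0 x y + (-1) * ?f x y) + (-1) * ((\<gamma>\<^sub>0 x y - ?f x y) - d_right 1 0 \<zeta> x y))"
      by (intro bi_eq_lin bi_eq_refl bi_eq_sym[OF \<beta>(2)])
    also have "(\<lambda>x y. 1 * (1 * \<gamma>\<^sub>0 x y + (-1) * ?f x y) + (-1) * ((\<gamma>\<^sub>0 x y - ?f x y) - d_right 1 0 \<zeta> x y)) = d_right 1 0 \<zeta>"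
      by (simp add: fun_eq_iff)
    finally have "bi_eq 1 (Suc 1) (d_right 1 1 (\<lambda>x y. 1 * (1 * \<gamma>\<^sub>0 x y + (-1) * ?f x y) + (-1) * d_up 0 \<beta> x y)) (d_right 1 1 (d_right 1 0 \<zeta>))"
      by (rule bi_eq_d_right)
    moreover have "Suc 1 = 2" by simp
    ultimately show ?thesis
      using bi_eq_trans[OF 1] by (simp only: d_right_d_right_1)
  qed
  define F where "F = (\<lambda>x y. d_right 0 2 \<gamma>\<^sub>1 x y - s_cochain \<phi> y)"
  have d\<xi>: "bi_eq 0 3 (d_right 0 2 \<xi>) F"
  proof -
    have "d_right 0 2 \<xi> = (\<lambda>x y. 1 * d_right 0 2 \<gamma>\<^sub>1 x y + (-1) * d_right 0 2 ?z x y)"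
      unfolding \<xi>_def d_right_lin d_right_d_right_2 by simp
    moreover have "bi_eq 0 3 (\<lambda>x y. 1 * d_right 0 2 \<gamma>\<^sub>1 x y + (-1) * d_right 0 2 ?z x y) (\<lambda>x y. 1 * d_right 0 2 \<gamma>\<^sub>1 x y + (-1) * s_cochain \<phi> y)"
      by (rule bi_eq_lin[OF bi_eq_refl d_right_zigzag])
    ultimately show ?thesis by (simp add: F_def)
  qed
  have sE: "(\<lambda>_. s_cochain \<phi>) \<in> E1_cocycles 0 3" by (rule const_E1_cocycles[OF s_cochain_L0_inv])
  have Fb: "F \<in> bicochains 0 3"
    using bicochains_lin[OF d_right_bicochains[OF \<gamma>1(1)], of "\<lambda>_. s_cochain \<phi>" 1 "-1"] sE
    by (simp add: F_def E1_cocycles_def numeral_3_eq_3 numeral_2_eq_2)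
  have d\<xi>b: "d_right 0 2 \<xi> \<in> bicochains 0 3"
    using d_right_bicochains[OF \<xi>b] by (simp add: numeral_3_eq_3 numeral_2_eq_2)
  have "bi_eq 1 3 (d_up 0 F) (\<lambda>_ _. 0)"
  proof -
    have "bi_eq 1 3 (d_up 0 F) (d_up 0 (d_right 0 2 \<xi>))"
      using bi_eq_d_up[OF bi_eq_sym[OF d\<xi>]] by simp
    moreover have "bi_eq 1 (Suc 2) (d_right 1 2 (d_up 0 \<xi>)) (d_right 1 2 (\<lambda>_ _. 0))"
      by (rule bi_eq_d_right[OF \<xi>0])
    then have "bi_eq 1 3 (d_right 1 2 (d_up 0 \<xi>)) (\<lambda>_ _. 0)"
      unfolding d_right_zero by (simp add: numeral_3_eq_3 numeral_2_eq_2)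
    from bi_eq_lin[OF this bi_eq_refl[of 1 3 "\<lambda>_ _. 0"], of "-1" 0]
    have "bi_eq 1 3 (d_up 0 (d_right 0 2 \<xi>)) (\<lambda>_ _. 0)"
      by (simp add: d_up_d_right)
    ultimately show ?thesis by (rule bi_eq_trans)
  qed
  then have "F \<in> E1_cocycles 0 3" using Fb by (simp add: E1_cocycles_def)
  moreover have "\<xi> \<in> E1_cocycles 0 2" using \<xi>b \<xi>0 by (simp add: E1_cocycles_def)
  moreover have "(\<lambda>x y. F x y - d_right 0 2 \<xi> x y) \<in> E1_coboundaries 0 3"
  proof -
    have "(\<lambda>x y. F x y - d_right 0 2 \<xi> x y) \<in> bicochains 0 3"
      using bicochains_lin[OF Fb d\<xi>b, of 1 "-1"] by simp
    moreover have "bi_eq 0 3 (\<lambda>x y. F x y - d_right 0 2 \<xi> x y) (\<lambda>_ _. 0)"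
      using bi_eq_lin[OF bi_eq_refl[of 0 3 F] d\<xi>, of 1 "-1"] by simp
    ultimately show ?thesis by (simp add: E1_coboundaries_def)
  qed
  ultimately have "F \<in> E2_coboundaries 0 (Suc 2)"
    unfolding E2_coboundaries_def nat.case by auto
  from E2_class_eq[OF this[unfolded F_def]] show ?thesis by (simp add: numeral_3_eq_3)
qed

text \<open>All admissible choices give the same class, and the zigzag exhibits one of them; without
  it the union defining \<open>d2\<close> could be empty.\<close>

lemma d2_form_to_E2:
  assumes \<phi>: "\<phi> \<in> lie_a_dual_w0"
  shows "d2 0 1 (form_to_E2 \<phi>) = E2_class 0 3 (\<lambda>_. s_cochain \<phi>)"
proof -
  let ?C = "{E2_class 0 3 (d_right 0 2 \<gamma>\<^sub>1) | \<gamma>\<^sub>0 \<gamma>\<^sub>1. \<gamma>\<^sub>0 \<in> form_to_E2 \<phi> \<and> \<gamma>\<^sub>1 \<in> bicochains 0 2 \<and>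
     bi_eq 1 2 (d_right 1 1 \<gamma>\<^sub>0) (d_up 0 \<gamma>\<^sub>1)}"
  have n: "(1::nat) + 2 = 3" "(1::nat) + 1 = 2" "(0::nat) + 1 = 1" by simp_all
  have "d2 0 1 (form_to_E2 \<phi>) = \<Union> ?C"
    unfolding d2_def n ..
  moreover have "form_bicochain \<phi> \<in> form_to_E2 \<phi>"
    using E2_class_self[OF form_bicochain_E2_cocycle[OF \<phi>]] by (simp add: form_to_E2_def)
  then have "E2_class 0 3 (d_right 0 2 (zigzag (form_coeff \<phi>))) \<in> ?C"
    using zigzag_bicochain bi_eq_d_up_zigzag[OF \<phi>] by blast
  then have "?C \<noteq> {}" by blast
  moreover have "c = E2_class 0 3 (\<lambda>_. s_cochain \<phi>)" if "c \<in> ?C" for c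
    using that d2_representative[OF \<phi>] by blast
  ultimately show ?thesis by blast
qed

lemma H2_to_E2_s_cochain:
  "H2_to_E2 (cohom_class flag_act flag_measure 2 (s_cochain \<phi>)) = E2_class 0 3 (\<lambda>_. s_cochain \<phi>)"
proof -
  let ?c = "cohom_class flag_act flag_measure 2 (s_cochain \<phi>)"
  have eq: "E2_class 0 3 (\<lambda>_. f) = E2_class 0 3 (\<lambda>_. s_cochain \<phi>)" if "f \<in> ?c" for f
  proof -
    let ?d = "\<lambda>y. f y - s_cochain \<phi> y"
    have e: "Suc 2 = 3" by simp
    have "?d \<in> coboundaries flag_act flag_measure 2"
      using that by (simp add: cohom_class_def)
    then obtain h where h: "h \<in> L0_inv flag_act flag_measure 2" "AE y in pow_measure flag_measure 3. ?d y = hdiff 2 h y"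
      and d: "?d \<in> L0_inv flag_act flag_measure 3"
      unfolding coboundaries_def e by auto
    \<comment> \<open>The sign of \<open>d_right\<close> for \<open>p = 0\<close> makes
      \<open>- h\<close> the primitive; the summand \<open>0 * h y\<close> brings it into the shape
      of \<open>E1_cocycles_lin\<close>.\<close>
    have hE: "(\<lambda>_ y. - 1 * h y + 0 * h y) \<in> E1_cocycles 0 2"
      by (rule E1_cocycles_lin[OF const_E1_cocycles const_E1_cocycles]) (rule h(1))+
    have dE: "(\<lambda>_. ?d) \<in> E1_cocycles 0 3" by (rule const_E1_cocycles[OF d])
    have "d_right 0 2 (\<lambda>_ y. - 1 * h y + 0 * h y) = (\<lambda>_ y. hdiff 2 h y)"
      by (simp add: d_right_def fun_eq_iff hdiff_2)
    moreover have "bi_eq 0 3 (\<lambda>_. ?d) (\<lambda>_ y. hdiff 2 h y)"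
      using h(2) by (simp add: bi_eq_def)
    ultimately have "bi_eq 0 3 (\<lambda>_. ?d) (d_right 0 2 (\<lambda>_ y. - 1 * h y + 0 * h y))" by (simp only:)
    from bi_eq_lin[OF this bi_eq_refl[of 0 3 "d_right 0 2 (\<lambda>_ y. - 1 * h y + 0 * h y)"], of 1 "-1"]
    have "bi_eq 0 3 (\<lambda>x y. ?d y - d_right 0 2 (\<lambda>_ y. - 1 * h y + 0 * h y) x y) (\<lambda>_ _. 0)" by simp
    moreover have "(\<lambda>x y. ?d y - d_right 0 2 (\<lambda>_ y. - 1 * h y + 0 * h y) x y) \<in> bicochains 0 3"
    proof -
      have "d_right 0 2 (\<lambda>_ y. - 1 * h y + 0 * h y) \<in> bicochains 0 (Suc 2)"
        using hE by (intro d_right_bicochains) (simp add: E1_cocycles_def)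
      then have "d_right 0 2 (\<lambda>_ y. - 1 * h y + 0 * h y) \<in> bicochains 0 3" by simp
      from bicochains_lin[OF _ this, of "\<lambda>_. ?d" 1 "-1"] dE show ?thesis by (simp add: E1_cocycles_def)
    qed
    ultimately have "(\<lambda>x y. ?d y - d_right 0 2 (\<lambda>_ y. - 1 * h y + 0 * h y) x y) \<in> E1_coboundaries 0 3"
      by (simp add: E1_coboundaries_def)
    from this hE have "\<exists>\<zeta>\<in>E1_cocycles 0 2. (\<lambda>x y. ?d y - d_right 0 2 \<zeta> x y) \<in> E1_coboundaries 0 3" by (rule bexI)
    then have "(\<lambda>_. ?d) \<in> E2_coboundaries 0 (Suc 2)"
      using dE by (simp add: E2_coboundaries_def)
    then have "E2_class 0 (Suc 2) (\<lambda>_. f) = E2_class 0 (Suc 2) (\<lambda>_. s_cochain \<phi>)"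
      by (rule E2_class_eq)
    then show ?thesis by simp
  qed
  moreover have "s_cochain \<phi> \<in> ?c"
    using cohom_class_self[of "s_cochain \<phi>" flag_act flag_measure "Suc 0"] s_cochain_cocycle[of \<phi>]
    unfolding numeral_2_eq_2 by blast
  ultimately show ?thesis
    unfolding H2_to_E2_def by blast
qed

subsection \<open>Invariant functions of pairs of flags are constant\<close>

lemma generic_pair_standard:
  assumes F: "F0 \<in> flags" "F1 \<in> (flags :: 'k::rc_field flag set)" and nz: "incid F0 F1 \<noteq> 0" "incid F1 F0 \<noteq> 0"
  shows "\<exists>g\<in>SL3. F0 = flag_act g std_flag \<and> F1 = flag_act g (flag_act w0 std_flag)"
proof -
  let ?f0 = "fcov F0" and ?f1 = "fcov F1" and ?v0 = "fpoint F0" and ?v1 = "fpoint F1"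
  \<comment> \<open>The intersection of the two lines. The points and this vector form a basis: with
    \<open>?v0\<close> it spans the line of \<open>F0\<close>, with \<open>?v1\<close> the line of
    \<open>F1\<close>, while \<open>w0\<close> exchanges the outer basis vectors up to sign.\<close>
  define e where "e = crossk ?f0 ?f1"
  define r where "r = inverse (pairing (crossk ?v0 e) ?v1)"
  define g where "g = colmat ?v0 e (r *s ?v1)"
  have self: "pairing ?f0 ?v0 = 0" "pairing ?f1 ?v1 = 0" using F by (auto intro: flag_eqs(5) simp del: fst_conv)
  have triple: "crossk v (crossk a b) = pairing b v *s a - pairing a v *s b" for v a b :: "'k^3"
    by (simp add: vec_eq_iff forall_3 pairing_3 algebra_simps)
  have c0: "crossk ?v0 e = pairing ?f1 ?v0 *s ?f0" and c1: "crossk ?v1 e = - (pairing ?f0 ?v1 *s ?f1)"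
    unfolding e_def triple by (simp_all add: self)
  have n: "pairing ?f0 ?v1 \<noteq> 0" "pairing ?f1 ?v0 \<noteq> 0" using nz by (auto simp: incid_def)
  have r: "r \<noteq> 0" "r * pairing (crossk ?v0 e) ?v1 = 1"
  proof -
    have "pairing (crossk ?v0 e) ?v1 \<noteq> 0" using n by (simp add: c0)
    then show "r \<noteq> 0" "r * pairing (crossk ?v0 e) ?v1 = 1" by (simp_all add: r_def)
  qed
  have g: "g \<in> SL3" using r(2) by (simp add: g_def SL3_def det_colmat)
  have "F0 = flag_act g std_flag"
  proof (rule prod_eqI)
    show "fst F0 = fst (flag_act g std_flag)"
      by (simp add: fst_flag_act_std g_def flag_eqs(3)[OF F(1)])
    show "snd F0 = snd (flag_act g std_flag)"
      using n by (simp add: snd_flag_act_std SL3_det_nz[OF g] flag_eqs(4)[OF F(1)]) (simp add: g_def c0)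
  qed
  moreover have "F1 = flag_act (g ** w0) std_flag"
  proof (rule prod_eqI)
    have gw: "g ** w0 \<in> SL3" by (rule SL3_mult[OF g w0_SL3])
    have w: "column 1 w0 = axis 3 (1::'k)" "column 2 w0 = axis 2 (1::'k)"
      by (simp_all add: w0_def column_def vec_eq_iff forall_3 axis_def)
    have col: "column 1 (g ** w0) = r *s ?v1" "column 2 (g ** w0) = e"
      unfolding column_mult w mult_axis by (simp_all add: g_def)
    then show "fst F1 = fst (flag_act (g ** w0) std_flag)"
      using range_scale_scale[OF r(1), of ?v1] by (simp add: fst_flag_act_std flag_eqs(3)[OF F(2)])
    have "covec (g ** w0) = r *s crossk ?v1 e"
      unfolding covec_def col by (simp add: vec_eq_iff forall_3 algebra_simps)
    then show "snd F1 = snd (flag_act (g ** w0) std_flag)"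
      using n r(1) by (simp add: snd_flag_act_std SL3_det_nz[OF gw] flag_eqs(4)[OF F(2)] c1)
  qed
  ultimately show ?thesis using g by (auto simp: flag_act_mult)
qed

lemma generic_pair_transitive:
  assumes "F0 \<in> flags" "F1 \<in> flags" "incid F0 F1 \<noteq> 0" "incid F1 F0 \<noteq> 0"
    and "G0 \<in> flags" "G1 \<in> flags" "incid G0 G1 \<noteq> 0" "incid G1 G0 \<noteq> 0"
  shows "\<exists>a\<in>SL3. G0 = flag_act a F0 \<and> G1 = flag_act a (F1 :: 'k::rc_field flag)"
proof -
  obtain g h where g: "g \<in> SL3" "F0 = flag_act g std_flag" "F1 = flag_act g (flag_act w0 std_flag)"
    and h: "h \<in> SL3" "G0 = flag_act h std_flag" "G1 = flag_act h (flag_act w0 std_flag)"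
    using generic_pair_standard[OF assms(1-4)] generic_pair_standard[OF assms(5-8)] by blast
  then show ?thesis
    by (intro bexI[of _ "h ** matrix_inv g"])
       (simp_all add: flag_act_mult SL3_mult SL3_inv flip: flag_act_mult[of "matrix_inv g" g])
qed

text \<open>Transitivity on generic pairs is not enough at once, since the null set where invariance
  fails varies with the group element. By Fubini almost every pair has the same value as almost all
  of its translates; two such pairs are compared at a common translate.\<close>

lemma L0_inv_pair_const:
  assumes k: "k \<in> L0_inv flag_act (flag_measure :: 'k::rc_field flag measure) 2"
  shows "\<exists>c. AE y in pow_measure flag_measure 2. k y = c"
proof -
  let ?H = "haar :: ('k^3^3) measure"
  let ?p = "map_pow 2 (\<lambda>g. flag_act g std_flag :: 'k flag)"
  define K where "K x = k (?p x)" for x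
  have KL: "K \<in> L0_inv (**) ?H 2" unfolding K_def by (rule L0_inv_pullback[OF k])
  then have Km: "K \<in> borel_measurable (pow_measure ?H 2)" by (simp add: L0_inv_def)
  interpret P: pair_sigma_finite ?H "pow_measure ?H 2" by (rule haar.pair_pow)
  have tm: "(\<lambda>z. translate (**) 2 (fst z) (snd z)) \<in> ?H \<Otimes>\<^sub>M pow_measure ?H 2 \<rightarrow>\<^sub>M pow_measure ?H 2"
    unfolding translate_def
  proof (rule measurable_restrict)
    fix i :: nat assume i: "i \<in> {..<2}"
    have "(\<lambda>z. (fst z, snd z i)) \<in> ?H \<Otimes>\<^sub>M pow_measure ?H 2 \<rightarrow>\<^sub>M ?H \<Otimes>\<^sub>M ?H"
      using i by (intro measurable_Pair measurable_fst measurable_compose[OF measurable_snd flag_component]) simp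
    from measurable_compose[OF this haar_mult]
    show "(\<lambda>z. fst z ** snd z i) \<in> ?H \<Otimes>\<^sub>M pow_measure ?H 2 \<rightarrow>\<^sub>M ?H" by simp
  qed
  have "AE g in ?H. AE x in pow_measure ?H 2. K (translate (**) 2 g x) = K x"
    by (rule AE_I2) (use KL in \<open>simp add: L0_inv_def\<close>)
  moreover have "{z \<in> space (?H \<Otimes>\<^sub>M pow_measure ?H 2). K (translate (**) 2 (fst z) (snd z)) = K (snd z)} \<in> sets (?H \<Otimes>\<^sub>M pow_measure ?H 2)"
    by (rule borel_measurable_eq[OF measurable_compose[OF tm Km] measurable_compose[OF measurable_snd Km]])
  ultimately have good: "AE x in pow_measure ?H 2. AE g in ?H. K (translate (**) 2 g x) = K x"
    by (subst (asm) P.AE_commute) auto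
  define Good where "Good x \<longleftrightarrow> (AE g in ?H. K (translate (**) 2 g x) = K x) \<and> x \<in> space (pow_measure ?H 2) \<and>
     incid (?p x 0) (?p x 1) \<noteq> 0 \<and> incid (?p x 1) (?p x 0) \<noteq> 0" for x
  have "AE y in pow_measure (flag_measure :: 'k flag measure) 2. incid (y 0) (y 1) \<noteq> 0"
     "AE y in pow_measure (flag_measure :: 'k flag measure) 2. incid (y 1) (y 0) \<noteq> 0"
    by (rule AE_pow_incid; simp)+
  from good AE_pow_flagD[OF this(1)] AE_pow_flagD[OF this(2)] AE_space
  have AEGood: "AE x in pow_measure ?H 2. Good x"
    unfolding Good_def by eventually_elim simp
  have const: "K x = K x'" if "Good x" "Good x'" for x x'
  proof -
    have sp: "x \<in> space (pow_measure ?H 2)" "x' \<in> space (pow_measure ?H 2)" using that by (auto simp: Good_def)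
    have fl: "?p x 0 \<in> flags" "?p x 1 \<in> flags" "?p x' 0 \<in> flags" "?p x' 1 \<in> flags"
      using space_pow_haar[OF sp(1)] space_pow_haar[OF sp(2)] by (auto simp: map_pow_def flag_act_std_in SL3_det_nz)
    have nz: "incid (?p x 0) (?p x 1) \<noteq> 0" "incid (?p x 1) (?p x 0) \<noteq> 0"
      "incid (?p x' 0) (?p x' 1) \<noteq> 0" "incid (?p x' 1) (?p x' 0) \<noteq> 0"
      using that unfolding Good_def by simp_all
    obtain a where a: "a \<in> SL3" "?p x' 0 = flag_act a (?p x 0)" "?p x' 1 = flag_act a (?p x 1)"
      using generic_pair_transitive[OF fl(1,2) nz(1,2) fl(3,4) nz(3,4)] by blast
    have tr: "?p (translate (**) 2 g x') = ?p (translate (**) 2 (g ** a) x)" for g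
    proof
      fix i :: nat
      have "i = 0 \<or> i = 1 \<or> \<not> i < 2" by auto
      then show "?p (translate (**) 2 g x') i = ?p (translate (**) 2 (g ** a) x) i"
        using a(2,3) by (auto simp: map_pow_def translate_def flag_act_mult)
    qed
    have "AE g in ?H. K (translate (**) 2 g x) = K x" "AE g in ?H. K (translate (**) 2 g x') = K x'"
      using that by (auto simp: Good_def)
    \<comment> \<open>Right translation of null sets allows \<open>g ** a\<close> in place of
      \<open>g\<close> in the statement for \<open>x\<close>, and there the translates of
      \<open>x\<close> and of \<open>x'\<close> give the same pair of flags.\<close>
    with AE_haar_right[OF this(1) a(1)]
    have "AE g in ?H. K x = K x'"
      by eventually_elim (simp add: K_def tr)
    then show ?thesis using AE_haar_ex by blast
  qed
  have "\<exists>c. \<forall>x. Good x \<longrightarrow> K x = c"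
    by (metis const)
  then obtain c where c: "\<And>x. Good x \<Longrightarrow> K x = c" by blast
  have "AE x in pow_measure ?H 2. k (?p x) = c"
    using AEGood by eventually_elim (use c in \<open>simp add: K_def\<close>)
  moreover have "Measurable.pred (pow_measure flag_measure 2) (\<lambda>y. k y = c)"
    unfolding pred_def by (rule borel_measurable_eq) (use k in \<open>auto simp: L0_inv_def\<close>)
  ultimately have "AE y in pow_measure flag_measure 2. k y = c"
    using AE_pow_flag_iff[where n = 2 and P = "\<lambda>y. k y = c"] by blast
  then show ?thesis ..
qed

lemma skip_1_eq: "skip (Suc 0) 0 x = (\<lambda>i\<in>{..<Suc 0}. x 1)" "skip (Suc 0) (Suc 0) x = (\<lambda>i\<in>{..<Suc 0}. x 0)"
  by (auto simp: skip_def fun_eq_iff)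

text \<open>Closed under \<open>d_up\<close> in degree 0 means independent of the group variable
  almost everywhere. Freezing that variable leaves an invariant function of pairs of flags.\<close>

lemma E1_cocycle_const:
  fixes \<zeta> :: "'k::rc_field bicochain"
  assumes z: "\<zeta> \<in> E1_cocycles 0 2"
  shows "\<exists>c. bi_eq 0 2 \<zeta> (\<lambda>_ _. c)"
proof -
  let ?F = "pow_measure (flag_measure :: 'k flag measure) 2" and ?H = "haar :: ('k^3^3) measure"
  let ?e = "\<lambda>a::'k^3^3. \<lambda>i\<in>{..<Suc 0}. a"
  have zm: "case_prod \<zeta> \<in> borel_measurable (pow_measure ?H (Suc 0) \<Otimes>\<^sub>M ?F)"
    and zi: "\<And>g. g \<in> SL3 \<Longrightarrow> bi_eq 0 2 (bitranslate 0 2 g \<zeta>) \<zeta>"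
    and zd: "bi_eq (Suc 0) 2 (d_up 0 \<zeta>) (\<lambda>_ _. 0)"
    using z by (auto simp: E1_cocycles_def bicochains_iff)
  have "AE x in pow_measure ?H 2. AE y in ?F. \<zeta> (?e (x 1)) y = \<zeta> (?e (x 0)) y"
    using zd unfolding bi_eq_def d_up_def hdiff_1 skip_1_eq numeral_2_eq_2 by simp
  \<comment> \<open>A group element \<open>a\<close> that agrees with almost every other; the
    function at \<open>a\<close> serves as representative.\<close>
  from haar.AE_pow_2D[of "\<lambda>a b. AE y in ?F. \<zeta> (?e b) y = \<zeta> (?e a) y", OF this]
  obtain a where a: "a \<in> SL3" "AE b in ?H. AE y in ?F. \<zeta> (?e b) y = \<zeta> (?e a) y"
    using AE_haar_ex by blast
  define k where "k = \<zeta> (?e a)"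
  have "AE x in pow_measure ?H (Suc 0). AE y in ?F. \<zeta> (?e (x 0)) y = k y"
    using a(2) unfolding k_def by (simp only: haar.AE_pow_1[of "\<lambda>b. AE y in ?F. \<zeta> (?e b) y = \<zeta> (?e a) y"])
  then have zk: "AE x in pow_measure ?H (Suc 0). AE y in ?F. \<zeta> x y = k y"
    using AE_space
  proof eventually_elim
    case (elim x)
    have "?e (x 0) = x"
      using elim(2) by (auto simp: space_PiM PiE_def extensional_def fun_eq_iff)
    then show ?case using elim(1) by simp
  qed
  have "k \<in> L0_inv flag_act flag_measure 2"
    unfolding L0_inv_def
  proof (intro CollectI conjI ballI)
    have "?e a \<in> space (pow_measure ?H (Suc 0))" using a(1) by (auto simp: space_PiM)
    from measurable_Pair2[OF zm this] show "k \<in> borel_measurable ?F" by (simp add: k_def)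
    fix g :: "'k^3^3" assume g: "g \<in> SL3"
    have "AE x in pow_measure ?H (Suc 0). AE y in ?F. \<zeta> (translate (**) (Suc 0) g x) y = k y"
      by (rule AE_pow_haar_translate[OF g zk])
    then have "AE x in pow_measure ?H (Suc 0). AE y in ?F. \<zeta> (translate (**) (Suc 0) g x) (translate flag_act 2 g y) = k (translate flag_act 2 g y)"
      by (rule eventually_mono) (rule AE_pow_flag_translate[OF g])
    moreover have "AE x in pow_measure ?H (Suc 0). AE y in ?F. \<zeta> (translate (**) (Suc 0) g x) (translate flag_act 2 g y) = \<zeta> x y"
      using zi[OF g] by (simp add: bi_eq_def bitranslate_def)
    ultimately have "AE x in pow_measure ?H (Suc 0). AE y in ?F. k (translate flag_act 2 g y) = k y"
      using zk
    proof eventually_elim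
      case (elim x)
      then show ?case by eventually_elim simp
    qed
    then show "AE y in ?F. k (translate flag_act 2 g y) = k y"
      by (simp only: AE_const_pow_haar)
  qed
  then obtain c where c: "AE y in ?F. k y = c" using L0_inv_pair_const by blast
  have "AE x in pow_measure ?H (Suc 0). AE y in ?F. \<zeta> x y = c"
    using zk
  proof eventually_elim
    case (elim x)
    then show ?case using c by eventually_elim simp
  qed
  then show ?thesis unfolding bi_eq_def by blast
qed

subsection \<open>The triple ratio is not constant\<close>

text \<open>Separate continuity suffices: the almost-everywhere quantifiers are removed one at a
  time, from the innermost outwards, because \<open>haar\<close> charges open sets.\<close>

lemma continuous_triple_AE:
  fixes A :: "'k::rc_field^3^3 \<Rightarrow> 'k^3^3 \<Rightarrow> 'k^3^3 \<Rightarrow> real"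
  assumes A: "\<And>b c. continuous_on UNIV (\<lambda>a. A a b c)" "\<And>a c. continuous_on UNIV (\<lambda>b. A a b c)" "\<And>a b. continuous_on UNIV (\<lambda>c. A a b c)"
    and AE: "AE a in haar. AE b in haar. AE c in haar. A a b c = 0" and abc: "a \<in> SL3" "b \<in> SL3" "c \<in> SL3"
  shows "A a b c = 0"
proof -
  have "AE a in haar. AE b in haar. \<forall>c\<in>SL3. A a b c = 0"
    using AE
  proof eventually_elim
    case (elim a)
    then show ?case
    proof eventually_elim
      case (elim b)
      then show ?case using AE_haar_continuous[OF A(3)] by blast
    qed
  qed
  then have "AE a in haar. \<forall>b\<in>SL3. \<forall>c\<in>SL3. A a b c = 0"
  proof eventually_elim
    case (elim a)
    show ?case
    proof (intro ballI)
      fix b c :: "'k^3^3" assume "b \<in> SL3" "c \<in> SL3"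
      have "AE b in haar. A a b c = 0"
        using elim by (rule eventually_mono) (use \<open>c \<in> SL3\<close> in blast)
      then show "A a b c = 0" using AE_haar_continuous[OF A(2)] \<open>b \<in> SL3\<close> by blast
    qed
  qed
  then have "AE a in haar. A a b c = 0"
    by (rule eventually_mono) (use abc in blast)
  then show ?thesis using AE_haar_continuous[OF A(1)] abc(1) by blast
qed

text \<open>If the coefficients differed, |\<tau>| would be the constant exp(C/d) almost everywhere.
  With denominators cleared this is the vanishing of the continuous function \<open>A\<close>, which
  therefore holds on all of \<open>SL3\<close> and can be tested at explicit matrices.\<close>

lemma s_cochain_diff_const:
  fixes \<phi> \<psi> :: "'k::rc_field^3^3 \<Rightarrow> real"
  assumes AE: "AE y in pow_measure (flag_measure :: 'k flag measure) 3. s_cochain \<phi> y - s_cochain \<psi> y = C"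
  shows "form_coeff \<phi> = form_coeff \<psi>"
proof (rule ccontr)
  assume neq: "form_coeff \<phi> \<noteq> form_coeff \<psi>"
  define d where "d = form_coeff \<phi> - form_coeff \<psi>"
  have d: "d \<noteq> 0" using neq by (simp add: d_def)
  let ?D = "\<lambda>g h :: 'k^3^3. norm (pairing (covec g) (column 1 h))"
  define A where "A a b c = ?D a b * ?D b c * ?D c a - exp (C / d) * (?D b a * ?D c b * ?D a c)" for a b c
  have "AE x in pow_measure haar 3. A (x 0) (x 1) (x 2) = 0"
    using AE_pow_flagD[OF AE] AE_pow_flagD[OF AE_generic3] AE_space
  proof eventually_elim
    case (elim x)
    have x: "x i \<in> SL3" if "i < 3" for i using space_pow_haar[OF elim(3) that] .
    have x012: "x 0 \<in> SL3" "x 1 \<in> SL3" "x 2 \<in> SL3" using x by auto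
    have pos: "?D (x 0) (x 1) > 0" "?D (x 1) (x 0) > 0" "?D (x 0) (x 2) > 0" "?D (x 2) (x 0) > 0" "?D (x 1) (x 2) > 0" "?D (x 2) (x 1) > 0"
      using elim(2) incid_std[OF x012(1,2)] incid_std[OF x012(2,1)] incid_std[OF x012(1,3)] incid_std[OF x012(3,1)]
        incid_std[OF x012(2,3)] incid_std[OF x012(3,2)]
      unfolding generic3_def by (simp_all add: map_pow_def)
    have "d * (lnD (x 0) (x 1) + lnD (x 1) (x 2) + lnD (x 2) (x 0)) = C"
    proof -
      have "s_cochain \<theta> (map_pow 3 (\<lambda>g. flag_act g std_flag) x)
          = form_coeff \<theta> * (lnD (x 0) (x 1) + lnD (x 1) (x 2) + lnD (x 2) (x 0))" for \<theta> :: "'k^3^3 \<Rightarrow> real"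
        by (rule s_cochain_std[OF _ elim(2)]) (rule x)
      then show ?thesis
        using elim(1) by (simp only: d_def left_diff_distrib)
    qed
    then have "lnD (x 0) (x 1) + lnD (x 1) (x 2) + lnD (x 2) (x 0) = C / d"
      using d by (simp add: field_simps)
    moreover have "lnD (x 0) (x 1) + lnD (x 1) (x 2) + lnD (x 2) (x 0) =
      ln ((?D (x 0) (x 1) * ?D (x 1) (x 2) * ?D (x 2) (x 0)) / (?D (x 1) (x 0) * ?D (x 2) (x 1) * ?D (x 0) (x 2)))"
      using pos by (simp add: lnD_def ln_mult ln_div)
    ultimately have "(?D (x 0) (x 1) * ?D (x 1) (x 2) * ?D (x 2) (x 0)) / (?D (x 1) (x 0) * ?D (x 2) (x 1) * ?D (x 0) (x 2)) = exp (C / d)"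
      using pos by (metis exp_ln divide_pos_pos mult_pos_pos)
    then show ?case
      using pos by (simp add: A_def field_simps)
  qed
  then have "AE a in haar. AE b in haar. AE c in haar. A a b c = 0"
    by (rule haar.AE_pow_3D)
  note zero = continuous_triple_AE[OF _ _ _ this]
  have A0: "A a b c = 0" if "a \<in> SL3" "b \<in> SL3" "c \<in> SL3" for a b c
    by (rule zero[OF _ _ _ that]) (unfold A_def, (intro continuous_intros)+)
  \<comment> \<open>A flag with covector (-2,3,-1), chosen so that the triple \<open>mat 1\<close>,
    \<open>w0\<close>, \<open>c\<close> has |\<tau>| = 2. Exchanging the first two flags gives 1/2,
    and both values would have to equal exp(C/d).\<close>
  define c :: "'k^3^3" where "c = colmat (vector [1, 1, 1]) (vector [1, 0, -2]) (vector [0, 0, -1])"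
  have c: "c \<in> SL3" by (simp add: c_def SL3_def det_colmat pairing_3)
  have cols: "column 1 (mat 1 :: 'k^3^3) = vector [1, 0, 0]" "column 2 (mat 1 :: 'k^3^3) = vector [0, 1, 0]"
    "column 1 (w0 :: 'k^3^3) = vector [0, 0, 1]" "column 2 (w0 :: 'k^3^3) = vector [0, 1, 0]"
    "column 1 c = vector [1, 1, 1]" "column 2 c = vector [1, 0, -2]"
    by (simp_all add: column_def mat_def w0_def vec_eq_iff forall_3 c_def colmat_def)
  have D: "?D (mat 1) w0 = 1" "?D w0 (mat 1) = 1" "?D (mat 1) c = 1" "?D c (mat 1) = 2" "?D w0 c = 1" "?D c w0 = 1"
    unfolding covec_def cols by (simp_all add: pairing_3)
  have "A (mat 1) w0 c = 0" "A w0 (mat 1) c = 0"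
    using A0 one_SL3 w0_SL3 c by blast+
  then show False unfolding A_def D by simp
qed

subsection \<open>Recovering the form\<close>

lemma s_cochain_E2_cocycle: "(\<lambda>_. s_cochain \<phi>) \<in> E2_cocycles 0 (Suc 2)"
proof -
  have e: "Suc 2 = 3" by simp
  have E: "(\<lambda>_. s_cochain \<phi>) \<in> E1_cocycles 0 3" by (rule const_E1_cocycles[OF s_cochain_L0_inv])
  have "AE y in pow_measure flag_measure (Suc 3). hdiff 3 (s_cochain \<phi>) y = 0"
    using s_cochain_cocycle[of \<phi>] unfolding cocycles_def e by blast
  then have *: "AE y in pow_measure flag_measure (Suc 3). d_right 0 3 (\<lambda>_. s_cochain \<phi>) x y = 0" for x
    by (rule eventually_mono) (simp only: d_right_def mult_zero_right)
  have "bi_eq 0 (Suc 3) (d_right 0 3 (\<lambda>_. s_cochain \<phi>)) (\<lambda>_ _. 0)"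
    unfolding bi_eq_def by (rule AE_I2) (rule *)
  moreover have "d_right 0 3 (\<lambda>_. s_cochain \<phi>) \<in> bicochains 0 (Suc 3)"
    using E by (intro d_right_bicochains) (simp add: E1_cocycles_def)
  ultimately show ?thesis
    unfolding e E2_cocycles_def using E by (simp add: E1_coboundaries_def)
qed

text \<open>The difference of two cochains with the same class is \<open>d_right\<close> of an
  almost everywhere constant function \<open>c\<close>. Three alternating terms and the sign for
  \<open>p = 0\<close> make this \<open>- c\<close>, so the difference is constant.\<close>

lemma E2_class_s_cochain_inj:
  fixes \<phi> \<psi> :: "'k::rc_field^3^3 \<Rightarrow> real"
  assumes "E2_class 0 3 (\<lambda>_. s_cochain \<phi>) = E2_class 0 3 (\<lambda>_. s_cochain \<psi>)"
  shows "form_coeff \<phi> = form_coeff \<psi>"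
proof -
  have e: "Suc 2 = 3" by simp
  have "(\<lambda>_. s_cochain \<phi>) \<in> E2_class 0 (Suc 2) (\<lambda>_. s_cochain \<psi>)"
    using E2_class_self[OF s_cochain_E2_cocycle[of \<phi>]] assms unfolding e by blast
  then have "(\<lambda>_ y. s_cochain \<phi> y - s_cochain \<psi> y) \<in> E2_coboundaries 0 (Suc 2)"
    by (simp add: E2_class_def)
  then obtain \<zeta> where z: "\<zeta> \<in> E1_cocycles 0 2"
    "(\<lambda>x y. (s_cochain \<phi> y - s_cochain \<psi> y) - d_right 0 2 \<zeta> x y) \<in> E1_coboundaries 0 (Suc 2)"
    unfolding E2_coboundaries_def nat.case by blast
  obtain c where c: "bi_eq 0 2 \<zeta> (\<lambda>_ _. c)" using E1_cocycle_const[OF z(1)] by blast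
  have "bi_eq 0 (Suc 2) (\<lambda>x y. (s_cochain \<phi> y - s_cochain \<psi> y) - d_right 0 2 \<zeta> x y) (\<lambda>_ _. 0)"
    using z(2) by (simp add: E1_coboundaries_def)
  with bi_eq_d_right[OF c] have "AE x in pow_measure (haar :: ('k^3^3) measure) (Suc 0).
      AE y in pow_measure flag_measure 3. s_cochain \<phi> y - s_cochain \<psi> y = - c"
    unfolding bi_eq_def e
  proof eventually_elim
    case (elim x)
    then show ?case
      by eventually_elim (simp add: d_right_def hdiff_2)
  qed
  then have "AE y in pow_measure flag_measure 3. s_cochain \<phi> y - s_cochain \<psi> y = - c"
    by (simp only: AE_const_pow_haar)
  then show ?thesis by (rule s_cochain_diff_const)
qed

text \<open>The definite description asks for two things: the zigzag shows that
  \<open>\<alpha>\<close> satisfies the equation, and injectivity on classes shows that no other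
  form does, a form being determined by its coefficient.\<close>

lemma q_map_s_cochain:
  fixes \<alpha> :: "'k::rc_field^3^3 \<Rightarrow> real"
  assumes \<alpha>: "\<alpha> \<in> lie_a_dual_w0"
  shows "q_map (cohom_class flag_act flag_measure 2 (s_cochain \<alpha>)) = \<alpha>"
  unfolding q_map_def
proof (rule the_equality)
  show "\<alpha> \<in> lie_a_dual_w0 \<and> d2 0 1 (form_to_E2 \<alpha>) = H2_to_E2 (cohom_class flag_act flag_measure 2 (s_cochain \<alpha>))"
    by (simp only: \<alpha> d2_form_to_E2[OF \<alpha>] H2_to_E2_s_cochain)
  fix \<phi> :: "'k^3^3 \<Rightarrow> real"
  assume "\<phi> \<in> lie_a_dual_w0 \<and> d2 0 1 (form_to_E2 \<phi>) = H2_to_E2 (cohom_class flag_act flag_measure 2 (s_cochain \<alpha>))"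
  then have \<phi>: "\<phi> \<in> lie_a_dual_w0"
    and d: "d2 0 1 (form_to_E2 \<phi>) = E2_class 0 3 (\<lambda>_. s_cochain \<alpha>)"
    by (simp_all only: H2_to_E2_s_cochain)
  have "E2_class 0 3 (\<lambda>_. s_cochain \<phi>) = E2_class 0 3 (\<lambda>_. s_cochain \<alpha>)"
    using d unfolding d2_form_to_E2[OF \<phi>] .
  then have "form_coeff \<phi> = form_coeff \<alpha>" by (intro E2_class_s_cochain_inj)
  then show "\<phi> = \<alpha>"
    using lie_a_dual_w0_form[OF \<phi>] lie_a_dual_w0_form[OF \<alpha>] by simp
qed

lemma triple_ratio_section:
  "(AE F in pow_measure (flag_measure :: 'k::rc_field flag measure) 3.
      general_position 3 F \<and> triple_ratio (F 0) (F 1) (F 2) \<noteq> 0) \<and>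
   (\<forall>\<alpha> \<in> (lie_a_dual_w0 :: ('k^3^3 \<Rightarrow> real) set).
      s_cochain \<alpha> \<in> cocycles flag_act flag_measure 2 \<and>
      alternating 3 flags (s_cochain \<alpha>) \<and>
      cohom_class flag_act flag_measure 2 (s_cochain \<alpha>) \<in> NHm 2 \<and>
      q_map (cohom_class flag_act flag_measure 2 (s_cochain \<alpha>)) = \<alpha>)"
  using AE_triple_ratio s_cochain_cocycle alternating_s_cochain s_cochain_NHm q_map_s_cochain by blast

theorem theorem4:
  shows "((AE F in pow_measure (flag_measure :: real flag measure) 3.
             general_position 3 F \<and> triple_ratio (F 0) (F 1) (F 2) \<noteq> 0) \<and>
          (\<forall>\<alpha> \<in> (lie_a_dual_w0 :: (real^3^3 \<Rightarrow> real) set).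
             s_cochain \<alpha> \<in> cocycles flag_act flag_measure 2 \<and>
             alternating 3 flags (s_cochain \<alpha>) \<and>
             cohom_class flag_act flag_measure 2 (s_cochain \<alpha>) \<in> NHm 2 \<and>
             q_map (cohom_class flag_act flag_measure 2 (s_cochain \<alpha>)) = \<alpha>)) \<and>
         ((AE F in pow_measure (flag_measure :: complex flag measure) 3.
             general_position 3 F \<and> triple_ratio (F 0) (F 1) (F 2) \<noteq> 0) \<and>
          (\<forall>\<alpha> \<in> (lie_a_dual_w0 :: (complex^3^3 \<Rightarrow> real) set).
             s_cochain \<alpha> \<in> cocycles flag_act flag_measure 2 \<and>
             alternating 3 flags (s_cochain \<alpha>) \<and>
             cohom_class flag_act flag_measure 2 (s_cochain \<alpha>) \<in> NHm 2 \<and>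
             q_map (cohom_class flag_act flag_measure 2 (s_cochain \<alpha>)) = \<alpha>))"
  using triple_ratio_section[where 'k = real] triple_ratio_section[where 'k = complex] by (rule conjI)

end
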